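(* The following are equivalent for an (ordinary) category $\mathcal A$: (1) $\mathrm{Pt}(\mathcal A)$ has (small) limits of representables (i.e. $\mathcal A$ is pre-complete); (2) $\mathrm{Lcd}(\mathcal A)$ is complete and contains the representables; (3) $\mathcal P\mathcal A$ has (small) limits of representables; (4) $\mathcal P\mathcal A$ is complete. In that case $\mathcal P\mathcal A=\mathrm{Lcd}(\mathcal A)$ as full subcategories of $[\mathcal A^{op},\mathbf{Set}]$.
   Context: Here $\mathcal V=\mathbf{Set}$ and $\mathcal A$ may be large (but is locally small). $\mathcal P\mathcal A$, the free cocompletion of $\mathcal A$ under small colimits, is the full subcategory of $[\mathcal A^{op},\mathbf{Set}]$ spanned by the small presheaves, i.e. small colimits of representables $\mathcal A(-,A)$. A presheaf $P\colon\mathcal A^{op}\to\mathbf{Set}$ is petty if there is a small family $(A_i)_{i\in I}$ of objects of $\mathcal A$ and an epimorphism $\sum_{i\in I}\mathcal A(-,A_i)\twoheadrightarrow P$; $\mathrm{Pt}(\mathcal A)$ is the full subcategory of $[\mathcal A^{op},\mathbf{Set}]$ spanned by the petty presheaves. A presheaf $L$ is lucid if it is petty and for every petty $P$ and every pair $f,g\colon P\to L$, the equalizer of $(f,g)$ is petty; $\mathrm{Lcd}(\mathcal A)$ is the full subcategory of $\mathrm{Pt}(\mathcal A)$ spanned by the lucid presheaves. "Has limits of representables" means that every small diagram of representable presheaves has a limit in the category in question. *)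

theory Defs
  imports Main "HOL-Library.FuncSet" "HOL-Library.Equipollence"
begin

section \<open>Smallness\<close>

text \<open>
  The role of the universe of small sets is played by a type \<open>'u\<close> whose cardinality is strongly
  inaccessible, i.e. uncountable, strong limit and regular (the three class axioms, in this order).
  A set is small if it has fewer elements than \<open>'u\<close>; every small set is in bijection with a
  small set of elements of \<open>'u\<close>, so that the latter can be taken as the objects of \<open>Set\<close>,
  as index sets of small families, and as the sets of objects and arrows of small categories.
  HOL alone cannot exhibit an instance of the class, just as ZFC alone cannot exhibit a universe.
\<close>

definition small :: "'u set \<Rightarrow> bool" where
  "small X \<longleftrightarrow> X \<prec> (UNIV :: 'u set)"

class universe =
  assumes nat_small: "(UNIV :: nat set) \<prec> (UNIV :: 'a set)"
    and small_Pow: "small (X :: 'a set) \<Longrightarrow> Pow X \<prec> (UNIV :: 'a set)"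
    and small_UN: "small (I :: 'a set) \<Longrightarrow> (\<And>i. i \<in> I \<Longrightarrow> small (F i :: 'a set)) \<Longrightarrow>
           small (\<Union>i\<in>I. F i)"


section \<open>Categories, functors and natural transformations\<close>

text \<open>
  \<open>Comp C X Y Z g f\<close> is the composite of \<open>f : X \<rightarrow> Y\<close> and \<open>g : Y \<rightarrow> Z\<close>. Hom-sets need not be
  disjoint, whence the object arguments of composition.
\<close>

record ('o, 'm) cat =
  Obj :: "'o set"
  Hom :: "'o \<Rightarrow> 'o \<Rightarrow> 'm set"
  Comp :: "'o \<Rightarrow> 'o \<Rightarrow> 'o \<Rightarrow> 'm \<Rightarrow> 'm \<Rightarrow> 'm"
  Id :: "'o \<Rightarrow> 'm"

definition category :: "('o, 'm) cat \<Rightarrow> bool" where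
  "category C \<longleftrightarrow>
     (\<forall>X \<in> Obj C. Id C X \<in> Hom C X X) \<and>
     (\<forall>X \<in> Obj C. \<forall>Y \<in> Obj C. \<forall>Z \<in> Obj C. \<forall>f \<in> Hom C X Y. \<forall>g \<in> Hom C Y Z.
        Comp C X Y Z g f \<in> Hom C X Z) \<and>
     (\<forall>X \<in> Obj C. \<forall>Y \<in> Obj C. \<forall>f \<in> Hom C X Y.
        Comp C X X Y f (Id C X) = f \<and> Comp C X Y Y (Id C Y) f = f) \<and>
     (\<forall>W \<in> Obj C. \<forall>X \<in> Obj C. \<forall>Y \<in> Obj C. \<forall>Z \<in> Obj C.
        \<forall>f \<in> Hom C W X. \<forall>g \<in> Hom C X Y. \<forall>h \<in> Hom C Y Z.
        Comp C W Y Z h (Comp C W X Y g f) = Comp C W X Z (Comp C X Y Z h g) f)"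

definition locally_small :: "('o, 'u) cat \<Rightarrow> bool" where
  "locally_small C \<longleftrightarrow> (\<forall>X \<in> Obj C. \<forall>Y \<in> Obj C. small (Hom C X Y))"

definition small_category :: "('u, 'u) cat \<Rightarrow> bool" where
  "small_category J \<longleftrightarrow> category J \<and> small (Obj J) \<and> locally_small J"

definition opposite :: "('o, 'm) cat \<Rightarrow> ('o, 'm) cat" where
  "opposite C = \<lparr>Obj = Obj C, Hom = (\<lambda>X Y. Hom C Y X),
     Comp = (\<lambda>X Y Z g f. Comp C Z Y X f g), Id = Id C\<rparr>"

definition full_subcategory :: "('o, 'm) cat \<Rightarrow> 'o set \<Rightarrow> ('o, 'm) cat" where
  "full_subcategory C S = \<lparr>Obj = S, Hom = Hom C, Comp = Comp C, Id = Id C\<rparr>"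

definition set_cat :: "('u set, 'u \<Rightarrow> 'u) cat" where
  "set_cat = \<lparr>Obj = {X. small X}, Hom = (\<lambda>X Y. X \<rightarrow>\<^sub>E Y),
     Comp = (\<lambda>X Y Z g f. compose X g f), Id = (\<lambda>X. \<lambda>x\<in>X. x)\<rparr>"

text \<open>
  Values of \<open>omap\<close> and \<open>amap\<close> outside the source category are irrelevant and left
  unconstrained. Natural transformations, in contrast, are \<open>undefined\<close> off the objects, so that
  equality of arrows of a functor category is equality of components.
\<close>

record ('o1, 'm1, 'o2, 'm2) fun_data =
  omap :: "'o1 \<Rightarrow> 'o2"
  amap :: "'o1 \<Rightarrow> 'o1 \<Rightarrow> 'm1 \<Rightarrow> 'm2"

definition is_functor ::
    "('o1, 'm1) cat \<Rightarrow> ('o2, 'm2) cat \<Rightarrow> ('o1, 'm1, 'o2, 'm2) fun_data \<Rightarrow> bool" where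
  "is_functor C D F \<longleftrightarrow>
     (\<forall>X \<in> Obj C. omap F X \<in> Obj D) \<and>
     (\<forall>X \<in> Obj C. \<forall>Y \<in> Obj C. \<forall>f \<in> Hom C X Y. amap F X Y f \<in> Hom D (omap F X) (omap F Y)) \<and>
     (\<forall>X \<in> Obj C. amap F X X (Id C X) = Id D (omap F X)) \<and>
     (\<forall>X \<in> Obj C. \<forall>Y \<in> Obj C. \<forall>Z \<in> Obj C. \<forall>f \<in> Hom C X Y. \<forall>g \<in> Hom C Y Z.
        amap F X Z (Comp C X Y Z g f) =
        Comp D (omap F X) (omap F Y) (omap F Z) (amap F Y Z g) (amap F X Y f))"

definition functor_cat ::
    "('o1, 'm1) cat \<Rightarrow> ('o2, 'm2) cat \<Rightarrow> (('o1, 'm1, 'o2, 'm2) fun_data, 'o1 \<Rightarrow> 'm2) cat" where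
  "functor_cat C D = \<lparr>
     Obj = {F. is_functor C D F},
     Hom = (\<lambda>F G. {t \<in> \<Pi>\<^sub>E X \<in> Obj C. Hom D (omap F X) (omap G X).
        \<forall>X \<in> Obj C. \<forall>Y \<in> Obj C. \<forall>f \<in> Hom C X Y.
          Comp D (omap F X) (omap F Y) (omap G Y) (t Y) (amap F X Y f) =
          Comp D (omap F X) (omap G X) (omap G Y) (amap G X Y f) (t X)}),
     Comp = (\<lambda>F G H s t. \<lambda>X \<in> Obj C. Comp D (omap F X) (omap G X) (omap H X) (s X) (t X)),
     Id = (\<lambda>F. \<lambda>X \<in> Obj C. Id D (omap F X))\<rparr>"


section \<open>Universal constructions\<close>

definition isomorphic :: "('o, 'm) cat \<Rightarrow> 'o \<Rightarrow> 'o \<Rightarrow> bool" where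
  "isomorphic C X Y \<longleftrightarrow> (\<exists>f \<in> Hom C X Y. \<exists>g \<in> Hom C Y X.
     Comp C X Y X g f = Id C X \<and> Comp C Y X Y f g = Id C Y)"

definition is_epi :: "('o, 'm) cat \<Rightarrow> 'o \<Rightarrow> 'o \<Rightarrow> 'm \<Rightarrow> bool" where
  "is_epi C X Y e \<longleftrightarrow> e \<in> Hom C X Y \<and>
     (\<forall>Z \<in> Obj C. \<forall>f \<in> Hom C Y Z. \<forall>g \<in> Hom C Y Z.
        Comp C X Y Z f e = Comp C X Y Z g e \<longrightarrow> f = g)"

definition is_equalizer ::
    "('o, 'm) cat \<Rightarrow> 'o \<Rightarrow> 'o \<Rightarrow> 'm \<Rightarrow> 'm \<Rightarrow> 'o \<Rightarrow> 'm \<Rightarrow> bool" where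
  "is_equalizer C X Y f g E e \<longleftrightarrow>
     E \<in> Obj C \<and> e \<in> Hom C E X \<and> Comp C E X Y f e = Comp C E X Y g e \<and>
     (\<forall>E' \<in> Obj C. \<forall>e' \<in> Hom C E' X. Comp C E' X Y f e' = Comp C E' X Y g e' \<longrightarrow>
        (\<exists>!h. h \<in> Hom C E' E \<and> Comp C E' E X e h = e'))"

definition is_coproduct ::
    "('o, 'm) cat \<Rightarrow> 'i set \<Rightarrow> ('i \<Rightarrow> 'o) \<Rightarrow> 'o \<Rightarrow> ('i \<Rightarrow> 'm) \<Rightarrow> bool" where
  "is_coproduct C I X S inc \<longleftrightarrow>
     S \<in> Obj C \<and> (\<forall>i \<in> I. inc i \<in> Hom C (X i) S) \<and>
     (\<forall>T \<in> Obj C. \<forall>f. (\<forall>i \<in> I. f i \<in> Hom C (X i) T) \<longrightarrow>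
        (\<exists>!h. h \<in> Hom C S T \<and> (\<forall>i \<in> I. Comp C (X i) S T h (inc i) = f i)))"

definition is_cone :: "('j, 'k) cat \<Rightarrow> ('o, 'm) cat \<Rightarrow> ('j, 'k, 'o, 'm) fun_data \<Rightarrow>
    'o \<Rightarrow> ('j \<Rightarrow> 'm) \<Rightarrow> bool" where
  "is_cone J C D L p \<longleftrightarrow> L \<in> Obj C \<and>
     (\<forall>i \<in> Obj J. p i \<in> Hom C L (omap D i)) \<and>
     (\<forall>i \<in> Obj J. \<forall>j \<in> Obj J. \<forall>u \<in> Hom J i j.
        Comp C L (omap D i) (omap D j) (amap D i j u) (p i) = p j)"

definition is_limit :: "('j, 'k) cat \<Rightarrow> ('o, 'm) cat \<Rightarrow> ('j, 'k, 'o, 'm) fun_data \<Rightarrow>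
    'o \<Rightarrow> ('j \<Rightarrow> 'm) \<Rightarrow> bool" where
  "is_limit J C D L p \<longleftrightarrow> is_cone J C D L p \<and>
     (\<forall>L' p'. is_cone J C D L' p' \<longrightarrow>
        (\<exists>!h. h \<in> Hom C L' L \<and> (\<forall>i \<in> Obj J. Comp C L' L (omap D i) (p i) h = p' i)))"

definition is_cocone :: "('j, 'k) cat \<Rightarrow> ('o, 'm) cat \<Rightarrow> ('j, 'k, 'o, 'm) fun_data \<Rightarrow>
    'o \<Rightarrow> ('j \<Rightarrow> 'm) \<Rightarrow> bool" where
  "is_cocone J C D L q \<longleftrightarrow> L \<in> Obj C \<and>
     (\<forall>i \<in> Obj J. q i \<in> Hom C (omap D i) L) \<and>
     (\<forall>i \<in> Obj J. \<forall>j \<in> Obj J. \<forall>u \<in> Hom J i j.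
        Comp C (omap D i) (omap D j) L (q j) (amap D i j u) = q i)"

definition is_colimit :: "('j, 'k) cat \<Rightarrow> ('o, 'm) cat \<Rightarrow> ('j, 'k, 'o, 'm) fun_data \<Rightarrow>
    'o \<Rightarrow> ('j \<Rightarrow> 'm) \<Rightarrow> bool" where
  "is_colimit J C D L q \<longleftrightarrow> is_cocone J C D L q \<and>
     (\<forall>L' q'. is_cocone J C D L' q' \<longrightarrow>
        (\<exists>!h. h \<in> Hom C L L' \<and> (\<forall>i \<in> Obj J. Comp C (omap D i) L L' h (q i) = q' i)))"

text \<open>\<open>C\<close> has limits of all small diagrams in \<open>C\<close> whose objects lie in the class \<open>S\<close>.\<close>

definition has_limits_of :: "'u itself \<Rightarrow> ('o, 'm) cat \<Rightarrow> 'o set \<Rightarrow> bool" where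
  "has_limits_of _ C S \<longleftrightarrow>
     (\<forall>(J :: ('u, 'u) cat) D.
        small_category J \<and> is_functor J C D \<and> (\<forall>j \<in> Obj J. omap D j \<in> S) \<longrightarrow>
        (\<exists>L p. is_limit J C D L p))"

definition complete :: "'u itself \<Rightarrow> ('o, 'm) cat \<Rightarrow> bool" where
  "complete U C \<longleftrightarrow> has_limits_of U C (Obj C)"


section \<open>Small, petty and lucid presheaves\<close>

type_synonym ('o, 'u) presheaf = "('o, 'u, 'u set, 'u \<Rightarrow> 'u) fun_data"
type_synonym ('o, 'u) psh_cat = "(('o, 'u) presheaf, 'o \<Rightarrow> 'u \<Rightarrow> 'u) cat"

definition presheaf_cat :: "('o, 'u) cat \<Rightarrow> ('o, 'u) psh_cat" where
  "presheaf_cat A = functor_cat (opposite A) set_cat"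

definition hom_presheaf :: "('o, 'u) cat \<Rightarrow> 'o \<Rightarrow> ('o, 'u) presheaf" where
  "hom_presheaf A a = \<lparr>omap = (\<lambda>X. Hom A X a),
     amap = (\<lambda>X Y f. \<lambda>h \<in> Hom A X a. Comp A Y X a h f)\<rparr>"

definition representables :: "('o, 'u) cat \<Rightarrow> ('o, 'u) presheaf set" where
  "representables A =
     {P \<in> Obj (presheaf_cat A). \<exists>a \<in> Obj A. isomorphic (presheaf_cat A) P (hom_presheaf A a)}"

definition small_presheaf :: "('o, 'u) cat \<Rightarrow> ('o, 'u) presheaf \<Rightarrow> bool" where
  "small_presheaf A P \<longleftrightarrow>
     (\<exists>(J :: ('u, 'u) cat) D q.
        small_category J \<and> is_functor J (presheaf_cat A) D \<and>
        (\<forall>j \<in> Obj J. omap D j \<in> representables A) \<and>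
        is_colimit J (presheaf_cat A) D P q)"

definition petty :: "('o, 'u) cat \<Rightarrow> ('o, 'u) presheaf \<Rightarrow> bool" where
  "petty A P \<longleftrightarrow> P \<in> Obj (presheaf_cat A) \<and>
     (\<exists>(I :: 'u set) a S inc e.
        small I \<and> (\<forall>i \<in> I. a i \<in> Obj A) \<and>
        is_coproduct (presheaf_cat A) I (\<lambda>i. hom_presheaf A (a i)) S inc \<and>
        is_epi (presheaf_cat A) S P e)"

definition lucid :: "('o, 'u) cat \<Rightarrow> ('o, 'u) presheaf \<Rightarrow> bool" where
  "lucid A L \<longleftrightarrow> petty A L \<and>
     (\<forall>P f g. petty A P \<and> f \<in> Hom (presheaf_cat A) P L \<and> g \<in> Hom (presheaf_cat A) P L \<longrightarrow>
        (\<exists>E e. is_equalizer (presheaf_cat A) P L f g E e \<and> petty A E))"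

definition PA :: "('o, 'u) cat \<Rightarrow> ('o, 'u) psh_cat" where
  "PA A = full_subcategory (presheaf_cat A) {P. small_presheaf A P}"

definition Pt :: "('o, 'u) cat \<Rightarrow> ('o, 'u) psh_cat" where
  "Pt A = full_subcategory (presheaf_cat A) {P. petty A P}"

definition Lcd :: "('o, 'u) cat \<Rightarrow> ('o, 'u) psh_cat" where
  "Lcd A = full_subcategory (presheaf_cat A) {P. lucid A P}"

end

theory Submission
  imports Defs
begin

text \<open>
  The universal property of limits applied to representables shows that in a full subcategory of
  presheaves that contains them a limit must be the pointwise one. Hence each of the four conditions
  says that certain pointwise limits are generated by a small set of elements. Everything is reduced
  to \<open>precomplete\<close>, the generation by a small set of the solutions of any small system of equations
  between arrows into given objects of \<open>A\<close>.

  Under this condition the representables are lucid and pointwise limits of lucid presheaves are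
  lucid, because a small intersection of sieves with small sets of generators again has a small set
  of generators. A lucid presheaf is then the colimit of the representables at a small set of its
  elements, containing generators together with generators of the relations between them. Conversely,
  equality in a colimit of lucid presheaves means being joined by a zigzag; the sieve on which two
  elements are joined by a zigzag of length \<open>n\<close> has a small set of generators by induction on
  \<open>n\<close>, so small presheaves are lucid.
\<close>

section \<open>Small sets of arbitrary type\<close>

text \<open>Presheaves take values in subsets of \<open>'u\<close>, whereas sums, matching families
  and quotients consist of pairs, functions and classes. Such constructions are therefore made as
  actions on sets of any type, with smallness and generation defined at that level, and become
  presheaves only where an object of the presheaf category is required. The given notions are
  universal properties in a presheaf category. Each is turned once into a statement about elements:
  an element is an arrow out of a representable, and an epimorphism is surjective at every object.
  The recurring argument factors each element through one of a small set of generators; for a fixed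
  generator, the condition imposed on the element cuts out a sieve. Since factorizations are not
  canonical, all choices of generators are considered at once. The universe axioms divide the
  labour: regularity collects the generators, the strong limit property bounds the number of
  choices, and uncountability bounds the number of lengths of zigzags.\<close>

text \<open>\<open>small\<close> is confined to sets over \<open>'u\<close> itself. Here the set may
  have any type, so the universe to compare with is passed as a type argument.\<close>

definition usmall :: "'u itself \<Rightarrow> 'a set \<Rightarrow> bool" where
  "usmall _ X \<longleftrightarrow> X \<prec> (UNIV :: 'u set)"

lemma small_iff_usmall: "small X \<longleftrightarrow> usmall TYPE('u) (X :: 'u set)"
  by (simp add: small_def usmall_def)

lemma usmall_lepoll: "usmall U X \<Longrightarrow> Y \<lesssim> X \<Longrightarrow> usmall U Y"
  unfolding usmall_def by (rule lesspoll_trans1)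

lemma usmall_subset: "usmall U X \<Longrightarrow> Y \<subseteq> X \<Longrightarrow> usmall U Y"
  by (rule usmall_lepoll[OF _ subset_imp_lepoll])

lemma usmall_image: "usmall U X \<Longrightarrow> usmall U (f ` X)"
  by (rule usmall_lepoll[OF _ image_lepoll])

lemma usmall_inj_on: "usmall U (f ` X) \<Longrightarrow> inj_on f X \<Longrightarrow> usmall U X"
  by (erule usmall_lepoll) (auto simp: lepoll_def)

text \<open>The passage back to \<open>'u\<close>, required wherever a definition insists on index
  sets, objects or elements of that type.\<close>

lemma usmall_encode:
  assumes "usmall TYPE('u) X"
  obtains f :: "'a \<Rightarrow> 'u" where "inj_on f X" "usmall TYPE('u) (f ` X)"
proof -
  from assms have "X \<lesssim> (UNIV :: 'u set)" by (simp add: usmall_def lesspoll_imp_lepoll)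
  then obtain f :: "'a \<Rightarrow> 'u" where "inj_on f X" unfolding lepoll_def by blast
  with that usmall_image[OF assms] show thesis by blast
qed

lemma universe_infinite: "infinite (UNIV :: 'u::universe set)"
  using nat_small unfolding infinite_le_lepoll by (rule lesspoll_imp_lepoll)

lemma usmall_nat: "usmall TYPE('u::universe) (UNIV :: nat set)"
  by (simp add: usmall_def nat_small)

lemma usmall_countable:
  assumes "inj_on (f :: 'a \<Rightarrow> nat) X" shows "usmall TYPE('u::universe) X"
  by (rule usmall_lepoll[OF usmall_nat]) (use assms in \<open>auto simp: lepoll_def\<close>)

lemma usmall_finite: "finite X \<Longrightarrow> usmall TYPE('u::universe) X"
  using finite_imp_inj_to_nat_seg usmall_countable by metis

lemma ex_pairing: "\<exists>p :: 'u \<times> 'u \<Rightarrow> 'u::universe. inj p"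
  using card_of_Times_same_infinite[OF universe_infinite]
  by (auto dest!: ordIso_imp_ordLeq simp: card_of_ordLeq[symmetric])

text \<open>Regularity is an axiom about unions of sets over \<open>'u\<close>. Indices and fibres
  are therefore coded in \<open>'u\<close> separately, a pairing function joins the two codes, and
  the coded sum is a union indexed by the codes of \<open>I\<close>.\<close>

lemma usmall_Sigma:
  fixes I :: "'i set" and F :: "'i \<Rightarrow> 'b set"
  assumes I: "usmall TYPE('u::universe) I" and F: "\<And>i. i \<in> I \<Longrightarrow> usmall TYPE('u) (F i)"
  shows "usmall TYPE('u) (Sigma I F)"
proof -
  obtain p :: "'u \<times> 'u \<Rightarrow> 'u" where p: "inj p" using ex_pairing by blast
  obtain e :: "'i \<Rightarrow> 'u" where e: "inj_on e I" "usmall TYPE('u) (e ` I)"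
    using usmall_encode[OF I] by blast
  have "\<forall>i\<in>I. \<exists>g :: 'b \<Rightarrow> 'u. inj_on g (F i) \<and> usmall TYPE('u) (g ` F i)"
    using usmall_encode[OF F] by metis
  then obtain g :: "'i \<Rightarrow> 'b \<Rightarrow> 'u"
    where g: "\<And>i. i \<in> I \<Longrightarrow> inj_on (g i) (F i)" "\<And>i. i \<in> I \<Longrightarrow> usmall TYPE('u) (g i ` F i)" by metis
  let ?c = "\<lambda>(i, x). p (e i, g i x)"
  have A: "inj_on ?c (Sigma I F)"
  proof (rule inj_onI, clarify)
    fix i x j y
    assume i: "i \<in> I" "x \<in> F i" and j: "j \<in> I" "y \<in> F j" and "p (e i, g i x) = p (e j, g j y)"
    then have eq: "e i = e j" "g i x = g j y" using injD[OF p] by blast+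
    then have "i = j" using inj_onD[OF e(1)] i j by blast
    then show "i = j \<and> x = y" using inj_onD[OF g(1)] i j eq by blast
  qed
  have B: "usmall TYPE('u) (\<Union>j\<in>e ` I. ?c ` ({inv_into I e j} \<times> F (inv_into I e j)))"
    unfolding small_iff_usmall[symmetric]
  proof (rule small_UN)
    show "small (e ` I)" using e(2) by (simp add: small_iff_usmall)
  next
    fix j assume "j \<in> e ` I"
    then have "inv_into I e j \<in> I" by (rule inv_into_into)
    from F[OF this] have "usmall TYPE('u) (?c ` Pair (inv_into I e j) ` F (inv_into I e j))"
      by (intro usmall_image)
    moreover have "Pair (inv_into I e j) ` F (inv_into I e j) = {inv_into I e j} \<times> F (inv_into I e j)"
      by auto
    ultimately show "small (?c ` ({inv_into I e j} \<times> F (inv_into I e j)))"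
      by (simp add: small_iff_usmall)
  qed
  have C: "?c ` Sigma I F \<subseteq> (\<Union>j\<in>e ` I. ?c ` ({inv_into I e j} \<times> F (inv_into I e j)))"
    using e(1) by (force simp: inv_into_f_f)
  show ?thesis by (rule usmall_inj_on[OF usmall_subset[OF B C] A])
qed

lemma usmall_UN:
  assumes "usmall TYPE('u::universe) I" and "\<And>i. i \<in> I \<Longrightarrow> usmall TYPE('u) (F i)"
  shows "usmall TYPE('u) (\<Union>i\<in>I. F i)"
proof -
  have "(\<Union>i\<in>I. F i) = snd ` Sigma I F" by force
  then show ?thesis using usmall_image[OF usmall_Sigma[OF assms]] by simp
qed

lemma usmall_Un:
  assumes "usmall TYPE('u::universe) X" "usmall TYPE('u) Y" shows "usmall TYPE('u) (X \<union> Y)"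
proof -
  have "usmall TYPE('u) (\<Union>b\<in>UNIV. if b then X else Y)"
    by (rule usmall_UN[OF usmall_finite]) (simp_all add: assms)
  moreover have "(\<Union>b\<in>UNIV. if b then X else Y) = X \<union> Y" by auto
  ultimately show ?thesis by simp
qed

lemma usmall_Pow:
  fixes X :: "'a set"
  assumes "usmall TYPE('u::universe) X" shows "usmall TYPE('u) (Pow X)"
proof -
  obtain e :: "'a \<Rightarrow> 'u" where e: "inj_on e X" "usmall TYPE('u) (e ` X)"
    using usmall_encode[OF assms] by blast
  have "usmall TYPE('u) (Pow (e ` X))"
    using e(2) small_Pow unfolding small_iff_usmall usmall_def by blast
  then show ?thesis
    using usmall_inj_on[of "TYPE('u)" "image e" "Pow X"] e(1)
    by (simp add: image_Pow_surj inj_on_image_Pow)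
qed

text \<open>An extensional function is determined by its graph on \<open>I\<close>, a subset of the
  small set \<open>Sigma I F\<close>; the strong limit property bounds the number of these. It is
  this bound that later permits running through all choices of generators.\<close>

lemma usmall_PiE:
  assumes "usmall TYPE('u::universe) I" and "\<And>i. i \<in> I \<Longrightarrow> usmall TYPE('u) (F i)"
  shows "usmall TYPE('u) (Pi\<^sub>E I F)"
proof (rule usmall_inj_on)
  let ?g = "\<lambda>f. {(i, f i) | i. i \<in> I}"
  have "?g ` Pi\<^sub>E I F \<subseteq> Pow (Sigma I F)" by (auto simp: PiE_iff)
  then show "usmall TYPE('u) (?g ` Pi\<^sub>E I F)"
    using usmall_Pow[OF usmall_Sigma[OF assms]] by (rule usmall_subset[rotated])
  show "inj_on ?g (Pi\<^sub>E I F)"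
  proof (rule inj_onI)
    fix f f' assume f: "f \<in> Pi\<^sub>E I F" "f' \<in> Pi\<^sub>E I F" and eq: "?g f = ?g f'"
    have "f i = f' i" if "i \<in> I" for i
    proof -
      have "(i, f i) \<in> ?g f'" using that eq[symmetric] by blast
      then show ?thesis by blast
    qed
    with f show "f = f'" by (metis PiE_ext)
  qed
qed


section \<open>Universal properties\<close>

lemma complete_imp_limits: "complete U C \<Longrightarrow> S \<subseteq> Obj C \<Longrightarrow> has_limits_of U C S"
  unfolding complete_def has_limits_of_def by blast

lemma coproduct_ex:
  assumes "is_coproduct C I F S inc" "T \<in> Obj C" "\<And>i. i \<in> I \<Longrightarrow> f i \<in> Hom C (F i) T"
  obtains h where "h \<in> Hom C S T" "\<And>i. i \<in> I \<Longrightarrow> Comp C (F i) S T h (inc i) = f i"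
  using assms unfolding is_coproduct_def by meson

lemma coproduct_eqI:
  assumes cop: "is_coproduct C I F S inc" and T: "T \<in> Obj C"
    and h: "h \<in> Hom C S T" and k: "k \<in> Hom C S T"
    and "\<And>i. i \<in> I \<Longrightarrow> Comp C (F i) S T h (inc i) \<in> Hom C (F i) T"
    and eq: "\<And>i. i \<in> I \<Longrightarrow> Comp C (F i) S T h (inc i) = Comp C (F i) S T k (inc i)"
  shows "h = k"
proof -
  have "\<exists>!m. m \<in> Hom C S T \<and> (\<forall>i\<in>I. Comp C (F i) S T m (inc i) = Comp C (F i) S T h (inc i))"
    using assms(1,2,5) unfolding is_coproduct_def by simp
  moreover have "h \<in> Hom C S T \<and> (\<forall>i\<in>I. Comp C (F i) S T h (inc i) = Comp C (F i) S T h (inc i))"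
    using h by simp
  moreover have "k \<in> Hom C S T \<and> (\<forall>i\<in>I. Comp C (F i) S T k (inc i) = Comp C (F i) S T h (inc i))"
    using k eq by simp
  ultimately show ?thesis by (elim ex1E) metis
qed

lemma is_functor_full_subcategory:
  assumes "is_functor J (full_subcategory C S) D" and "S \<subseteq> Obj C"
  shows "is_functor J C D" and "\<And>j. j \<in> Obj J \<Longrightarrow> omap D j \<in> S"
  using assms by (auto simp: is_functor_def full_subcategory_def)

lemma is_limit_full_subcategory:
  assumes "is_limit J C D L p" and "L \<in> S" and "S \<subseteq> Obj C"
  shows "is_limit J (full_subcategory C S) D L p"
  using assms unfolding is_limit_def is_cone_def full_subcategory_def
  by (simp add: subset_iff)

lemma is_functor_full_subcategoryI:
  assumes "is_functor J C D" and "\<And>j. j \<in> Obj J \<Longrightarrow> omap D j \<in> S"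
  shows "is_functor J (full_subcategory C S) D"
  using assms by (simp add: is_functor_def full_subcategory_def)

lemma limit_ex:
  assumes "is_limit J C D L p" "is_cone J C D M q"
  shows "\<exists>m. m \<in> Hom C M L \<and> (\<forall>i \<in> Obj J. Comp C M L (omap D i) (p i) m = q i)"
  using assms unfolding is_limit_def by (blast dest: ex1_implies_ex)

lemma colimit_ex:
  assumes "is_colimit J C D P q" "is_cocone J C D M r"
  obtains m where "m \<in> Hom C P M" "\<And>i. i \<in> Obj J \<Longrightarrow> Comp C (omap D i) P M m (q i) = r i"
  using assms unfolding is_colimit_def by (blast dest: ex1_implies_ex)

text \<open>\<open>C\<close> is an arbitrary record without category axioms, so that
  \<open>f\<close> composed with the colimit cocone is again a cocone has to be supplied by the user
  of the rule.\<close>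

lemma colimit_eqI:
  assumes col: "is_colimit J C D P q" and f: "f \<in> Hom C P M" and g: "g \<in> Hom C P M"
    and cocone: "is_cocone J C D M (\<lambda>i. Comp C (omap D i) P M f (q i))"
    and eq: "\<And>i. i \<in> Obj J \<Longrightarrow> Comp C (omap D i) P M g (q i) = Comp C (omap D i) P M f (q i)"
  shows "f = g"
proof -
  have "\<exists>!h. h \<in> Hom C P M \<and> (\<forall>i\<in>Obj J. Comp C (omap D i) P M h (q i) = Comp C (omap D i) P M f (q i))"
    using col cocone unfolding is_colimit_def by simp
  then show ?thesis using f g eq by (elim ex1E) metis
qed


section \<open>Presheaves and natural transformations\<close>

locale presheaves =
  fixes A :: "('o, 'u::universe) cat"
  assumes category: "category A" and locally_small: "locally_small A"
begin

abbreviation ob where "ob \<equiv> Obj A"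
abbreviation PS where "PS \<equiv> presheaf_cat A"

lemma Id_in [intro, simp]: "c \<in> ob \<Longrightarrow> Id A c \<in> Hom A c c"
  using category by (simp add: category_def)

lemma Comp_in [intro, simp]:
  "\<lbrakk>b \<in> ob; c \<in> ob; d \<in> ob; f \<in> Hom A b c; g \<in> Hom A c d\<rbrakk> \<Longrightarrow> Comp A b c d g f \<in> Hom A b d"
  using category by (simp add: category_def)

lemma Comp_Id [simp]: "\<lbrakk>c \<in> ob; d \<in> ob; f \<in> Hom A c d\<rbrakk> \<Longrightarrow> Comp A c c d f (Id A c) = f"
  using category by (simp add: category_def)

lemma Id_Comp [simp]: "\<lbrakk>c \<in> ob; d \<in> ob; f \<in> Hom A c d\<rbrakk> \<Longrightarrow> Comp A c d d (Id A d) f = f"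
  using category by (simp add: category_def)

lemma Comp_assoc:
  "\<lbrakk>a \<in> ob; b \<in> ob; c \<in> ob; d \<in> ob; f \<in> Hom A a b; g \<in> Hom A b c; h \<in> Hom A c d\<rbrakk> \<Longrightarrow>
   Comp A a c d h (Comp A a b c g f) = Comp A a b d (Comp A b c d h g) f"
  using category unfolding category_def by blast

lemma usmall_Hom: "\<lbrakk>c \<in> ob; d \<in> ob\<rbrakk> \<Longrightarrow> usmall TYPE('u) (Hom A c d)"
  using locally_small by (simp add: locally_small_def small_iff_usmall)


text \<open>A contravariant functor on \<open>A\<close> with values in sets of any type, free of the
  size and extensionality conditions of a presheaf.\<close>

definition action :: "('o \<Rightarrow> 'v set) \<Rightarrow> ('o \<Rightarrow> 'o \<Rightarrow> 'u \<Rightarrow> 'v \<Rightarrow> 'v) \<Rightarrow> bool" where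
  "action V act \<longleftrightarrow>
     (\<forall>c \<in> ob. \<forall>d \<in> ob. \<forall>f \<in> Hom A c d. \<forall>v \<in> V d. act d c f v \<in> V c) \<and>
     (\<forall>c \<in> ob. \<forall>v \<in> V c. act c c (Id A c) v = v) \<and>
     (\<forall>b \<in> ob. \<forall>c \<in> ob. \<forall>d \<in> ob. \<forall>f \<in> Hom A b c. \<forall>g \<in> Hom A c d. \<forall>v \<in> V d.
        act d b (Comp A b c d g f) v = act c b f (act d c g v))"

lemma psh_iff:
  "P \<in> Obj PS \<longleftrightarrow> action (omap P) (amap P) \<and> (\<forall>c \<in> ob. usmall TYPE('u) (omap P c)) \<and>
     (\<forall>c \<in> ob. \<forall>d \<in> ob. \<forall>f \<in> Hom A c d. amap P d c f \<in> extensional (omap P d))"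
  (is "?L \<longleftrightarrow> ?R")
proof
  assume ?L
  then have L: "is_functor (opposite A) set_cat P" by (simp add: presheaf_cat_def functor_cat_def)
  have E: "amap P d c f \<in> omap P d \<rightarrow>\<^sub>E omap P c" if "c \<in> ob" "d \<in> ob" "f \<in> Hom A c d" for c d f
    using L that by (simp add: is_functor_def opposite_def set_cat_def)
  have I: "amap P c c (Id A c) = (\<lambda>x\<in>omap P c. x)" if "c \<in> ob" for c
    using L that by (simp add: is_functor_def opposite_def set_cat_def)
  have C: "amap P d b (Comp A b c d g f) = compose (omap P d) (amap P c b f) (amap P d c g)"
    if "b \<in> ob" "c \<in> ob" "d \<in> ob" "f \<in> Hom A b c" "g \<in> Hom A c d" for b c d f g
    using L that by (simp add: is_functor_def opposite_def set_cat_def)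
  have S: "usmall TYPE('u) (omap P c)" if "c \<in> ob" for c
    using L that by (simp add: is_functor_def opposite_def set_cat_def small_iff_usmall)
  show ?R
    unfolding action_def using E by (auto simp: I C compose_eq S PiE_iff)
next
  assume ?R
  then have S: "\<And>c. c \<in> ob \<Longrightarrow> usmall TYPE('u) (omap P c)"
    and E: "\<And>c d f. \<lbrakk>c \<in> ob; d \<in> ob; f \<in> Hom A c d\<rbrakk> \<Longrightarrow> amap P d c f \<in> omap P d \<rightarrow>\<^sub>E omap P c"
    and I: "\<And>c x. \<lbrakk>c \<in> ob; x \<in> omap P c\<rbrakk> \<Longrightarrow> amap P c c (Id A c) x = x"
    and C: "\<And>b c d f g x. \<lbrakk>b \<in> ob; c \<in> ob; d \<in> ob; f \<in> Hom A b c; g \<in> Hom A c d; x \<in> omap P d\<rbrakk> \<Longrightarrow>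
        amap P d b (Comp A b c d g f) x = amap P c b f (amap P d c g x)"
    by (auto simp: action_def PiE_iff)
  have I': "amap P c c (Id A c) = (\<lambda>x\<in>omap P c. x)" if "c \<in> ob" for c
    by (rule PiE_ext[OF E[OF that that Id_in[OF that]]]) (auto simp: I that)
  have C': "amap P d b (Comp A b c d g f) = compose (omap P d) (amap P c b f) (amap P d c g)"
    if "b \<in> ob" "c \<in> ob" "d \<in> ob" "f \<in> Hom A b c" "g \<in> Hom A c d" for b c d f g
    by (rule extensionalityI[where A = "omap P d"])
       (use that E[of b d "Comp A b c d g f"] in \<open>auto simp: C PiE_iff compose_eq\<close>)
  show ?L
    by (auto simp: presheaf_cat_def functor_cat_def is_functor_def opposite_def set_cat_def
        S[folded small_iff_usmall] E I' C')
qed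

lemma psh_usmall: "\<lbrakk>P \<in> Obj PS; c \<in> ob\<rbrakk> \<Longrightarrow> usmall TYPE('u) (omap P c)"
  by (simp add: psh_iff)

lemma psh_act [intro, simp]:
  "\<lbrakk>P \<in> Obj PS; c \<in> ob; d \<in> ob; f \<in> Hom A c d; x \<in> omap P d\<rbrakk> \<Longrightarrow> amap P d c f x \<in> omap P c"
  by (simp add: psh_iff action_def)

lemma psh_Id [simp]: "\<lbrakk>P \<in> Obj PS; c \<in> ob; x \<in> omap P c\<rbrakk> \<Longrightarrow> amap P c c (Id A c) x = x"
  by (simp add: psh_iff action_def)

lemma psh_Comp [simp]:
  "\<lbrakk>P \<in> Obj PS; b \<in> ob; c \<in> ob; d \<in> ob; f \<in> Hom A b c; g \<in> Hom A c d; x \<in> omap P d\<rbrakk> \<Longrightarrow>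
   amap P d b (Comp A b c d g f) x = amap P c b f (amap P d c g x)"
  by (simp add: psh_iff action_def)

lemma PS_Hom_iff:
  assumes "P \<in> Obj PS" "Q \<in> Obj PS"
  shows "t \<in> Hom PS P Q \<longleftrightarrow> t \<in> (\<Pi>\<^sub>E c \<in> ob. omap P c \<rightarrow>\<^sub>E omap Q c) \<and>
     (\<forall>c \<in> ob. \<forall>d \<in> ob. \<forall>f \<in> Hom A c d. \<forall>x \<in> omap P d.
        t c (amap P d c f x) = amap Q d c f (t d x))"
proof -
  have "compose (omap P d) (t c) (amap P d c f) = compose (omap P d) (amap Q d c f) (t d) \<longleftrightarrow>
      (\<forall>x \<in> omap P d. t c (amap P d c f x) = amap Q d c f (t d x))" for c d f
    by (auto simp: compose_def restrict_def fun_eq_iff)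
  then show ?thesis
    by (auto simp: presheaf_cat_def functor_cat_def opposite_def set_cat_def)
qed

lemma PS_Hom_psh: "t \<in> Hom PS P Q \<Longrightarrow> t \<in> (\<Pi>\<^sub>E c \<in> ob. omap P c \<rightarrow>\<^sub>E omap Q c)"
  by (simp add: presheaf_cat_def functor_cat_def opposite_def set_cat_def)

lemma hom_in [intro]: "\<lbrakk>t \<in> Hom PS P Q; c \<in> ob; x \<in> omap P c\<rbrakk> \<Longrightarrow> t c x \<in> omap Q c"
  using PS_Hom_psh by fastforce

lemma hom_natural:
  "\<lbrakk>P \<in> Obj PS; Q \<in> Obj PS; t \<in> Hom PS P Q; c \<in> ob; d \<in> ob; f \<in> Hom A c d; x \<in> omap P d\<rbrakk> \<Longrightarrow>
   t c (amap P d c f x) = amap Q d c f (t d x)"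
  by (simp add: PS_Hom_iff)

lemma hom_eqI:
  assumes "t \<in> Hom PS P Q" "s \<in> Hom PS P Q"
    and "\<And>c x. \<lbrakk>c \<in> ob; x \<in> omap P c\<rbrakk> \<Longrightarrow> t c x = s c x"
  shows "t = s"
proof (rule PiE_ext)
  show "t \<in> (\<Pi>\<^sub>E c \<in> ob. omap P c \<rightarrow>\<^sub>E omap Q c)" "s \<in> (\<Pi>\<^sub>E c \<in> ob. omap P c \<rightarrow>\<^sub>E omap Q c)"
    using assms(1,2) PS_Hom_psh by blast+
  fix c assume c: "c \<in> ob"
  with assms(1,2) have "t c \<in> omap P c \<rightarrow>\<^sub>E omap Q c" "s c \<in> omap P c \<rightarrow>\<^sub>E omap Q c"
    using PS_Hom_psh by blast+
  then show "t c = s c" by (rule PiE_ext) (simp add: assms(3) c)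
qed

text \<open>Arrows of the presheaf category are \<open>undefined\<close> off the objects and off the
  elements; a formula for the components has to be cut down accordingly.\<close>

definition transf :: "('o, 'u) presheaf \<Rightarrow> ('o \<Rightarrow> 'u \<Rightarrow> 'u) \<Rightarrow> 'o \<Rightarrow> 'u \<Rightarrow> 'u" where
  "transf P \<tau> = (\<lambda>c\<in>ob. \<lambda>x\<in>omap P c. \<tau> c x)"

lemma transf_apply [simp]: "\<lbrakk>c \<in> ob; x \<in> omap P c\<rbrakk> \<Longrightarrow> transf P \<tau> c x = \<tau> c x"
  by (simp add: transf_def)

lemma transf_in:
  assumes "P \<in> Obj PS" "Q \<in> Obj PS"
    and "\<And>c x. \<lbrakk>c \<in> ob; x \<in> omap P c\<rbrakk> \<Longrightarrow> \<tau> c x \<in> omap Q c"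
    and "\<And>c d f x. \<lbrakk>c \<in> ob; d \<in> ob; f \<in> Hom A c d; x \<in> omap P d\<rbrakk> \<Longrightarrow>
        \<tau> c (amap P d c f x) = amap Q d c f (\<tau> d x)"
  shows "transf P \<tau> \<in> Hom PS P Q"
  unfolding PS_Hom_iff[OF assms(1,2)] by (auto simp: assms transf_def)

lemma PS_Comp_apply [simp]:
  "\<lbrakk>c \<in> ob; x \<in> omap P c\<rbrakk> \<Longrightarrow> Comp PS P Q R s t c x = s c (t c x)"
  by (simp add: presheaf_cat_def functor_cat_def opposite_def set_cat_def compose_eq)

lemma PS_Comp_in [intro]:
  assumes "P \<in> Obj PS" "Q \<in> Obj PS" "R \<in> Obj PS" "t \<in> Hom PS P Q" "s \<in> Hom PS Q R"
  shows "Comp PS P Q R s t \<in> Hom PS P R"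
proof -
  have "Comp PS P Q R s t = transf P (\<lambda>c x. s c (t c x))"
    by (simp add: presheaf_cat_def functor_cat_def opposite_def set_cat_def transf_def compose_def)
  moreover have "transf P (\<lambda>c x. s c (t c x)) \<in> Hom PS P R"
    using assms by (intro transf_in)
      (auto simp: hom_natural[OF assms(1,2,4)] hom_natural[OF assms(2,3,5) _ _ _ hom_in[OF assms(4)]])
  ultimately show ?thesis by simp
qed

lemma PS_Comp_eq_iff:
  assumes "P \<in> Obj PS" "Q \<in> Obj PS" "R \<in> Obj PS" "t \<in> Hom PS P Q" "s \<in> Hom PS Q R" "r \<in> Hom PS P R"
  shows "Comp PS P Q R s t = r \<longleftrightarrow> (\<forall>c \<in> ob. \<forall>x \<in> omap P c. s c (t c x) = r c x)"
proof
  assume "\<forall>c \<in> ob. \<forall>x \<in> omap P c. s c (t c x) = r c x"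
  then show "Comp PS P Q R s t = r"
    using assms by (intro hom_eqI[where P = P and Q = R]) auto
qed auto

lemma PS_Id_apply [simp]: "\<lbrakk>c \<in> ob; x \<in> omap P c\<rbrakk> \<Longrightarrow> Id PS P c x = x"
  by (simp add: presheaf_cat_def functor_cat_def opposite_def set_cat_def)

lemma PS_Id_in [intro]:
  assumes "P \<in> Obj PS" shows "Id PS P \<in> Hom PS P P"
proof -
  have "Id PS P = transf P (\<lambda>c x. x)"
    by (simp add: presheaf_cat_def functor_cat_def opposite_def set_cat_def transf_def)
  then show ?thesis using transf_in[of P P "\<lambda>c x. x"] assms by simp
qed

section \<open>Representable presheaves and the Yoneda lemma\<close>

lemma hom_presheaf_omap [simp]: "omap (hom_presheaf A a) c = Hom A c a"
  by (simp add: hom_presheaf_def)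

lemma hom_presheaf_amap [simp]:
  "h \<in> Hom A d a \<Longrightarrow> amap (hom_presheaf A a) d c f h = Comp A c d a h f"
  by (simp add: hom_presheaf_def)

lemma hom_presheaf_psh [intro, simp]: "a \<in> ob \<Longrightarrow> hom_presheaf A a \<in> Obj PS"
  unfolding psh_iff action_def by (auto simp: usmall_Hom Comp_assoc) (simp add: hom_presheaf_def)

text \<open>The arrow out of the representable at \<open>a\<close> that the Yoneda lemma assigns to
  the element \<open>x\<close>.\<close>

definition yon :: "('o, 'u) presheaf \<Rightarrow> 'o \<Rightarrow> 'u \<Rightarrow> 'o \<Rightarrow> 'u \<Rightarrow> 'u" where
  "yon P a x = transf (hom_presheaf A a) (\<lambda>c h. amap P a c h x)"

lemma yon_apply [simp]: "\<lbrakk>c \<in> ob; h \<in> Hom A c a\<rbrakk> \<Longrightarrow> yon P a x c h = amap P a c h x"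
  by (simp add: yon_def)

lemma yon_in [intro]:
  "\<lbrakk>P \<in> Obj PS; a \<in> ob; x \<in> omap P a\<rbrakk> \<Longrightarrow> yon P a x \<in> Hom PS (hom_presheaf A a) P"
  unfolding yon_def by (rule transf_in) auto

lemma yoneda:
  assumes "P \<in> Obj PS" "a \<in> ob" "t \<in> Hom PS (hom_presheaf A a) P" "c \<in> ob" "h \<in> Hom A c a"
  shows "t c h = amap P a c h (t a (Id A a))"
  using hom_natural[of "hom_presheaf A a" P t c a h "Id A a"] assms by simp

text \<open>Each set \<open>V c\<close> is embedded into \<open>'u\<close> on its own and the action
  is conjugated with the embeddings. This is how an action on pairs, families or classes becomes an
  object of the presheaf category.\<close>

lemma ex_transport:
  fixes V :: "'o \<Rightarrow> 'v set"
  assumes act: "action V act" and V: "\<And>c. c \<in> ob \<Longrightarrow> usmall TYPE('u) (V c)"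
  obtains P \<theta> where "P \<in> Obj PS" "\<And>c. c \<in> ob \<Longrightarrow> bij_betw (\<theta> c) (V c) (omap P c)"
    "\<And>c d f v. \<lbrakk>c \<in> ob; d \<in> ob; f \<in> Hom A c d; v \<in> V d\<rbrakk> \<Longrightarrow>
       amap P d c f (\<theta> d v) = \<theta> c (act d c f v)"
proof -
  have "\<forall>c\<in>ob. \<exists>e :: 'v \<Rightarrow> 'u. inj_on e (V c) \<and> usmall TYPE('u) (e ` V c)"
    using usmall_encode[OF V] by metis
  then obtain \<theta> :: "'o \<Rightarrow> 'v \<Rightarrow> 'u"
    where \<theta>: "\<And>c. c \<in> ob \<Longrightarrow> inj_on (\<theta> c) (V c)" "\<And>c. c \<in> ob \<Longrightarrow> usmall TYPE('u) (\<theta> c ` V c)"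
    by metis
  define P :: "('o, 'u) presheaf" where "P = \<lparr>omap = \<lambda>c. \<theta> c ` V c,
    amap = \<lambda>d c f. \<lambda>x\<in>\<theta> d ` V d. \<theta> c (act d c f (inv_into (V d) (\<theta> d) x))\<rparr>"
  have o [simp]: "omap P c = \<theta> c ` V c" for c by (simp add: P_def)
  have a [simp]: "amap P d c f (\<theta> d v) = \<theta> c (act d c f v)" if "d \<in> ob" "v \<in> V d" for c d f v
    using that \<theta>(1) by (simp add: P_def)
  show thesis
  proof (rule that)
    show "P \<in> Obj PS" unfolding psh_iff action_def
      using act \<theta>(2) by (auto simp: action_def) (simp add: P_def)
    show "bij_betw (\<theta> c) (V c) (omap P c)" if "c \<in> ob" for c
      by (simp add: bij_betw_def \<theta>(1) that)
  qed simp
qed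


subsection \<open>Petty presheaves\<close>

text \<open>Pettiness in terms of elements, for actions of any type. A generator is stored with its
  object, since the sets \<open>V c\<close> for different \<open>c\<close> may overlap.\<close>

definition generated :: "('o \<Rightarrow> 'v set) \<Rightarrow> ('o \<Rightarrow> 'o \<Rightarrow> 'u \<Rightarrow> 'v \<Rightarrow> 'v) \<Rightarrow> bool" where
  "generated V act \<longleftrightarrow> (\<exists>G \<subseteq> Sigma ob V. usmall TYPE('u) G \<and>
     (\<forall>c \<in> ob. \<forall>v \<in> V c. \<exists>(d, w) \<in> G. \<exists>f \<in> Hom A c d. v = act d c f w))"

lemma generatedE:
  assumes "generated V act"
  obtains G where "usmall TYPE('u) G" "\<And>d w. (d, w) \<in> G \<Longrightarrow> d \<in> ob \<and> w \<in> V d"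
    "\<And>c v. \<lbrakk>c \<in> ob; v \<in> V c\<rbrakk> \<Longrightarrow> \<exists>d w f. (d, w) \<in> G \<and> f \<in> Hom A c d \<and> v = act d c f w"
proof -
  from assms obtain G where G: "G \<subseteq> Sigma ob V" "usmall TYPE('u) G"
    "\<forall>c \<in> ob. \<forall>v \<in> V c. \<exists>(d, w) \<in> G. \<exists>f \<in> Hom A c d. v = act d c f w"
    unfolding generated_def by blast
  show thesis by (rule that[OF G(2)]) (use G(1,3) in fast)+
qed

lemma generatedI:
  assumes "usmall TYPE('u) G" "\<And>d w. (d, w) \<in> G \<Longrightarrow> d \<in> ob \<and> w \<in> V d"
    "\<And>c v. \<lbrakk>c \<in> ob; v \<in> V c\<rbrakk> \<Longrightarrow> \<exists>d w f. (d, w) \<in> G \<and> f \<in> Hom A c d \<and> v = act d c f w"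
  shows "generated V act"
  unfolding generated_def by (rule exI[of _ G]) (use assms in fast)

text \<open>Jointly surjective natural maps send generators to generators, and regularity keeps
  their union small. Nearly all later generation results arise by exhibiting such a cover, whose
  members are indexed by generators or by choices of generators.\<close>

lemma generated_cover:
  fixes V :: "'m \<Rightarrow> 'o \<Rightarrow> 'v set" and W :: "'o \<Rightarrow> 'w set"
  assumes M: "usmall TYPE('u) M"
    and V: "\<And>m. m \<in> M \<Longrightarrow> generated (V m) (actV m)"
    and \<phi>: "\<And>m c v. \<lbrakk>m \<in> M; c \<in> ob; v \<in> V m c\<rbrakk> \<Longrightarrow> \<phi> m c v \<in> W c"
    and nat: "\<And>m c d f v. \<lbrakk>m \<in> M; c \<in> ob; d \<in> ob; f \<in> Hom A c d; v \<in> V m d\<rbrakk> \<Longrightarrow>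
      \<phi> m c (actV m d c f v) = actW d c f (\<phi> m d v)"
    and surj: "\<And>c w. \<lbrakk>c \<in> ob; w \<in> W c\<rbrakk> \<Longrightarrow> \<exists>m v. m \<in> M \<and> v \<in> V m c \<and> w = \<phi> m c v"
  shows "generated W actW"
proof -
  have "\<forall>m\<in>M. \<exists>G. usmall TYPE('u) G \<and> (\<forall>d w. (d, w) \<in> G \<longrightarrow> d \<in> ob \<and> w \<in> V m d) \<and>
      (\<forall>c v. c \<in> ob \<and> v \<in> V m c \<longrightarrow> (\<exists>d w f. (d, w) \<in> G \<and> f \<in> Hom A c d \<and> v = actV m d c f w))"
  proof
    fix m assume "m \<in> M"
    from generatedE[OF V[OF this]] show "\<exists>G. usmall TYPE('u) G \<and> (\<forall>d w. (d, w) \<in> G \<longrightarrow> d \<in> ob \<and> w \<in> V m d) \<and>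
      (\<forall>c v. c \<in> ob \<and> v \<in> V m c \<longrightarrow> (\<exists>d w f. (d, w) \<in> G \<and> f \<in> Hom A c d \<and> v = actV m d c f w))"
      by metis
  qed
  from bchoice[OF this] obtain G where G: "\<And>m. m \<in> M \<Longrightarrow> usmall TYPE('u) (G m)"
    "\<And>m d w. \<lbrakk>m \<in> M; (d, w) \<in> G m\<rbrakk> \<Longrightarrow> d \<in> ob \<and> w \<in> V m d"
    "\<And>m c v. \<lbrakk>m \<in> M; c \<in> ob; v \<in> V m c\<rbrakk> \<Longrightarrow>
       \<exists>d w f. (d, w) \<in> G m \<and> f \<in> Hom A c d \<and> v = actV m d c f w"
    by blast
  show ?thesis
  proof (rule generatedI)
    show "usmall TYPE('u) (\<Union>m\<in>M. (\<lambda>(d, w). (d, \<phi> m d w)) ` G m)"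
      by (intro usmall_UN M usmall_image G(1))
  next
    fix d w assume "(d, w) \<in> (\<Union>m\<in>M. (\<lambda>(d, w). (d, \<phi> m d w)) ` G m)"
    then show "d \<in> ob \<and> w \<in> W d" using G(2) \<phi> by fast
  next
    fix c w assume c: "c \<in> ob" and "w \<in> W c"
    with surj obtain m v where m: "m \<in> M" "v \<in> V m c" "w = \<phi> m c v" by blast
    with G(3) c obtain d u f where d: "(d, u) \<in> G m" "f \<in> Hom A c d" "v = actV m d c f u" by blast
    with G(2) m have "d \<in> ob" "u \<in> V m d" by blast+
    with nat[OF m(1) c _ d(2)] m d have "w = actW d c f (\<phi> m d u)" by simp
    moreover have "(d, \<phi> m d u) \<in> (\<Union>m\<in>M. (\<lambda>(d, w). (d, \<phi> m d w)) ` G m)" using m d by force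
    ultimately show "\<exists>d w' f. (d, w') \<in> (\<Union>m\<in>M. (\<lambda>(d, w). (d, \<phi> m d w)) ` G m) \<and>
        f \<in> Hom A c d \<and> w = actW d c f w'" using d(2) by blast
  qed
qed

lemma generated_surj:
  fixes V :: "'o \<Rightarrow> 'v set" and W :: "'o \<Rightarrow> 'w set"
  assumes V: "generated V actV"
    and \<phi>: "\<And>c v. \<lbrakk>c \<in> ob; v \<in> V c\<rbrakk> \<Longrightarrow> \<phi> c v \<in> W c"
    and nat: "\<And>c d f v. \<lbrakk>c \<in> ob; d \<in> ob; f \<in> Hom A c d; v \<in> V d\<rbrakk> \<Longrightarrow>
      \<phi> c (actV d c f v) = actW d c f (\<phi> d v)"
    and surj: "\<And>c w. \<lbrakk>c \<in> ob; w \<in> W c\<rbrakk> \<Longrightarrow> \<exists>v. v \<in> V c \<and> w = \<phi> c v"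
  shows "generated W actW"
  by (rule generated_cover[where M = "{()}" and V = "\<lambda>_. V" and actV = "\<lambda>_. actV" and \<phi> = "\<lambda>_. \<phi>"])
     (use assms in \<open>auto intro: usmall_finite\<close>)

text \<open>The two maps compared here have as target two copies of \<open>P\<close> glued along \<open>Q\<close>.\<close>

lemma jointly_epi_covers:
  assumes P: "P \<in> Obj PS" and Q: "\<And>c. c \<in> ob \<Longrightarrow> Q c \<subseteq> omap P c"
    and cl: "\<And>c d f x. \<lbrakk>c \<in> ob; d \<in> ob; f \<in> Hom A c d; x \<in> Q d\<rbrakk> \<Longrightarrow> amap P d c f x \<in> Q c"
    and epi: "\<And>Z f g. \<lbrakk>Z \<in> Obj PS; f \<in> Hom PS P Z; g \<in> Hom PS P Z;
      \<And>c x. \<lbrakk>c \<in> ob; x \<in> Q c\<rbrakk> \<Longrightarrow> f c x = g c x\<rbrakk> \<Longrightarrow> f = g"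
    and c: "c \<in> ob" and x: "x \<in> omap P c"
  shows "x \<in> Q c"
proof -
  \<comment> \<open>The flag \<open>True\<close> marks the second copy, which has points only
    outside \<open>Q\<close>. Restriction clears the flag as soon as a point enters
    \<open>Q\<close>, so the action stays inside \<open>V\<close>.\<close>
  define V where "V c = {(x, b). x \<in> omap P c \<and> (b \<longrightarrow> x \<notin> Q c)}" for c
  define act where "act d c f = (\<lambda>(x, b). (amap P d c f x, b \<and> amap P d c f x \<notin> Q c))" for d c f
  have "action V act"
    unfolding action_def V_def act_def using P cl by auto
  moreover have "usmall TYPE('u) (V c)" if "c \<in> ob" for c
    by (rule usmall_subset[of _ "omap P c \<times> UNIV"])
       (auto simp: V_def intro!: usmall_Sigma[OF psh_usmall[OF P that] usmall_finite])
  ultimately obtain Z \<theta> where Z: "Z \<in> Obj PS"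
    and bij: "\<And>c. c \<in> ob \<Longrightarrow> bij_betw (\<theta> c) (V c) (omap Z c)"
    and nat: "\<And>c d f v. \<lbrakk>c \<in> ob; d \<in> ob; f \<in> Hom A c d; v \<in> V d\<rbrakk> \<Longrightarrow>
       amap Z d c f (\<theta> d v) = \<theta> c (act d c f v)"
    using ex_transport by blast
  have in_Z: "\<theta> c v \<in> omap Z c" if "c \<in> ob" "v \<in> V c" for c v
    using bij that by (auto simp: bij_betw_def)
  let ?f = "transf P (\<lambda>c x. \<theta> c (x, False))" and ?g = "transf P (\<lambda>c x. \<theta> c (x, x \<notin> Q c))"
  have "?f \<in> Hom PS P Z"
    by (rule transf_in) (auto simp: P Z in_Z nat V_def act_def)
  moreover have "?g \<in> Hom PS P Z"
  proof (rule transf_in[OF P Z])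
    fix c d f x assume cd: "c \<in> ob" "d \<in> ob" "f \<in> Hom A c d" and x: "x \<in> omap P d"
    have "(x \<notin> Q d \<and> amap P d c f x \<notin> Q c) = (amap P d c f x \<notin> Q c)" using cl cd by blast
    then show "\<theta> c (amap P d c f x, amap P d c f x \<notin> Q c) = amap Z d c f (\<theta> d (x, x \<notin> Q d))"
      using cd x by (simp add: nat V_def act_def)
  qed (simp add: in_Z V_def)
  moreover have "?f c x = ?g c x" if "c \<in> ob" "x \<in> Q c" for c x
    using that Q by (simp add: subset_iff)
  ultimately have "?f = ?g" using epi Z by blast
  then have "\<theta> c (x, False) = \<theta> c (x, x \<notin> Q c)" using c x by (metis (no_types, lifting) transf_apply)
  then show ?thesis
    using bij[OF c] x by (auto simp: bij_betw_def inj_on_def V_def)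
qed

lemma surj_imp_epi:
  assumes P: "P \<in> Obj PS" and Q: "Q \<in> Obj PS" and e: "e \<in> Hom PS P Q"
    and surj: "\<And>c y. \<lbrakk>c \<in> ob; y \<in> omap Q c\<rbrakk> \<Longrightarrow> \<exists>x \<in> omap P c. y = e c x"
  shows "is_epi PS P Q e"
  unfolding is_epi_def
proof (intro conjI e ballI impI)
  fix Z f g
  assume Z: "Z \<in> Obj PS" and f: "f \<in> Hom PS Q Z" and g: "g \<in> Hom PS Q Z"
    and eq: "Comp PS P Q Z f e = Comp PS P Q Z g e"
  show "f = g"
  proof (rule hom_eqI[OF f g])
    fix c y assume c: "c \<in> ob" and "y \<in> omap Q c"
    then obtain x where x: "x \<in> omap P c" "y = e c x" using surj by blast
    then show "f c y = g c y" using fun_cong[OF fun_cong[OF eq], of c x] c by simp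
  qed
qed

text \<open>The disjoint union formed at each object. It provides the sum of representables that the
  definition of \<open>petty\<close> asks for, and its injections are visibly jointly
  surjective.\<close>

lemma ex_coproduct:
  assumes I: "usmall TYPE('u) I" and F: "\<And>i. i \<in> I \<Longrightarrow> F i \<in> Obj PS"
  obtains S inc where "is_coproduct PS I F S inc"
    "\<And>c s. \<lbrakk>c \<in> ob; s \<in> omap S c\<rbrakk> \<Longrightarrow> \<exists>i\<in>I. \<exists>x\<in>omap (F i) c. s = inc i c x"
proof -
  define V where "V c = Sigma I (\<lambda>i. omap (F i) c)" for c
  define act where "act d c f = (\<lambda>(i, x). (i, amap (F i) d c f x))" for d c f
  have "action V act"
    unfolding action_def V_def act_def using F by auto
  moreover have "usmall TYPE('u) (V c)" if "c \<in> ob" for c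
    unfolding V_def by (intro usmall_Sigma I psh_usmall F that)
  ultimately obtain S \<theta> where S: "S \<in> Obj PS"
    and bij: "\<And>c. c \<in> ob \<Longrightarrow> bij_betw (\<theta> c) (V c) (omap S c)"
    and nat: "\<And>c d f v. \<lbrakk>c \<in> ob; d \<in> ob; f \<in> Hom A c d; v \<in> V d\<rbrakk> \<Longrightarrow>
       amap S d c f (\<theta> d v) = \<theta> c (act d c f v)"
    using ex_transport by blast
  define inc where "inc i = transf (F i) (\<lambda>c x. \<theta> c (i, x))" for i
  define \<kappa> where "\<kappa> c = inv_into (V c) (\<theta> c)" for c
  have \<kappa>\<theta> [simp]: "\<kappa> c (\<theta> c v) = v" if "c \<in> ob" "v \<in> V c" for c v
    unfolding \<kappa>_def by (rule bij_betw_inv_into_left[OF bij[OF that(1)] that(2)])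
  have \<theta>_in: "\<theta> c v \<in> omap S c" if "c \<in> ob" "v \<in> V c" for c v
    using bij that by (auto simp: bij_betw_def)
  have surj: "\<exists>i\<in>I. \<exists>x\<in>omap (F i) c. s = \<theta> c (i, x)" if "c \<in> ob" "s \<in> omap S c" for c s
  proof -
    from bij[OF that(1)] that(2) obtain v where "v \<in> V c" "s = \<theta> c v"
      unfolding bij_betw_def by blast
    then show ?thesis by (auto simp: V_def)
  qed
  have inc: "inc i \<in> Hom PS (F i) S" if "i \<in> I" for i
    unfolding inc_def using that by (intro transf_in F S) (auto simp: \<theta>_in V_def nat act_def F)
  show thesis
  proof (rule that)
    show "is_coproduct PS I F S inc"
      unfolding is_coproduct_def
    proof (intro conjI ballI allI impI S)
      fix T f assume T: "T \<in> Obj PS" and f: "\<forall>i\<in>I. f i \<in> Hom PS (F i) T"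
      let ?h = "transf S (\<lambda>c s. case \<kappa> c s of (i, x) \<Rightarrow> f i c x)"
      have h: "?h \<in> Hom PS S T"
      proof (rule transf_in[OF S T])
        fix c s assume c: "c \<in> ob" and "s \<in> omap S c"
        with surj obtain i x where "i \<in> I" "x \<in> omap (F i) c" "s = \<theta> c (i, x)" by blast
        then show "(case \<kappa> c s of (i, x) \<Rightarrow> f i c x) \<in> omap T c" using c f by (auto simp: V_def)
      next
        fix c d g s assume cd: "c \<in> ob" "d \<in> ob" "g \<in> Hom A c d" and "s \<in> omap S d"
        with surj obtain i x where i: "i \<in> I" "x \<in> omap (F i) d" "s = \<theta> d (i, x)" by blast
        then have "(i, x) \<in> V d" by (simp add: V_def)
        then show "(case \<kappa> c (amap S d c g s) of (i, x) \<Rightarrow> f i c x) =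
            amap T d c g (case \<kappa> d s of (i, x) \<Rightarrow> f i d x)"
          using i cd f F[OF i(1)] T nat[OF cd] by (auto simp: V_def act_def hom_natural)
      qed
      show "\<exists>!h. h \<in> Hom PS S T \<and> (\<forall>i\<in>I. Comp PS (F i) S T h (inc i) = f i)"
      proof (rule ex1I[of _ ?h])
        show "?h \<in> Hom PS S T \<and> (\<forall>i\<in>I. Comp PS (F i) S T ?h (inc i) = f i)"
          using h f inc F S T by (auto simp: PS_Comp_eq_iff) (auto simp: inc_def \<theta>_in V_def)
      next
        fix h assume h': "h \<in> Hom PS S T \<and> (\<forall>i\<in>I. Comp PS (F i) S T h (inc i) = f i)"
        show "h = ?h"
        proof (rule hom_eqI)
          fix c s assume c: "c \<in> ob" and "s \<in> omap S c"
          with surj obtain i x where i: "i \<in> I" "x \<in> omap (F i) c" "s = \<theta> c (i, x)" by blast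
          with h' have "Comp PS (F i) S T h (inc i) c x = f i c x" by simp
          then show "h c s = ?h c s" using i c by (simp add: inc_def \<theta>_in V_def)
        qed (use h h' in auto)
      qed
    qed (rule inc)
    show "\<exists>i\<in>I. \<exists>x\<in>omap (F i) c. s = inc i c x" if "c \<in> ob" "s \<in> omap S c" for c s
      using surj[OF that] that(1) by (auto simp: inc_def)
  qed
qed

text \<open>An epimorphism of presheaves is surjective at every object by
  \<open>jointly_epi_covers\<close>, so the images of the identities in the summands generate.
  Conversely, generators are arrows out of representables by Yoneda, and together they give an arrow
  out of the sum which is surjective, hence epi.\<close>

lemma petty_iff: "petty A P \<longleftrightarrow> P \<in> Obj PS \<and> generated (omap P) (amap P)"
proof (intro iffI conjI)
  assume petty: "petty A P"
  then show P: "P \<in> Obj PS" by (simp add: petty_def)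
  from petty obtain I :: "'u set" and a S inc e where I: "usmall TYPE('u) I"
    and a: "\<And>i. i \<in> I \<Longrightarrow> a i \<in> ob"
    and cop: "is_coproduct PS I (\<lambda>i. hom_presheaf A (a i)) S inc" and epi: "is_epi PS S P e"
    unfolding petty_def small_iff_usmall by blast
  have S: "S \<in> Obj PS" and inc: "\<And>i. i \<in> I \<Longrightarrow> inc i \<in> Hom PS (hom_presheaf A (a i)) S"
    using cop by (auto simp: is_coproduct_def)
  have e: "e \<in> Hom PS S P" using epi by (simp add: is_epi_def)
  \<comment> \<open>The element of \<open>P\<close> that Yoneda assigns to the composite of
    \<open>inc i\<close> and \<open>e\<close>.\<close>
  define x where "x i = e (a i) (inc i (a i) (Id A (a i)))" for i
  have x: "x i \<in> omap P (a i)" if "i \<in> I" for i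
    unfolding x_def using hom_in[OF e a[OF that] hom_in[OF inc[OF that] a[OF that]]] a[OF that] by simp
  have e_inc: "e c (inc i c h) = amap P (a i) c h (x i)" if "c \<in> ob" "i \<in> I" "h \<in> Hom A c (a i)" for c i h
    using yoneda[OF S a inc that(1,3)] that a
      hom_natural[OF S P e that(1) a that(3) hom_in[OF inc a]] by (simp add: x_def)
  \<comment> \<open>The subpresheaf generated by the \<open>x i\<close>. Arrows out of
    \<open>P\<close> that agree on it agree after composition with \<open>e\<close>, as can be
    checked on each summand, and \<open>e\<close> is epi.\<close>
  define Q where "Q c = {amap P (a i) c h (x i) | i h. i \<in> I \<and> h \<in> Hom A c (a i)}" for c
  have cover: "y \<in> Q c" if "c \<in> ob" "y \<in> omap P c" for c y
  proof (rule jointly_epi_covers[OF P _ _ _ that])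
    show "Q c \<subseteq> omap P c" if "c \<in> ob" for c using that P x a by (auto simp: Q_def)
  next
    fix c d f y assume cd: "c \<in> ob" "d \<in> ob" "f \<in> Hom A c d" and "y \<in> Q d"
    then obtain i h where i: "i \<in> I" "h \<in> Hom A d (a i)" "y = amap P (a i) d h (x i)"
      by (auto simp: Q_def)
    then have "amap P d c f y = amap P (a i) c (Comp A c d (a i) h f) (x i)"
      using cd P a x by simp
    moreover have "Comp A c d (a i) h f \<in> Hom A c (a i)" using i cd a by blast
    ultimately show "amap P d c f y \<in> Q c" using i(1) unfolding Q_def by blast
  next
    fix Z f g assume Z: "Z \<in> Obj PS" and f: "f \<in> Hom PS P Z" and g: "g \<in> Hom PS P Z"
      and eq: "\<And>c y. \<lbrakk>c \<in> ob; y \<in> Q c\<rbrakk> \<Longrightarrow> f c y = g c y"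
    let ?fe = "Comp PS S P Z f e" and ?ge = "Comp PS S P Z g e"
    have fe: "?fe \<in> Hom PS S Z" and ge: "?ge \<in> Hom PS S Z" using S P Z e f g by blast+
    have "?fe = ?ge"
    proof (rule coproduct_eqI[OF cop Z fe ge])
      show fi: "Comp PS (hom_presheaf A (a i)) S Z ?fe (inc i) \<in> Hom PS (hom_presheaf A (a i)) Z"
        if "i \<in> I" for i
        by (rule PS_Comp_in[OF hom_presheaf_psh[OF a[OF that]] S Z inc[OF that] fe])
      fix i assume i: "i \<in> I"
      show "Comp PS (hom_presheaf A (a i)) S Z ?fe (inc i) =
          Comp PS (hom_presheaf A (a i)) S Z ?ge (inc i)"
      proof (rule hom_eqI[OF fi[OF i] PS_Comp_in[OF hom_presheaf_psh[OF a[OF i]] S Z inc[OF i] ge]])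
        fix c h assume c: "c \<in> ob" "h \<in> omap (hom_presheaf A (a i)) c"
        then have "e c (inc i c h) \<in> Q c" using e_inc i by (auto simp: Q_def)
        moreover have "inc i c h \<in> omap S c" using hom_in[OF inc[OF i]] c by blast
        ultimately show "Comp PS (hom_presheaf A (a i)) S Z ?fe (inc i) c h =
            Comp PS (hom_presheaf A (a i)) S Z ?ge (inc i) c h" using c eq by simp
      qed
    qed
    then show "f = g" using epi f g Z by (simp add: is_epi_def)
  qed
  show "generated (omap P) (amap P)"
  proof (rule generatedI)
    show "usmall TYPE('u) ((\<lambda>i. (a i, x i)) ` I)" using I by (rule usmall_image)
  next
    fix c y assume "c \<in> ob" "y \<in> omap P c"
    then obtain i h where "i \<in> I" "h \<in> Hom A c (a i)" "y = amap P (a i) c h (x i)"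
      using cover unfolding Q_def by blast
    then show "\<exists>d w f. (d, w) \<in> (\<lambda>i. (a i, x i)) ` I \<and> f \<in> Hom A c d \<and> y = amap P d c f w" by blast
  qed (use x a in auto)
next
  assume P: "P \<in> Obj PS \<and> generated (omap P) (amap P)"
  then obtain G where G: "usmall TYPE('u) G" "\<And>d w. (d, w) \<in> G \<Longrightarrow> d \<in> ob \<and> w \<in> omap P d"
    "\<And>c v. \<lbrakk>c \<in> ob; v \<in> omap P c\<rbrakk> \<Longrightarrow> \<exists>d w f. (d, w) \<in> G \<and> f \<in> Hom A c d \<and> v = amap P d c f w"
    using generatedE by metis
  obtain e :: "_ \<Rightarrow> 'u" where e: "inj_on e G" "usmall TYPE('u) (e ` G)" using usmall_encode[OF G(1)] by blast
  \<comment> \<open>The index set in \<open>petty\<close> has to lie in \<open>'u\<close>; the sum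
    is thus taken over codes of generators, which \<open>a\<close> and \<open>x\<close>
    decode.\<close>
  define a x where "a i = fst (inv_into G e i)" and "x i = snd (inv_into G e i)" for i
  have ax: "a i \<in> ob \<and> x i \<in> omap P (a i)" if "i \<in> e ` G" for i
    using G(2)[of "a i" "x i"] inv_into_into[OF that] by (simp add: a_def x_def)
  obtain S inc where S: "is_coproduct PS (e ` G) (\<lambda>i. hom_presheaf A (a i)) S inc"
    "\<And>c s. \<lbrakk>c \<in> ob; s \<in> omap S c\<rbrakk> \<Longrightarrow> \<exists>i\<in>e ` G. \<exists>h\<in>omap (hom_presheaf A (a i)) c. s = inc i c h"
    using ex_coproduct[OF e(2), of "\<lambda>i. hom_presheaf A (a i)"] ax by blast
  have inc: "inc i \<in> Hom PS (hom_presheaf A (a i)) S" if "i \<in> e ` G" for i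
    using S(1) that unfolding is_coproduct_def by blast
  obtain t where t: "t \<in> Hom PS S P"
    "\<And>i. i \<in> e ` G \<Longrightarrow> Comp PS (hom_presheaf A (a i)) S P t (inc i) = yon P (a i) (x i)"
    using coproduct_ex[OF S(1), of P "\<lambda>i. yon P (a i) (x i)"] ax P yon_in by metis
  have "is_epi PS S P t"
  proof (rule surj_imp_epi)
    fix c y assume c: "c \<in> ob" and "y \<in> omap P c"
    with G(3) obtain d w f where d: "(d, w) \<in> G" "f \<in> Hom A c d" "y = amap P d c f w" by blast
    let ?i = "e (d, w)"
    have i: "?i \<in> e ` G" "a ?i = d" "x ?i = w" using d e(1) by (auto simp: a_def x_def)
    then have "y = t c (inc ?i c f)"
      using fun_cong[OF fun_cong[OF t(2)[OF i(1)]], of c f] c d by simp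
    moreover have "inc ?i c f \<in> omap S c" using inc[OF i(1)] c d i by auto
    ultimately show "\<exists>s\<in>omap S c. y = t c s" by blast
  qed (use S(1) P t(1) in \<open>auto simp: is_coproduct_def\<close>)
  then show "petty A P"
    unfolding petty_def using P e(2) ax S(1) small_iff_usmall by blast
qed


subsection \<open>Lucid presheaves and limits of presheaves\<close>

lemma ex_transport_inverse:
  fixes V :: "'o \<Rightarrow> 'v set"
  assumes "action V act" and "\<And>c. c \<in> ob \<Longrightarrow> usmall TYPE('u) (V c)"
  obtains P \<theta> \<kappa> where "P \<in> Obj PS"
    "\<And>c v. \<lbrakk>c \<in> ob; v \<in> V c\<rbrakk> \<Longrightarrow> \<theta> c v \<in> omap P c"
    "\<And>c x. \<lbrakk>c \<in> ob; x \<in> omap P c\<rbrakk> \<Longrightarrow> \<kappa> c x \<in> V c"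
    "\<And>c v. \<lbrakk>c \<in> ob; v \<in> V c\<rbrakk> \<Longrightarrow> \<kappa> c (\<theta> c v) = v"
    "\<And>c x. \<lbrakk>c \<in> ob; x \<in> omap P c\<rbrakk> \<Longrightarrow> \<theta> c (\<kappa> c x) = x"
    "\<And>c d f v. \<lbrakk>c \<in> ob; d \<in> ob; f \<in> Hom A c d; v \<in> V d\<rbrakk> \<Longrightarrow>
       amap P d c f (\<theta> d v) = \<theta> c (act d c f v)"
    "\<And>c d f x. \<lbrakk>c \<in> ob; d \<in> ob; f \<in> Hom A c d; x \<in> omap P d\<rbrakk> \<Longrightarrow>
       \<kappa> c (amap P d c f x) = act d c f (\<kappa> d x)"
proof -
  obtain P \<theta> where P: "P \<in> Obj PS"
    and bij: "\<And>c. c \<in> ob \<Longrightarrow> bij_betw (\<theta> c) (V c) (omap P c)"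
    and nat: "\<And>c d f v. \<lbrakk>c \<in> ob; d \<in> ob; f \<in> Hom A c d; v \<in> V d\<rbrakk> \<Longrightarrow>
       amap P d c f (\<theta> d v) = \<theta> c (act d c f v)"
    using ex_transport[OF assms] by blast
  let ?\<kappa> = "\<lambda>c. inv_into (V c) (\<theta> c)"
  have 1: "\<theta> c v \<in> omap P c" if "c \<in> ob" "v \<in> V c" for c v
    using bij_betwE[OF bij[OF that(1)]] that(2) by blast
  have 2: "?\<kappa> c x \<in> V c" if "c \<in> ob" "x \<in> omap P c" for c x
    using bij_betw_inv_into[OF bij[OF that(1)]] that(2) bij_betwE by blast
  have 3: "?\<kappa> c (\<theta> c v) = v" if "c \<in> ob" "v \<in> V c" for c v
    by (rule bij_betw_inv_into_left[OF bij[OF that(1)] that(2)])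
  have 4: "\<theta> c (?\<kappa> c x) = x" if "c \<in> ob" "x \<in> omap P c" for c x
    by (rule bij_betw_inv_into_right[OF bij[OF that(1)] that(2)])
  have 5: "?\<kappa> c (amap P d c f x) = act d c f (?\<kappa> d x)"
    if "c \<in> ob" "d \<in> ob" "f \<in> Hom A c d" "x \<in> omap P d" for c d f x
  proof -
    have "act d c f (?\<kappa> d x) \<in> V c" using assms(1) 2 that by (simp add: action_def)
    moreover have "amap P d c f x = \<theta> c (act d c f (?\<kappa> d x))"
      using nat[OF that(1-3) 2[OF that(2,4)]] 4[OF that(2,4)] by simp
    ultimately show ?thesis using 3[OF that(1)] by simp
  qed
  show thesis by (rule that[OF P 1 2 3 4 nat 5])
qed

text \<open>For a predicate stable under precomposition this is pettiness of a sieve on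
  \<open>b\<close>, viewed as a subpresheaf of the representable at \<open>b\<close>.\<close>

definition gsieve :: "'o \<Rightarrow> ('o \<Rightarrow> 'u \<Rightarrow> bool) \<Rightarrow> bool" where
  "gsieve b T \<longleftrightarrow> generated (\<lambda>c. {h \<in> Hom A c b. T c h}) (\<lambda>d c f h. Comp A c d b h f)"

text \<open>Lucidity tested on representables: two elements over \<open>b\<close> are a parallel
  pair out of the representable at \<open>b\<close>, and the equalizer of that pair is the sieve of
  arrows along which they restrict to the same element.\<close>

definition elementwise_lucid :: "('o, 'u) presheaf \<Rightarrow> bool" where
  "elementwise_lucid L \<longleftrightarrow> L \<in> Obj PS \<and> generated (omap L) (amap L) \<and>
     (\<forall>b \<in> ob. \<forall>x \<in> omap L b. \<forall>y \<in> omap L b. gsieve b (\<lambda>c h. amap L b c h x = amap L b c h y))"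

lemma generated_hom:
  assumes "a \<in> ob" shows "generated (\<lambda>c. Hom A c a) (amap (hom_presheaf A a))"
proof (rule generatedI)
  show "usmall TYPE('u) {(a, Id A a)}" by (simp add: usmall_finite)
  show "\<exists>d w f. (d, w) \<in> {(a, Id A a)} \<and> f \<in> Hom A c d \<and> v = amap (hom_presheaf A a) d c f w"
    if "c \<in> ob" "v \<in> Hom A c a" for c v
    using assms that by (intro exI[of _ a] exI[of _ "Id A a"] exI[of _ v]) simp
qed (use assms in auto)

lemma petty_hom: "a \<in> ob \<Longrightarrow> petty A (hom_presheaf A a)"
  unfolding petty_iff using generated_hom hom_presheaf_psh[of a]
  by (simp add: hom_presheaf_omap[abs_def] cong del: if_weak_cong)

text \<open>Representables are petty, so lucidity yields a petty equalizer of the two Yoneda arrows.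
  It is known only up to its universal property, but evaluating its arrow already maps it onto the
  sieve, and generators are carried along.\<close>

lemma gsieve_equalizer:
  assumes L: "lucid A L" and b: "b \<in> ob" and x: "x \<in> omap L b" and y: "y \<in> omap L b"
  shows "gsieve b (\<lambda>c h. amap L b c h x = amap L b c h y)"
proof -
  have LP: "L \<in> Obj PS" using L by (simp add: lucid_def petty_def)
  let ?H = "hom_presheaf A b" and ?f = "yon L b x" and ?g = "yon L b y"
  have H: "?H \<in> Obj PS" and f: "?f \<in> Hom PS ?H L" and g: "?g \<in> Hom PS ?H L"
    using LP b x y by auto
  obtain E e where eq: "is_equalizer PS ?H L ?f ?g E e" and "petty A E"
    using L f g petty_hom[OF b] unfolding lucid_def by blast
  then have E: "E \<in> Obj PS" "generated (omap E) (amap E)" and e: "e \<in> Hom PS E ?H"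
    and fe: "Comp PS E ?H L ?f e = Comp PS E ?H L ?g e"
    by (auto simp: petty_iff is_equalizer_def)
  have e_in: "e c v \<in> Hom A c b" if "c \<in> ob" "v \<in> omap E c" for c v
    using hom_in[OF e that] by simp
  show ?thesis unfolding gsieve_def
  proof (rule generated_surj[OF E(2), where \<phi> = e])
    fix c v assume c: "c \<in> ob" "v \<in> omap E c"
    then show "e c v \<in> {h \<in> Hom A c b. amap L b c h x = amap L b c h y}"
      using e_in[OF c] fun_cong[OF fun_cong[OF fe], of c v] by simp
  next
    fix c d f v assume c: "c \<in> ob" "d \<in> ob" "f \<in> Hom A c d" "v \<in> omap E d"
    then show "e c (amap E d c f v) = Comp A c d b (e d v) f"
      using hom_natural[OF E(1) H e c] e_in by simp
  next
    fix c h assume c: "c \<in> ob" and "h \<in> {h \<in> Hom A c b. amap L b c h x = amap L b c h y}"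
    then have h: "h \<in> Hom A c b" "amap L b c h x = amap L b c h y" by auto
    let ?C = "hom_presheaf A c"
    have C: "?C \<in> Obj PS" and k: "yon ?H c h \<in> Hom PS ?C ?H" using c h H by auto
    \<comment> \<open>An arrow \<open>h\<close> of the sieve, viewed as an arrow between
      representables, equalizes the pair and factors through \<open>E\<close>; the factor evaluated
      at the identity is the desired preimage of \<open>h\<close>.\<close>
    have "Comp PS ?C ?H L ?f (yon ?H c h) = Comp PS ?C ?H L ?g (yon ?H c h)"
      by (rule hom_eqI[OF PS_Comp_in[OF C H LP k f] PS_Comp_in[OF C H LP k g]])
         (use h LP b c x y in simp)
    then obtain m where m: "m \<in> Hom PS ?C E" "Comp PS ?C E ?H e m = yon ?H c h"
      using eq C k unfolding is_equalizer_def by meson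
    have "m c (Id A c) \<in> omap E c" using hom_in[OF m(1)] c by simp
    moreover have "h = e c (m c (Id A c))"
      using fun_cong[OF fun_cong[OF m(2)], of c "Id A c"] b c h by simp
    ultimately show "\<exists>v. v \<in> omap E c \<and> h = e c v" by blast
  qed
qed

text \<open>The equalizer is formed at each object. Each of its elements is the restriction of a
  generator \<open>(d, w)\<close> of \<open>P\<close> along some \<open>h\<close>, and the
  admissible \<open>h\<close> are those that equalize \<open>f d w\<close> and \<open>g d w\<close>.
  So the equalizing sieves of \<open>L\<close>, one for each generator of \<open>P\<close>, cover
  it.\<close>

lemma ex_petty_equalizer:
  assumes L: "elementwise_lucid L" and P: "P \<in> Obj PS" and gen: "generated (omap P) (amap P)"
    and f: "f \<in> Hom PS P L" and g: "g \<in> Hom PS P L"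
  shows "\<exists>E e. is_equalizer PS P L f g E e \<and> petty A E"
proof -
  have LP: "L \<in> Obj PS"
    and sv: "\<And>b x y. \<lbrakk>b \<in> ob; x \<in> omap L b; y \<in> omap L b\<rbrakk> \<Longrightarrow>
      gsieve b (\<lambda>c h. amap L b c h x = amap L b c h y)" using L by (auto simp: elementwise_lucid_def)
  define V where "V c = {x \<in> omap P c. f c x = g c x}" for c
  have aV: "action V (amap P)"
    unfolding action_def V_def using P by (auto simp: hom_natural[OF P LP f] hom_natural[OF P LP g])
  have sV: "usmall TYPE('u) (V c)" if "c \<in> ob" for c
    by (rule usmall_subset[OF psh_usmall[OF P that]]) (auto simp: V_def)
  obtain E \<theta> \<kappa> where E: "E \<in> Obj PS"
    and \<theta>: "\<And>c v. \<lbrakk>c \<in> ob; v \<in> V c\<rbrakk> \<Longrightarrow> \<theta> c v \<in> omap E c"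
    and \<kappa>: "\<And>c x. \<lbrakk>c \<in> ob; x \<in> omap E c\<rbrakk> \<Longrightarrow> \<kappa> c x \<in> V c"
    and \<kappa>\<theta>: "\<And>c v. \<lbrakk>c \<in> ob; v \<in> V c\<rbrakk> \<Longrightarrow> \<kappa> c (\<theta> c v) = v"
    and \<theta>\<kappa>: "\<And>c x. \<lbrakk>c \<in> ob; x \<in> omap E c\<rbrakk> \<Longrightarrow> \<theta> c (\<kappa> c x) = x"
    and \<theta>n: "\<And>c d f v. \<lbrakk>c \<in> ob; d \<in> ob; f \<in> Hom A c d; v \<in> V d\<rbrakk> \<Longrightarrow>
       amap E d c f (\<theta> d v) = \<theta> c (amap P d c f v)"
    and \<kappa>n: "\<And>c d f x. \<lbrakk>c \<in> ob; d \<in> ob; f \<in> Hom A c d; x \<in> omap E d\<rbrakk> \<Longrightarrow>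
       \<kappa> c (amap E d c f x) = amap P d c f (\<kappa> d x)"
    by (rule ex_transport_inverse[OF aV sV]) (assumption, rule that)
  let ?e = "transf E \<kappa>"
  have e: "?e \<in> Hom PS E P"
    by (rule transf_in[OF E P]) (use \<kappa> \<kappa>n in \<open>auto simp: V_def\<close>)
  have "is_equalizer PS P L f g E ?e"
    unfolding is_equalizer_def
  proof (intro conjI E e ballI impI)
    show "Comp PS E P L f ?e = Comp PS E P L g ?e"
      by (rule hom_eqI[OF PS_Comp_in[OF E P LP e f] PS_Comp_in[OF E P LP e g]])
         (use \<kappa> in \<open>auto simp: V_def\<close>)
  next
    fix E' e' assume E': "E' \<in> Obj PS" and e': "e' \<in> Hom PS E' P"
      and eq: "Comp PS E' P L f e' = Comp PS E' P L g e'"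
    have e'V: "e' c x \<in> V c" if "c \<in> ob" "x \<in> omap E' c" for c x
      using fun_cong[OF fun_cong[OF eq], of c x] hom_in[OF e' that] that by (simp add: V_def)
    have h: "transf E' (\<lambda>c x. \<theta> c (e' c x)) \<in> Hom PS E' E"
      by (rule transf_in[OF E' E]) (auto simp: \<theta> \<theta>n e'V hom_natural[OF E' P e'])
    show "\<exists>!h. h \<in> Hom PS E' E \<and> Comp PS E' E P ?e h = e'"
    proof (rule ex1I[of _ "transf E' (\<lambda>c x. \<theta> c (e' c x))"])
      show "transf E' (\<lambda>c x. \<theta> c (e' c x)) \<in> Hom PS E' E \<and>
          Comp PS E' E P ?e (transf E' (\<lambda>c x. \<theta> c (e' c x))) = e'"
        using h by (auto simp: PS_Comp_eq_iff[OF E' E P h e e'] \<theta> \<kappa>\<theta> e'V)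
    next
      fix k assume k: "k \<in> Hom PS E' E \<and> Comp PS E' E P ?e k = e'"
      show "k = transf E' (\<lambda>c x. \<theta> c (e' c x))"
      proof (rule hom_eqI[OF _ h])
        fix c x assume c: "c \<in> ob" "x \<in> omap E' c"
        with k have "k c x \<in> omap E c" by auto
        with k c show "k c x = transf E' (\<lambda>c x. \<theta> c (e' c x)) c x"
          by (auto simp: PS_Comp_eq_iff[OF E' E P _ e e'] \<theta>\<kappa> dest!: bspec)
      qed (use k in auto)
    qed
  qed
  moreover have "petty A E"
    unfolding petty_iff
  proof (intro conjI E)
    obtain G where G: "usmall TYPE('u) G" "\<And>d w. (d, w) \<in> G \<Longrightarrow> d \<in> ob \<and> w \<in> omap P d"
      "\<And>c v. \<lbrakk>c \<in> ob; v \<in> omap P c\<rbrakk> \<Longrightarrow> \<exists>d w f. (d, w) \<in> G \<and> f \<in> Hom A c d \<and> v = amap P d c f w"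
      using generatedE[OF gen] by blast
    show "generated (omap E) (amap E)"
    proof (rule generated_cover[OF G(1), where
          V = "\<lambda>(d, w) c. {h \<in> Hom A c d. amap L d c h (f d w) = amap L d c h (g d w)}" and
          actV = "\<lambda>(d, w) d' c k h. Comp A c d' d h k" and
          \<phi> = "\<lambda>(d, w) c h. \<theta> c (amap P d c h w)"])
      fix m assume m: "m \<in> G"
      obtain d w where [simp]: "m = (d, w)" by fastforce
      have d: "d \<in> ob" "w \<in> omap P d" using G(2) m by auto
      have inV: "amap P d c h w \<in> V c"
        if "c \<in> ob" "h \<in> Hom A c d" "amap L d c h (f d w) = amap L d c h (g d w)" for c h
        using that d P by (auto simp: V_def hom_natural[OF P LP f] hom_natural[OF P LP g])
      show "generated (case m of (d, w) \<Rightarrow> \<lambda>c. {h \<in> Hom A c d. amap L d c h (f d w) = amap L d c h (g d w)})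
          (case m of (d, w) \<Rightarrow> \<lambda>d' c k h. Comp A c d' d h k)"
        using sv[OF d(1) hom_in[OF f d] hom_in[OF g d]] by (simp add: gsieve_def)
      fix c h assume c: "c \<in> ob"
      show "(case m of (d, w) \<Rightarrow> \<lambda>c h. \<theta> c (amap P d c h w)) c h \<in> omap E c"
        if "h \<in> (case m of (d, w) \<Rightarrow> \<lambda>c. {h \<in> Hom A c d. amap L d c h (f d w) = amap L d c h (g d w)}) c"
        using that by (auto intro!: \<theta> inV c)
      fix d' k assume d': "d' \<in> ob" "k \<in> Hom A c d'"
        and h: "h \<in> (case m of (d, w) \<Rightarrow> \<lambda>c. {h \<in> Hom A c d. amap L d c h (f d w) = amap L d c h (g d w)}) d'"
      then show "(case m of (d, w) \<Rightarrow> \<lambda>c h. \<theta> c (amap P d c h w)) c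
          ((case m of (d, w) \<Rightarrow> \<lambda>d' c k h. Comp A c d' d h k) d' c k h) =
          amap E d' c k ((case m of (d, w) \<Rightarrow> \<lambda>c h. \<theta> c (amap P d c h w)) d' h)"
        using c d P inV by (auto simp: \<theta>n)
    next
      fix c v assume c: "c \<in> ob" "v \<in> omap E c"
      then have v: "\<kappa> c v \<in> omap P c" "f c (\<kappa> c v) = g c (\<kappa> c v)" using \<kappa> by (auto simp: V_def)
      with G(3) c obtain d w h where d: "(d, w) \<in> G" "h \<in> Hom A c d" "\<kappa> c v = amap P d c h w" by blast
      with G(2) have dw: "d \<in> ob" "w \<in> omap P d" by auto
      have "amap L d c h (f d w) = amap L d c h (g d w)"
        using v(2) unfolding d(3) hom_natural[OF P LP f c(1) dw(1) d(2) dw(2)]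
          hom_natural[OF P LP g c(1) dw(1) d(2) dw(2)] .
      moreover have "v = \<theta> c (amap P d c h w)" using \<theta>\<kappa>[OF c] d(3) by simp
      ultimately show "\<exists>m h. m \<in> G \<and> h \<in> (case m of (d, w) \<Rightarrow>
          \<lambda>c. {h \<in> Hom A c d. amap L d c h (f d w) = amap L d c h (g d w)}) c \<and>
          v = (case m of (d, w) \<Rightarrow> \<lambda>c h. \<theta> c (amap P d c h w)) c h"
        using d(1,2) by (intro exI[of _ "(d, w)"] exI[of _ h]) simp
    qed
  qed
  ultimately show ?thesis by blast
qed

lemma lucid_iff: "lucid A L \<longleftrightarrow> elementwise_lucid L"
proof
  assume "lucid A L"
  moreover from this have "petty A L" by (simp add: lucid_def)
  ultimately show "elementwise_lucid L" using gsieve_equalizer unfolding elementwise_lucid_def petty_iff by blast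
next
  assume L: "elementwise_lucid L"
  then have "petty A L" by (simp add: elementwise_lucid_def petty_iff)
  with ex_petty_equalizer[OF L] show "lucid A L" unfolding lucid_def petty_iff by blast
qed

section \<open>Limits of presheaves computed at each object\<close>

text \<open>The limit of sets \<open>omap (omap D j) c\<close> in its usual form as a set of
  matching families.\<close>

definition compat :: "('j, 'k) cat \<Rightarrow> ('j, 'k, ('o, 'u) presheaf, 'o \<Rightarrow> 'u \<Rightarrow> 'u) fun_data \<Rightarrow>
    'o \<Rightarrow> ('j \<Rightarrow> 'u) set" where
  "compat J D c = {z \<in> \<Pi>\<^sub>E j \<in> Obj J. omap (omap D j) c.
     \<forall>i \<in> Obj J. \<forall>j \<in> Obj J. \<forall>u \<in> Hom J i j. amap D i j u c (z i) = z j}"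

lemma functor_PS:
  assumes "is_functor J PS D"
  shows "j \<in> Obj J \<Longrightarrow> omap D j \<in> Obj PS"
    and "\<lbrakk>i \<in> Obj J; j \<in> Obj J; u \<in> Hom J i j\<rbrakk> \<Longrightarrow> amap D i j u \<in> Hom PS (omap D i) (omap D j)"
  using assms by (auto simp: is_functor_def)

text \<open>Besides the universal property, the coordinates \<open>\<theta>\<close> are exported:
  generation and equality of elements of the limit are decided on matching families.\<close>

lemma ex_limit:
  assumes J: "usmall TYPE('u) (Obj J)" and D: "is_functor J PS D"
  obtains L p \<theta> where "is_limit J PS D L p"
    "\<And>c z. \<lbrakk>c \<in> ob; z \<in> compat J D c\<rbrakk> \<Longrightarrow> \<theta> c z \<in> omap L c"
    "\<And>c z j. \<lbrakk>c \<in> ob; z \<in> compat J D c; j \<in> Obj J\<rbrakk> \<Longrightarrow> p j c (\<theta> c z) = z j"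
    "\<And>c x. \<lbrakk>c \<in> ob; x \<in> omap L c\<rbrakk> \<Longrightarrow> \<exists>z \<in> compat J D c. x = \<theta> c z"
    "\<And>c d f z. \<lbrakk>c \<in> ob; d \<in> ob; f \<in> Hom A c d; z \<in> compat J D d\<rbrakk> \<Longrightarrow>
       amap L d c f (\<theta> d z) = \<theta> c (\<lambda>j\<in>Obj J. amap (omap D j) d c f (z j))"
proof -
  note Dj = functor_PS(1)[OF D] and Du = functor_PS(2)[OF D]
  have Dnat: "amap D i j u c (amap (omap D i) d c f z) = amap (omap D j) d c f (amap D i j u d z)"
    if "i \<in> Obj J" "j \<in> Obj J" "u \<in> Hom J i j" "c \<in> ob" "d \<in> ob" "f \<in> Hom A c d" "z \<in> omap (omap D i) d"
    for i j u c d f z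
    by (rule hom_natural[OF Dj[OF that(1)] Dj[OF that(2)] Du[OF that(1-3)] that(4-7)])
  let ?V = "compat J D" and ?act = "\<lambda>d c f z. \<lambda>j\<in>Obj J. amap (omap D j) d c f (z j)"
  have z_in: "z j \<in> omap (omap D j) c" if "z \<in> ?V c" "j \<in> Obj J" for z j c
    using that by (auto simp: compat_def)
  have z_ext: "(\<lambda>j\<in>Obj J. z j) = z" if "z \<in> ?V c" for z c
    using that by (auto simp: compat_def PiE_iff extensional_restrict)
  have z_comp: "amap D i j u c (z i) = z j"
    if "z \<in> ?V c" "i \<in> Obj J" "j \<in> Obj J" "u \<in> Hom J i j" for z c i j u
    using that by (auto simp: compat_def)
  have actV: "?act d c f z \<in> ?V c" if "c \<in> ob" "d \<in> ob" "f \<in> Hom A c d" "z \<in> ?V d" for c d f z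
    using that Dj unfolding compat_def by (auto simp: Dnat PiE_iff)
  have aV: "action ?V ?act"
    unfolding action_def
  proof (intro conjI ballI actV)
    fix c z assume c: "c \<in> ob" "z \<in> ?V c"
    then have "?act c c (Id A c) z = (\<lambda>j\<in>Obj J. z j)"
      by (intro restrict_ext) (simp add: Dj z_in)
    then show "?act c c (Id A c) z = z" using z_ext[OF c(2)] by simp
  next
    fix b c d f g z assume *: "b \<in> ob" "c \<in> ob" "d \<in> ob" "f \<in> Hom A b c" "g \<in> Hom A c d" "z \<in> ?V d"
    then show "?act d b (Comp A b c d g f) z = ?act c b f (?act d c g z)"
      by (intro restrict_ext) (simp add: Dj z_in)
  qed
  have sV: "usmall TYPE('u) (?V c)" if "c \<in> ob" for c
    by (rule usmall_subset[OF usmall_PiE[OF J]]) (auto simp: compat_def intro: psh_usmall Dj that)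
  obtain L \<theta> \<kappa> where L: "L \<in> Obj PS"
    and \<theta>: "\<And>c v. \<lbrakk>c \<in> ob; v \<in> ?V c\<rbrakk> \<Longrightarrow> \<theta> c v \<in> omap L c"
    and \<kappa>: "\<And>c x. \<lbrakk>c \<in> ob; x \<in> omap L c\<rbrakk> \<Longrightarrow> \<kappa> c x \<in> ?V c"
    and \<kappa>\<theta>: "\<And>c v. \<lbrakk>c \<in> ob; v \<in> ?V c\<rbrakk> \<Longrightarrow> \<kappa> c (\<theta> c v) = v"
    and \<theta>\<kappa>: "\<And>c x. \<lbrakk>c \<in> ob; x \<in> omap L c\<rbrakk> \<Longrightarrow> \<theta> c (\<kappa> c x) = x"
    and \<theta>n: "\<And>c d f v. \<lbrakk>c \<in> ob; d \<in> ob; f \<in> Hom A c d; v \<in> ?V d\<rbrakk> \<Longrightarrow>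
       amap L d c f (\<theta> d v) = \<theta> c (?act d c f v)"
    and \<kappa>n: "\<And>c d f x. \<lbrakk>c \<in> ob; d \<in> ob; f \<in> Hom A c d; x \<in> omap L d\<rbrakk> \<Longrightarrow>
       \<kappa> c (amap L d c f x) = ?act d c f (\<kappa> d x)"
    by (rule ex_transport_inverse[OF aV sV]) (assumption, rule that)
  define p where "p j = transf L (\<lambda>c x. \<kappa> c x j)" for j
  have p: "p j \<in> Hom PS L (omap D j)" if "j \<in> Obj J" for j
    unfolding p_def by (rule transf_in[OF L Dj[OF that]]) (use \<kappa> z_in \<kappa>n that in auto)
  have cone: "is_cone J PS D L p"
    unfolding is_cone_def
  proof (intro conjI L ballI p)
    fix i j u assume *: "i \<in> Obj J" "j \<in> Obj J" "u \<in> Hom J i j"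
    show "Comp PS L (omap D i) (omap D j) (amap D i j u) (p i) = p j"
      unfolding PS_Comp_eq_iff[OF L Dj[OF *(1)] Dj[OF *(2)] p[OF *(1)] Du[OF *] p[OF *(2)]]
      using * \<kappa> z_comp by (simp add: p_def)
  qed
  have "is_limit J PS D L p"
    unfolding is_limit_def
  proof (intro conjI cone allI impI)
    fix M q assume "is_cone J PS D M q"
    then have M: "M \<in> Obj PS" and q: "\<And>i. i \<in> Obj J \<Longrightarrow> q i \<in> Hom PS M (omap D i)"
      and qc: "\<And>i j u. \<lbrakk>i \<in> Obj J; j \<in> Obj J; u \<in> Hom J i j\<rbrakk> \<Longrightarrow>
        Comp PS M (omap D i) (omap D j) (amap D i j u) (q i) = q j"
      by (auto simp: is_cone_def)
    have qV: "(\<lambda>j\<in>Obj J. q j c x) \<in> ?V c" if "c \<in> ob" "x \<in> omap M c" for c x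
      unfolding compat_def
    proof (intro CollectI conjI ballI)
      show "(\<lambda>j\<in>Obj J. q j c x) \<in> (\<Pi>\<^sub>E j\<in>Obj J. omap (omap D j) c)" using hom_in[OF q that] by simp
      fix i j u assume *: "i \<in> Obj J" "j \<in> Obj J" "u \<in> Hom J i j"
      show "amap D i j u c ((\<lambda>j\<in>Obj J. q j c x) i) = (\<lambda>j\<in>Obj J. q j c x) j"
        using fun_cong[OF fun_cong[OF qc[OF *]], of c x] that * by simp
    qed
    let ?h = "transf M (\<lambda>c x. \<theta> c (\<lambda>j\<in>Obj J. q j c x))"
    have h: "?h \<in> Hom PS M L"
    proof (rule transf_in[OF M L])
      fix c d f x assume *: "c \<in> ob" "d \<in> ob" "f \<in> Hom A c d" "x \<in> omap M d"
      have "(\<lambda>j\<in>Obj J. q j c (amap M d c f x)) = ?act d c f (\<lambda>j\<in>Obj J. q j d x)"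
        by (rule restrict_ext) (simp add: hom_natural[OF M Dj q *])
      then show "\<theta> c (\<lambda>j\<in>Obj J. q j c (amap M d c f x)) = amap L d c f (\<theta> d (\<lambda>j\<in>Obj J. q j d x))"
        using \<theta>n[OF *(1-3) qV[OF *(2,4)]] by simp
    qed (use \<theta> qV in auto)
    show "\<exists>!h. h \<in> Hom PS M L \<and> (\<forall>i\<in>Obj J. Comp PS M L (omap D i) (p i) h = q i)"
    proof (rule ex1I[of _ ?h])
      show "?h \<in> Hom PS M L \<and> (\<forall>i\<in>Obj J. Comp PS M L (omap D i) (p i) ?h = q i)"
      proof (intro conjI ballI h)
        fix i assume i: "i \<in> Obj J"
        show "Comp PS M L (omap D i) (p i) ?h = q i"
          unfolding PS_Comp_eq_iff[OF M L Dj[OF i] h p[OF i] q[OF i]]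
          using i by (simp add: p_def \<theta> \<kappa>\<theta> qV)
      qed
    next
      fix k assume k: "k \<in> Hom PS M L \<and> (\<forall>i\<in>Obj J. Comp PS M L (omap D i) (p i) k = q i)"
      show "k = ?h"
      proof (rule hom_eqI[OF _ h])
        fix c x assume c: "c \<in> ob" "x \<in> omap M c"
        with k have kx: "k c x \<in> omap L c" by auto
        have "\<kappa> c (k c x) = (\<lambda>j\<in>Obj J. \<kappa> c (k c x) j)" using z_ext \<kappa> c kx by metis
        also have "\<dots> = (\<lambda>j\<in>Obj J. q j c x)"
        proof (rule restrict_ext)
          fix j assume j: "j \<in> Obj J"
          with k have "Comp PS M L (omap D j) (p j) k c x = q j c x" by simp
          then show "\<kappa> c (k c x) j = q j c x" using c kx by (simp add: p_def)
        qed
        finally show "k c x = ?h c x" using \<theta>\<kappa>[OF c(1) kx] c by simp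
      qed (use k in auto)
    qed
  qed
  then show thesis
  proof (rule that)
    show "p j c (\<theta> c z) = z j" if "c \<in> ob" "z \<in> ?V c" for c z j
      using that \<theta> \<kappa>\<theta> by (simp add: p_def)
    show "\<exists>z \<in> ?V c. x = \<theta> c z" if "c \<in> ob" "x \<in> omap L c" for c x
      using \<kappa> \<theta>\<kappa> that by metis
  qed (rule \<theta> \<theta>n, assumption+)+
qed


subsection \<open>Pre-completeness\<close>

lemma gsieve_cong:
  assumes "\<And>c h. \<lbrakk>c \<in> ob; h \<in> Hom A c b\<rbrakk> \<Longrightarrow> T c h \<longleftrightarrow> T' c h" and "gsieve b T"
  shows "gsieve b T'"
  unfolding gsieve_def
  by (rule generated_surj[OF assms(2)[unfolded gsieve_def], where \<phi> = "\<lambda>c h. h"]) (use assms(1) in auto)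

text \<open>A point of the limit also has coordinates at the objects \<open>b k\<close>. They are
  left out here because each of them is determined by the coordinate at \<open>s k\<close>.\<close>

definition solutions :: "'i set \<Rightarrow> 'k set \<Rightarrow> ('i \<Rightarrow> 'o) \<Rightarrow> ('k \<Rightarrow> 'o) \<Rightarrow> ('k \<Rightarrow> 'i) \<Rightarrow> ('k \<Rightarrow> 'i) \<Rightarrow>
    ('k \<Rightarrow> 'u) \<Rightarrow> ('k \<Rightarrow> 'u) \<Rightarrow> 'o \<Rightarrow> ('i \<Rightarrow> 'u) set" where
  "solutions I K a b s t f g c = {h \<in> \<Pi>\<^sub>E i \<in> I. Hom A c (a i). \<forall>k \<in> K.
     Comp A c (a (s k)) (b k) (f k) (h (s k)) = Comp A c (a (t k)) (b k) (g k) (h (t k))}"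

definition family_act :: "'i set \<Rightarrow> ('i \<Rightarrow> 'o) \<Rightarrow> 'o \<Rightarrow> 'o \<Rightarrow> 'u \<Rightarrow> ('i \<Rightarrow> 'u) \<Rightarrow> 'i \<Rightarrow> 'u" where
  "family_act I a d c u h = (\<lambda>i\<in>I. Comp A c d (a i) (h i) u)"

text \<open>
  The solutions of a system are the elements of the pointwise limit of a diagram with representables
  \<open>a i\<close> in one layer and \<open>b k\<close> in a second one, each of the latter receiving two arrows. Two layers
  suffice, since every limit is built from products and joint equalizers.
\<close>

definition system :: "'i set \<Rightarrow> 'k set \<Rightarrow> ('i \<Rightarrow> 'o) \<Rightarrow> ('k \<Rightarrow> 'o) \<Rightarrow> ('k \<Rightarrow> 'i) \<Rightarrow> ('k \<Rightarrow> 'i) \<Rightarrow>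
    ('k \<Rightarrow> 'u) \<Rightarrow> ('k \<Rightarrow> 'u) \<Rightarrow> bool" where
  "system I K a b s t f g \<longleftrightarrow> usmall TYPE('u) I \<and> usmall TYPE('u) K \<and> (\<forall>i \<in> I. a i \<in> ob) \<and>
     (\<forall>k \<in> K. s k \<in> I \<and> t k \<in> I \<and> b k \<in> ob \<and>
        f k \<in> Hom A (a (s k)) (b k) \<and> g k \<in> Hom A (a (t k)) (b k))"

text \<open>The index sets are disjoint and lie in \<open>'u\<close> because their union is to be
  the set of objects of a small category when precompleteness is derived from the existence of
  limits.\<close>

definition precomplete :: bool where
  "precomplete \<longleftrightarrow> (\<forall>(I :: 'u set) (K :: 'u set) a b s t f g.
     I \<inter> K = {} \<and> system I K a b s t f g \<longrightarrow>
     generated (solutions I K a b s t f g) (family_act I a))"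

text \<open>An injective code of the disjoint sum \<open>I <+> K\<close> makes the two index sets
  disjoint inside \<open>'u\<close>; reindexing does not change the solutions. Systems can
  henceforth be indexed by whatever type is convenient.\<close>

lemma solutions_generated:
  fixes I :: "'i set" and K :: "'k set"
  assumes pre: precomplete and sys: "system I K a b s t f g"
  shows "generated (solutions I K a b s t f g) (family_act I a)"
proof -
  have I: "usmall TYPE('u) I" and K: "usmall TYPE('u) K" using sys by (auto simp: system_def)
  have "usmall TYPE('u) (I <+> K)"
    unfolding Plus_def by (intro usmall_Un usmall_image I K)
  then obtain e :: "'i + 'k \<Rightarrow> 'u" where e: "inj_on e (I <+> K)" using usmall_encode by blast
  define i0 where "i0 x = projl (inv_into (I <+> K) e x)" for x
  define k0 where "k0 x = projr (inv_into (I <+> K) e x)" for x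
  have i0 [simp]: "i0 (e (Inl i)) = i" if "i \<in> I" for i
    using inv_into_f_f[OF e InlI[OF that]] by (simp add: i0_def)
  have k0 [simp]: "k0 (e (Inr k)) = k" if "k \<in> K" for k
    using inv_into_f_f[OF e InrI[OF that]] by (simp add: k0_def)
  let ?I = "(\<lambda>i. e (Inl i)) ` I" and ?K = "(\<lambda>k. e (Inr k)) ` K"
  let ?a = "\<lambda>x. a (i0 x)" and ?b = "\<lambda>x. b (k0 x)" and ?f = "\<lambda>x. f (k0 x)" and ?g = "\<lambda>x. g (k0 x)"
  let ?s = "\<lambda>x. e (Inl (s (k0 x)))" and ?t = "\<lambda>x. e (Inl (t (k0 x)))"
  have "e (Inl i) \<noteq> e (Inr k)" if "i \<in> I" "k \<in> K" for i k
    using inj_onD[OF e _ InlI[OF that(1)] InrI[OF that(2)]] by auto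
  then have "?I \<inter> ?K = {}" by blast
  moreover have "system ?I ?K ?a ?b ?s ?t ?f ?g"
    using sys unfolding system_def by (auto intro: usmall_image)
  ultimately have "generated (solutions ?I ?K ?a ?b ?s ?t ?f ?g) (family_act ?I ?a)"
    by (intro pre[unfolded precomplete_def, rule_format] conjI)
  then show ?thesis
  proof (rule generated_surj[where \<phi> = "\<lambda>c h. \<lambda>i\<in>I. h (e (Inl i))"])
    fix c h assume "c \<in> ob" and h: "h \<in> solutions ?I ?K ?a ?b ?s ?t ?f ?g c"
    then show "(\<lambda>i\<in>I. h (e (Inl i))) \<in> solutions I K a b s t f g c"
      using sys by (auto simp: solutions_def system_def PiE_iff)
  next
    fix c d u h
    show "(\<lambda>i\<in>I. family_act ?I ?a d c u h (e (Inl i))) =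
        family_act I a d c u (\<lambda>i\<in>I. h (e (Inl i)))"
      by (auto simp: family_act_def)
  next
    fix c h assume "c \<in> ob" and h: "h \<in> solutions I K a b s t f g c"
    then have "(\<lambda>x\<in>?I. h (i0 x)) \<in> solutions ?I ?K ?a ?b ?s ?t ?f ?g c"
      using sys by (auto simp: solutions_def system_def)
    moreover have "h = (\<lambda>i\<in>I. (\<lambda>x\<in>?I. h (i0 x)) (e (Inl i)))"
    proof -
      have "(\<lambda>i\<in>I. (\<lambda>x\<in>?I. h (i0 x)) (e (Inl i))) = (\<lambda>i\<in>I. h i)" by (rule restrict_ext) simp
      also have "\<dots> = h" using h by (auto simp: solutions_def PiE_iff intro: extensional_restrict)
      finally show ?thesis by simp
    qed
    ultimately show "\<exists>h'. h' \<in> solutions ?I ?K ?a ?b ?s ?t ?f ?g c \<and> h = (\<lambda>i\<in>I. h' (e (Inl i)))"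
      by blast
  qed
qed

lemma families_generated:
  fixes I :: "'i set"
  assumes precomplete "usmall TYPE('u) I" "\<And>i. i \<in> I \<Longrightarrow> a i \<in> ob"
  shows "generated (\<lambda>c. \<Pi>\<^sub>E i \<in> I. Hom A c (a i)) (family_act I a)"
proof -
  have "system I ({} :: unit set) a (\<lambda>_. undefined) (\<lambda>_. undefined) (\<lambda>_. undefined)
      (\<lambda>_. undefined) (\<lambda>_. undefined)"
    using assms(2,3) by (simp add: system_def usmall_finite)
  from solutions_generated[OF assms(1) this] show ?thesis by (simp add: solutions_def[abs_def])
qed

text \<open>The product of two representables. Its generators are spans from \<open>a\<close> to
  \<open>b\<close> such that every span factors through one of them.\<close>

lemma pairs_generated:
  assumes precomplete "a \<in> ob" "b \<in> ob"
  shows "generated (\<lambda>c. Hom A c a \<times> Hom A c b)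
    (\<lambda>d c u (h, k). (Comp A c d a h u, Comp A c d b k u))"
proof (rule generated_surj)
  show "generated (\<lambda>c. \<Pi>\<^sub>E i \<in> UNIV. Hom A c (if i then a else b)) (family_act UNIV (\<lambda>i. if i then a else b))"
    by (rule families_generated) (use assms in \<open>auto intro: usmall_finite\<close>)
  let ?\<phi> = "\<lambda>c h. (h True, h False)"
  show "?\<phi> c h \<in> Hom A c a \<times> Hom A c b"
    if "c \<in> ob" "h \<in> (\<Pi>\<^sub>E i \<in> UNIV. Hom A c (if i then a else b))" for c h
    using PiE_mem[OF that(2), of True] PiE_mem[OF that(2), of False] by simp
  show "?\<phi> c (family_act UNIV (\<lambda>i. if i then a else b) d c f h) =
      (case ?\<phi> d h of (h, k) \<Rightarrow> (Comp A c d a h f, Comp A c d b k f))" for c d f h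
    by (simp add: family_act_def)
  show "\<exists>h. h \<in> (\<Pi>\<^sub>E i \<in> UNIV. Hom A c (if i then a else b)) \<and> w = ?\<phi> c h"
    if "c \<in> ob" "w \<in> Hom A c a \<times> Hom A c b" for c w
    using that by (intro exI[of _ "\<lambda>i. if i then fst w else snd w"]) auto
qed

text \<open>An arrow in the intersection factors, for every \<open>k\<close>, through some generator
  of the sieve \<open>T k\<close>. Once a generator \<open>m k\<close> is chosen for each
  \<open>k\<close>, the arrow together with its factors is a solution of a system, and conversely
  every solution yields an arrow of the intersection. The choices \<open>m\<close> form a small
  set.\<close>

lemma gsieve_INT:
  fixes K :: "'k set"
  assumes pre: precomplete and K: "usmall TYPE('u) K" and b: "b \<in> ob"
    and T: "\<And>k. k \<in> K \<Longrightarrow> gsieve b (T k)"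
    and cl: "\<And>k c d f h. \<lbrakk>k \<in> K; c \<in> ob; d \<in> ob; f \<in> Hom A c d; h \<in> Hom A d b; T k d h\<rbrakk> \<Longrightarrow>
      T k c (Comp A c d b h f)"
  shows "gsieve b (\<lambda>c h. \<forall>k \<in> K. T k c h)"
proof -
  have "\<forall>k\<in>K. \<exists>G. usmall TYPE('u) G \<and> (\<forall>d w. (d, w) \<in> G \<longrightarrow> d \<in> ob \<and> w \<in> Hom A d b \<and> T k d w) \<and>
      (\<forall>c v. c \<in> ob \<and> v \<in> Hom A c b \<and> T k c v \<longrightarrow>
        (\<exists>d w f. (d, w) \<in> G \<and> f \<in> Hom A c d \<and> v = Comp A c d b w f))"
  proof
    fix k assume "k \<in> K"
    from generatedE[OF T[OF this, unfolded gsieve_def]] obtain G where "usmall TYPE('u) G"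
      "\<And>d w. (d, w) \<in> G \<Longrightarrow> d \<in> ob \<and> w \<in> {h \<in> Hom A d b. T k d h}"
      "\<And>c v. \<lbrakk>c \<in> ob; v \<in> {h \<in> Hom A c b. T k c h}\<rbrakk> \<Longrightarrow>
         \<exists>d w f. (d, w) \<in> G \<and> f \<in> Hom A c d \<and> v = Comp A c d b w f" by blast
    then show "\<exists>G. usmall TYPE('u) G \<and> (\<forall>d w. (d, w) \<in> G \<longrightarrow> d \<in> ob \<and> w \<in> Hom A d b \<and> T k d w) \<and>
      (\<forall>c v. c \<in> ob \<and> v \<in> Hom A c b \<and> T k c v \<longrightarrow>
        (\<exists>d w f. (d, w) \<in> G \<and> f \<in> Hom A c d \<and> v = Comp A c d b w f))"
      by (intro exI[of _ G]) simp
  qed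
  from bchoice[OF this] obtain G where G: "\<And>k. k \<in> K \<Longrightarrow> usmall TYPE('u) (G k)"
    "\<And>k d w. \<lbrakk>k \<in> K; (d, w) \<in> G k\<rbrakk> \<Longrightarrow> d \<in> ob \<and> w \<in> Hom A d b \<and> T k d w"
    "\<And>k c v. \<lbrakk>k \<in> K; c \<in> ob; v \<in> Hom A c b; T k c v\<rbrakk> \<Longrightarrow>
       \<exists>d w f. (d, w) \<in> G k \<and> f \<in> Hom A c d \<and> v = Comp A c d b w f"
    by blast
  \<comment> \<open>The unknown \<open>None\<close> is the arrow into \<open>b\<close>, and
    \<open>Some k\<close> is its factor through the generator chosen for \<open>k\<close>. Equation
    \<open>k\<close> states the factorization, the identity of \<open>b\<close> serving as the other
    side's arrow.\<close>
  let ?I = "insert None (Some ` K)"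
  let ?a = "\<lambda>m. case_option b (\<lambda>k. fst (m k))"
  let ?V = "\<lambda>m. solutions ?I K (?a m) (\<lambda>_. b) (\<lambda>_. None) Some (\<lambda>_. Id A b) (\<lambda>k. snd (m k))"
  have m: "fst (m k) \<in> ob" "snd (m k) \<in> Hom A (fst (m k)) b" "T k (fst (m k)) (snd (m k))"
    if "m \<in> Pi\<^sub>E K G" "k \<in> K" for m k
    using G(2)[OF that(2), of "fst (m k)" "snd (m k)"] PiE_mem[OF that] by auto
  have ins: "usmall TYPE('u) ?I"
    using usmall_Un[OF usmall_finite usmall_image[OF K], of "{None}" Some] by simp
  show ?thesis unfolding gsieve_def
  proof (rule generated_cover[where M = "Pi\<^sub>E K G" and V = ?V and \<phi> = "\<lambda>_ _ h. h None" and
        actV = "\<lambda>m. family_act ?I (?a m)"])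
    show "usmall TYPE('u) (Pi\<^sub>E K G)" by (intro usmall_PiE K G)
  next
    fix m assume mM: "m \<in> Pi\<^sub>E K G"
    show "generated (?V m) (family_act ?I (?a m))"
    proof (rule solutions_generated[OF pre])
      show "system ?I K (?a m) (\<lambda>_. b) (\<lambda>_. None) Some (\<lambda>_. Id A b) (\<lambda>k. snd (m k))"
        unfolding system_def using m[OF mM] b ins K by auto
    qed
    fix c h assume c: "c \<in> ob" and h: "h \<in> ?V m c"
    from h have hP: "h \<in> (\<Pi>\<^sub>E i\<in>?I. Hom A c (?a m i))" by (simp add: solutions_def)
    from PiE_mem[OF hP, of None] have hN: "h None \<in> Hom A c b" by simp
    moreover have "T k c (h None)" if k: "k \<in> K" for k
    proof -
      from PiE_mem[OF hP, of "Some k"] k have hk: "h (Some k) \<in> Hom A c (fst (m k))" by simp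
      from h k have "Comp A c b b (Id A b) (h None) = Comp A c (fst (m k)) b (snd (m k)) (h (Some k))"
        by (simp add: solutions_def)
      with b c hN have "h None = Comp A c (fst (m k)) b (snd (m k)) (h (Some k))" by simp
      with cl[OF k c m(1)[OF mM k] hk m(2,3)[OF mM k]] show ?thesis by simp
    qed
    ultimately show "h None \<in> {h \<in> Hom A c b. \<forall>k\<in>K. T k c h}" by simp
  next
    fix c w assume c: "c \<in> ob" and "w \<in> {h \<in> Hom A c b. \<forall>k\<in>K. T k c h}"
    then have w: "w \<in> Hom A c b" "\<And>k. k \<in> K \<Longrightarrow> T k c w" by auto
    have "\<forall>k\<in>K. \<exists>x. (fst x, fst (snd x)) \<in> G k \<and> snd (snd x) \<in> Hom A c (fst x) \<and>
        w = Comp A c (fst x) b (fst (snd x)) (snd (snd x))"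
      using G(3)[OF _ c w(1) w(2)] by force
    from bchoice[OF this] obtain x where x: "\<And>k. k \<in> K \<Longrightarrow> (fst (x k), fst (snd (x k))) \<in> G k"
      "\<And>k. k \<in> K \<Longrightarrow> snd (snd (x k)) \<in> Hom A c (fst (x k))"
      "\<And>k. k \<in> K \<Longrightarrow> w = Comp A c (fst (x k)) b (fst (snd (x k))) (snd (snd (x k)))" by blast
    define m where "m = (\<lambda>k\<in>K. (fst (x k), fst (snd (x k))))"
    have "m \<in> Pi\<^sub>E K G" using x(1) by (simp add: m_def)
    moreover have "(\<lambda>i\<in>?I. case_option w (\<lambda>k. snd (snd (x k))) i) \<in> ?V m c"
      unfolding solutions_def using x(2,3) w(1) b c by (auto simp: m_def)
    ultimately show "\<exists>m h. m \<in> Pi\<^sub>E K G \<and> h \<in> ?V m c \<and> w = h None"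
      by (intro exI[of _ m] exI[of _ "\<lambda>i\<in>?I. case_option w (\<lambda>k. snd (snd (x k))) i"]) simp
  qed (simp add: family_act_def)
qed

lemma gsieve_joint_equalizer:
  fixes K :: "'k set"
  assumes pre: precomplete and K: "usmall TYPE('u) K" and b: "b \<in> ob"
    and L: "\<And>k. k \<in> K \<Longrightarrow> elementwise_lucid (L k)"
    and x: "\<And>k. k \<in> K \<Longrightarrow> x k \<in> omap (L k) b" and y: "\<And>k. k \<in> K \<Longrightarrow> y k \<in> omap (L k) b"
  shows "gsieve b (\<lambda>c h. \<forall>k \<in> K. amap (L k) b c h (x k) = amap (L k) b c h (y k))"
proof (rule gsieve_INT[OF pre K b])
  fix k assume k: "k \<in> K"
  show "gsieve b (\<lambda>c h. amap (L k) b c h (x k) = amap (L k) b c h (y k))"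
    using L[OF k] x[OF k] y[OF k] b by (simp add: elementwise_lucid_def)
  fix c d f h assume "c \<in> ob" "d \<in> ob" "f \<in> Hom A c d" "h \<in> Hom A d b"
    "amap (L k) b d h (x k) = amap (L k) b d h (y k)"
  then show "amap (L k) b c (Comp A c d b h f) (x k) = amap (L k) b c (Comp A c d b h f) (y k)"
    using L[OF k] x[OF k] y[OF k] b by (simp add: elementwise_lucid_def)
qed

section \<open>Products and limits of lucid presheaves\<close>

text \<open>A family of elements restricts a family \<open>m\<close> of generators along a family of
  arrows with common domain. For fixed \<open>m\<close> these arrows form a product of
  representables, which precompleteness generates, and there is only a small set of choices
  \<open>m\<close>.\<close>

lemma product_generated:
  fixes J :: "'j set"
  assumes pre: precomplete and J: "usmall TYPE('u) J" and F: "\<And>j. j \<in> J \<Longrightarrow> F j \<in> Obj PS"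
    and gen: "\<And>j. j \<in> J \<Longrightarrow> generated (omap (F j)) (amap (F j))"
  shows "generated (\<lambda>c. \<Pi>\<^sub>E j \<in> J. omap (F j) c) (\<lambda>d c f z. \<lambda>j\<in>J. amap (F j) d c f (z j))"
proof -
  have "\<forall>j\<in>J. \<exists>G. usmall TYPE('u) G \<and> (\<forall>d w. (d, w) \<in> G \<longrightarrow> d \<in> ob \<and> w \<in> omap (F j) d) \<and>
      (\<forall>c v. c \<in> ob \<and> v \<in> omap (F j) c \<longrightarrow>
        (\<exists>d w f. (d, w) \<in> G \<and> f \<in> Hom A c d \<and> v = amap (F j) d c f w))"
    using generatedE[OF gen] by (metis (no_types, lifting))
  from bchoice[OF this] obtain G where G: "\<And>j. j \<in> J \<Longrightarrow> usmall TYPE('u) (G j)"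
    "\<And>j d w. \<lbrakk>j \<in> J; (d, w) \<in> G j\<rbrakk> \<Longrightarrow> d \<in> ob \<and> w \<in> omap (F j) d"
    "\<And>j c v. \<lbrakk>j \<in> J; c \<in> ob; v \<in> omap (F j) c\<rbrakk> \<Longrightarrow>
       \<exists>d w f. (d, w) \<in> G j \<and> f \<in> Hom A c d \<and> v = amap (F j) d c f w"
    by blast
  have m: "fst (m j) \<in> ob" "snd (m j) \<in> omap (F j) (fst (m j))" if "m \<in> Pi\<^sub>E J G" "j \<in> J" for m j
    using G(2)[OF that(2), of "fst (m j)" "snd (m j)"] PiE_mem[OF that] by auto
  show ?thesis
  proof (rule generated_cover[where M = "Pi\<^sub>E J G" and V = "\<lambda>m c. \<Pi>\<^sub>E j \<in> J. Hom A c (fst (m j))" and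
        actV = "\<lambda>m. family_act J (\<lambda>j. fst (m j))" and
        \<phi> = "\<lambda>m c h. \<lambda>j\<in>J. amap (F j) (fst (m j)) c (h j) (snd (m j))"])
    show "usmall TYPE('u) (Pi\<^sub>E J G)" by (intro usmall_PiE J G)
  next
    fix m assume mM: "m \<in> Pi\<^sub>E J G"
    show "generated (\<lambda>c. \<Pi>\<^sub>E j\<in>J. Hom A c (fst (m j))) (family_act J (\<lambda>j. fst (m j)))"
      by (rule families_generated[OF pre J m(1)[OF mM]])
    fix c h assume "c \<in> ob"
    then show "(\<lambda>j\<in>J. amap (F j) (fst (m j)) c (h j) (snd (m j))) \<in> (\<Pi>\<^sub>E j\<in>J. omap (F j) c)"
      if "h \<in> (\<Pi>\<^sub>E j\<in>J. Hom A c (fst (m j)))"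
      using that m[OF mM] F by (auto simp: PiE_iff)
  next
    fix m c d f h
    assume mM: "m \<in> Pi\<^sub>E J G" and "c \<in> ob" "d \<in> ob" "f \<in> Hom A c d"
      and "h \<in> (\<Pi>\<^sub>E j\<in>J. Hom A d (fst (m j)))"
    then show "(\<lambda>j\<in>J. amap (F j) (fst (m j)) c (family_act J (\<lambda>j. fst (m j)) d c f h j) (snd (m j))) =
        (\<lambda>j\<in>J. amap (F j) d c f ((\<lambda>j\<in>J. amap (F j) (fst (m j)) d (h j) (snd (m j))) j))"
      using m[OF mM] F by (intro restrict_ext) (auto simp: family_act_def PiE_iff)
  next
    fix c z assume c: "c \<in> ob" and z: "z \<in> (\<Pi>\<^sub>E j\<in>J. omap (F j) c)"
    have "\<forall>j\<in>J. \<exists>x. (fst x, fst (snd x)) \<in> G j \<and> snd (snd x) \<in> Hom A c (fst x) \<and>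
        z j = amap (F j) (fst x) c (snd (snd x)) (fst (snd x))"
    proof
      fix j assume j: "j \<in> J"
      from G(3)[OF j c PiE_mem[OF z j]] obtain d w f
        where "(d, w) \<in> G j \<and> f \<in> Hom A c d \<and> z j = amap (F j) d c f w" by blast
      then show "\<exists>x. (fst x, fst (snd x)) \<in> G j \<and> snd (snd x) \<in> Hom A c (fst x) \<and>
        z j = amap (F j) (fst x) c (snd (snd x)) (fst (snd x))" by (intro exI[of _ "(d, w, f)"]) simp
    qed
    from bchoice[OF this] obtain x where x: "\<And>j. j \<in> J \<Longrightarrow> (fst (x j), fst (snd (x j))) \<in> G j"
      "\<And>j. j \<in> J \<Longrightarrow> snd (snd (x j)) \<in> Hom A c (fst (x j))"
      "\<And>j. j \<in> J \<Longrightarrow> z j = amap (F j) (fst (x j)) c (snd (snd (x j))) (fst (snd (x j)))" by blast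
    define m where "m = (\<lambda>j\<in>J. (fst (x j), fst (snd (x j))))"
    have "m \<in> Pi\<^sub>E J G" using x(1) by (simp add: m_def)
    moreover have "(\<lambda>j\<in>J. snd (snd (x j))) \<in> (\<Pi>\<^sub>E j\<in>J. Hom A c (fst (m j)))" using x(2) by (simp add: m_def)
    moreover have "z = (\<lambda>j\<in>J. amap (F j) (fst (m j)) c ((\<lambda>j\<in>J. snd (snd (x j))) j) (snd (m j)))"
    proof -
      have "(\<lambda>j\<in>J. amap (F j) (fst (m j)) c ((\<lambda>j\<in>J. snd (snd (x j))) j) (snd (m j))) = (\<lambda>j\<in>J. z j)"
        by (rule restrict_ext) (simp add: m_def x(3)[symmetric])
      also have "\<dots> = z" using z by (simp add: PiE_iff extensional_restrict)
      finally show ?thesis by simp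
    qed
    ultimately show "\<exists>m h. m \<in> Pi\<^sub>E J G \<and> h \<in> (\<Pi>\<^sub>E j\<in>J. Hom A c (fst (m j))) \<and>
        z = (\<lambda>j\<in>J. amap (F j) (fst (m j)) c (h j) (snd (m j)))" by blast
  qed
qed

text \<open>The product is generated first. For each of its generators \<open>y\<close> the arrows
  that make the restriction of \<open>y\<close> a matching family form a small intersection of
  equalizing sieves, and these sieves cover the limit.\<close>

lemma compat_generated:
  assumes pre: precomplete and J: "small_category (J :: ('u, 'u) cat)" and D: "is_functor J PS D"
    and luc: "\<And>j. j \<in> Obj J \<Longrightarrow> elementwise_lucid (omap D j)"
  shows "generated (compat J D) (\<lambda>d c f z. \<lambda>j\<in>Obj J. amap (omap D j) d c f (z j))"
proof -
  note Dj = functor_PS(1)[OF D] and Du = functor_PS(2)[OF D]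
  have sJ: "usmall TYPE('u) (Obj J)" using J by (simp add: small_category_def small_iff_usmall)
  let ?act = "\<lambda>d c f z. \<lambda>j\<in>Obj J. amap (omap D j) d c f (z j)"
  have "generated (\<lambda>c. \<Pi>\<^sub>E j\<in>Obj J. omap (omap D j) c) ?act"
    by (rule product_generated[OF pre sJ Dj]) (use luc in \<open>auto simp: elementwise_lucid_def\<close>)
  then obtain G where G: "usmall TYPE('u) G"
    "\<And>d y. (d, y) \<in> G \<Longrightarrow> d \<in> ob \<and> y \<in> (\<Pi>\<^sub>E j\<in>Obj J. omap (omap D j) d)"
    "\<And>c z. \<lbrakk>c \<in> ob; z \<in> (\<Pi>\<^sub>E j\<in>Obj J. omap (omap D j) c)\<rbrakk> \<Longrightarrow>
      \<exists>d y f. (d, y) \<in> G \<and> f \<in> Hom A c d \<and> z = ?act d c f y"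
    by (rule generatedE) blast
  \<comment> \<open>The arrows of \<open>J\<close> with their ends: each of them imposes one
    equation on a family.\<close>
  define R where "R = (SIGMA i:Obj J. SIGMA j:Obj J. Hom J i j)"
  have R: "usmall TYPE('u) R" unfolding R_def using J
    by (intro usmall_Sigma sJ) (auto simp: small_category_def locally_small_def small_iff_usmall)
  let ?T = "\<lambda>d y c h. \<forall>k\<in>R. amap (omap D (fst (snd k))) d c h (y (fst (snd k))) =
    amap (omap D (fst (snd k))) d c h (amap D (fst k) (fst (snd k)) (snd (snd k)) d (y (fst k)))"
  have gs: "gsieve d (?T d y)" if "(d, y) \<in> G" for d y
  proof (rule gsieve_joint_equalizer[OF pre R])
    fix k assume "k \<in> R"
    then have k: "fst k \<in> Obj J" "fst (snd k) \<in> Obj J" "snd (snd k) \<in> Hom J (fst k) (fst (snd k))"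
      by (auto simp: R_def)
    show "elementwise_lucid (omap D (fst (snd k)))" by (rule luc[OF k(2)])
    show "y (fst (snd k)) \<in> omap (omap D (fst (snd k))) d" using G(2)[OF that] k by auto
    show "amap D (fst k) (fst (snd k)) (snd (snd k)) d (y (fst k)) \<in> omap (omap D (fst (snd k))) d"
      using G(2)[OF that] k by (intro hom_in[OF Du[OF k]]) auto
  qed (use G(2)[OF that] in auto)
  \<comment> \<open>By naturality of \<open>amap D i j u\<close> in the presheaf variable, the
    matching condition on the restricted family says that two elements over \<open>d\<close> agree
    after restriction along the same \<open>h\<close>.\<close>
  have key: "?act d c h y \<in> compat J D c \<longleftrightarrow> ?T d y c h"
    if "c \<in> ob" "h \<in> Hom A c d" "(d, y) \<in> G" for c d h y
  proof -
    have d: "d \<in> ob" and y: "\<And>j. j \<in> Obj J \<Longrightarrow> y j \<in> omap (omap D j) d" using G(2)[OF that(3)] by auto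
    have "?act d c h y \<in> (\<Pi>\<^sub>E j\<in>Obj J. omap (omap D j) c)" using that(1,2) d y Dj by auto
    moreover have "amap D i j u c (amap (omap D i) d c h (y i)) =
        amap (omap D j) d c h (amap D i j u d (y i))"
      if "i \<in> Obj J" "j \<in> Obj J" "u \<in> Hom J i j" for i j u
      by (rule hom_natural[OF Dj[OF that(1)] Dj[OF that(2)] Du[OF that] \<open>c \<in> ob\<close> d \<open>h \<in> Hom A c d\<close> y[OF that(1)]])
    ultimately show ?thesis by (auto simp: compat_def R_def)
  qed
  show ?thesis
  proof (rule generated_cover[OF G(1), where V = "\<lambda>m c. {h \<in> Hom A c (fst m). ?T (fst m) (snd m) c h}"
        and actV = "\<lambda>m d c f h. Comp A c d (fst m) h f" and \<phi> = "\<lambda>m c h. ?act (fst m) c h (snd m)"])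
    fix m assume "m \<in> G"
    then have m: "(fst m, snd m) \<in> G" by simp
    show "generated (\<lambda>c. {h \<in> Hom A c (fst m). ?T (fst m) (snd m) c h})
        (\<lambda>d c f h. Comp A c d (fst m) h f)"
      using gs[OF m] unfolding gsieve_def .
    fix c h assume c: "c \<in> ob"
    show "?act (fst m) c h (snd m) \<in> compat J D c" if "h \<in> {h \<in> Hom A c (fst m). ?T (fst m) (snd m) c h}"
      using that key[OF c _ m] by blast
    fix d f assume "d \<in> ob" "f \<in> Hom A c d" "h \<in> {h \<in> Hom A d (fst m). ?T (fst m) (snd m) d h}"
    then show "?act (fst m) c (Comp A c d (fst m) h f) (snd m) = ?act d c f (?act (fst m) d h (snd m))"
      using c G(2)[OF m] Dj by (intro restrict_ext) (auto dest: PiE_mem)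
  next
    fix c z assume c: "c \<in> ob" and z: "z \<in> compat J D c"
    then have "z \<in> (\<Pi>\<^sub>E j\<in>Obj J. omap (omap D j) c)" by (simp add: compat_def)
    with G(3) c obtain d y f where d: "(d, y) \<in> G" "f \<in> Hom A c d" "z = ?act d c f y" by blast
    with key[OF c d(2,1)] z have "?T d y c f" by blast
    with d show "\<exists>m h. m \<in> G \<and> h \<in> {h \<in> Hom A c (fst m). ?T (fst m) (snd m) c h} \<and>
        z = ?act (fst m) c h (snd m)" by (intro exI[of _ "(d, y)"] exI[of _ f]) simp
  qed
qed

text \<open>The projections are jointly injective, so two elements of the limit are equalized
  exactly where all their coordinates are. The equalizing sieve is thus a small intersection of
  equalizing sieves of the \<open>omap D j\<close>.\<close>

lemma limit_of_lucid:
  assumes pre: precomplete and J: "small_category (J :: ('u, 'u) cat)" and D: "is_functor J PS D"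
    and luc: "\<And>j. j \<in> Obj J \<Longrightarrow> elementwise_lucid (omap D j)"
  obtains L p where "is_limit J PS D L p" "elementwise_lucid L"
proof -
  have sJ: "usmall TYPE('u) (Obj J)" using J by (simp add: small_category_def small_iff_usmall)
  obtain L p \<theta> where L: "is_limit J PS D L p"
    and \<theta>: "\<And>c z. \<lbrakk>c \<in> ob; z \<in> compat J D c\<rbrakk> \<Longrightarrow> \<theta> c z \<in> omap L c"
    and p\<theta>: "\<And>c z j. \<lbrakk>c \<in> ob; z \<in> compat J D c; j \<in> Obj J\<rbrakk> \<Longrightarrow> p j c (\<theta> c z) = z j"
    and surj: "\<And>c x. \<lbrakk>c \<in> ob; x \<in> omap L c\<rbrakk> \<Longrightarrow> \<exists>z \<in> compat J D c. x = \<theta> c z"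
    and nat: "\<And>c d f z. \<lbrakk>c \<in> ob; d \<in> ob; f \<in> Hom A c d; z \<in> compat J D d\<rbrakk> \<Longrightarrow>
       amap L d c f (\<theta> d z) = \<theta> c (\<lambda>j\<in>Obj J. amap (omap D j) d c f (z j))"
    by (rule ex_limit[OF sJ D]) blast
  note Dj = functor_PS(1)[OF D]
  have LP: "L \<in> Obj PS" and p: "\<And>j. j \<in> Obj J \<Longrightarrow> p j \<in> Hom PS L (omap D j)"
    using L by (auto simp: is_limit_def is_cone_def)
  have monic: "x = y" if "c \<in> ob" "x \<in> omap L c" "y \<in> omap L c" "\<And>j. j \<in> Obj J \<Longrightarrow> p j c x = p j c y" for c x y
  proof -
    from surj[OF that(1,2)] obtain z where z: "z \<in> compat J D c" "x = \<theta> c z" by blast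
    from surj[OF that(1,3)] obtain z' where z': "z' \<in> compat J D c" "y = \<theta> c z'" by blast
    have "z = z'"
    proof (rule PiE_ext)
      show "z \<in> (\<Pi>\<^sub>E j\<in>Obj J. omap (omap D j) c)" "z' \<in> (\<Pi>\<^sub>E j\<in>Obj J. omap (omap D j) c)"
        using z z' by (auto simp: compat_def)
      show "z j = z' j" if "j \<in> Obj J" for j
        using \<open>\<And>j. j \<in> Obj J \<Longrightarrow> p j c x = p j c y\<close>[OF that] p\<theta> z z' that \<open>c \<in> ob\<close> by simp
    qed
    with z z' show ?thesis by simp
  qed
  have "elementwise_lucid L"
    unfolding elementwise_lucid_def
  proof (intro conjI ballI LP)
    show "generated (omap L) (amap L)"
    proof (rule generated_surj[OF compat_generated[OF pre J D luc], where \<phi> = \<theta>])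
      show "\<exists>z. z \<in> compat J D c \<and> x = \<theta> c z" if "c \<in> ob" "x \<in> omap L c" for c x
        using surj[OF that] by blast
    qed (simp_all add: \<theta> nat)
    fix b x y assume b: "b \<in> ob" and x: "x \<in> omap L b" and y: "y \<in> omap L b"
    have "gsieve b (\<lambda>c h. \<forall>j\<in>Obj J. amap (omap D j) b c h (p j b x) = amap (omap D j) b c h (p j b y))"
      by (rule gsieve_joint_equalizer[OF pre sJ b luc]) (use hom_in[OF p b] x y in auto)
    then show "gsieve b (\<lambda>c h. amap L b c h x = amap L b c h y)"
    proof (rule gsieve_cong[rotated])
      fix c h assume c: "c \<in> ob" "h \<in> Hom A c b"
      have *: "p j c (amap L b c h x) = amap (omap D j) b c h (p j b x)"
        "p j c (amap L b c h y) = amap (omap D j) b c h (p j b y)" if "j \<in> Obj J" for j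
        using hom_natural[OF LP Dj[OF that] p[OF that] c(1) b c(2)] x y by auto
      show "(\<forall>j\<in>Obj J. amap (omap D j) b c h (p j b x) = amap (omap D j) b c h (p j b y)) \<longleftrightarrow>
          amap L b c h x = amap L b c h y"
      proof
        assume eq: "\<forall>j\<in>Obj J. amap (omap D j) b c h (p j b x) = amap (omap D j) b c h (p j b y)"
        show "amap L b c h x = amap L b c h y"
          by (rule monic[OF c(1)]) (use * eq c b x y LP in auto)
      next
        assume "amap L b c h x = amap L b c h y"
        then show "\<forall>j\<in>Obj J. amap (omap D j) b c h (p j b x) = amap (omap D j) b c h (p j b y)"
          using *[symmetric] by simp
      qed
    qed
  qed
  with L show thesis by (rule that)
qed

section \<open>Representable presheaves in terms of universal elements\<close>

text \<open>The Yoneda arrow of \<open>x\<close> is a bijection at every object. This form replaces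
  an isomorphism with \<open>hom_presheaf A a\<close> and its inverse.\<close>

definition universal_element :: "('o, 'u) presheaf \<Rightarrow> 'o \<Rightarrow> 'u \<Rightarrow> bool" where
  "universal_element P a x \<longleftrightarrow> P \<in> Obj PS \<and> a \<in> ob \<and> x \<in> omap P a \<and>
     (\<forall>c \<in> ob. bij_betw (\<lambda>h. amap P a c h x) (Hom A c a) (omap P c))"

lemma representables_universal_element:
  assumes "P \<in> representables A"
  obtains a x where "universal_element P a x"
proof -
  from assms obtain a where P: "P \<in> Obj PS" and a: "a \<in> ob" and "isomorphic PS P (hom_presheaf A a)"
    by (auto simp: representables_def)
  let ?H = "hom_presheaf A a"
  from \<open>isomorphic PS P ?H\<close> obtain f g where f: "f \<in> Hom PS P ?H" and g: "g \<in> Hom PS ?H P"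
    and gf: "Comp PS P ?H P g f = Id PS P" and fg: "Comp PS ?H P ?H f g = Id PS ?H"
    unfolding isomorphic_def by blast
  have gf': "g c (f c y) = y" if "c \<in> ob" "y \<in> omap P c" for c y
    using fun_cong[OF fun_cong[OF gf], of c y] that by simp
  have fg': "f c (g c h) = h" if "c \<in> ob" "h \<in> Hom A c a" for c h
    using fun_cong[OF fun_cong[OF fg], of c h] that by simp
  define x where "x = g a (Id A a)"
  have x: "x \<in> omap P a" unfolding x_def by (rule hom_in[OF g a]) (simp add: a)
  have gx: "amap P a c h x = g c h" if "c \<in> ob" "h \<in> Hom A c a" for c h
    using yoneda[OF P a g that] by (simp add: x_def)
  have "bij_betw (\<lambda>h. amap P a c h x) (Hom A c a) (omap P c)" if c: "c \<in> ob" for c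
  proof (rule bij_betw_byWitness[where f' = "f c"])
    show "f c ` omap P c \<subseteq> Hom A c a" using hom_in[OF f c] by auto
    show "(\<lambda>h. amap P a c h x) ` Hom A c a \<subseteq> omap P c" using P a c x by auto
    show "\<forall>h\<in>Hom A c a. f c (amap P a c h x) = h" using gx fg' c by simp
    show "\<forall>y\<in>omap P c. amap P a c (f c y) x = y" using gx gf' c hom_in[OF f c] by simp
  qed
  with P a x that show thesis unfolding universal_element_def by blast
qed

lemma hom_presheaf_representable: "a \<in> ob \<Longrightarrow> hom_presheaf A a \<in> representables A"
proof -
  assume a: "a \<in> ob"
  let ?H = "hom_presheaf A a"
  have H: "?H \<in> Obj PS" using a by simp
  then have I: "Id PS ?H \<in> Hom PS ?H ?H" by blast
  have "Comp PS ?H ?H ?H (Id PS ?H) (Id PS ?H) = Id PS ?H"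
    unfolding PS_Comp_eq_iff[OF H H H I I I] by simp
  with I H a show ?thesis unfolding representables_def isomorphic_def by blast
qed

lemma universal_element_generated:
  assumes u: "universal_element P a x" shows "generated (omap P) (amap P)"
proof (rule generatedI)
  show "usmall TYPE('u) {(a, x)}" by (simp add: usmall_finite)
  fix c v assume "c \<in> ob" "v \<in> omap P c"
  then show "\<exists>d w f. (d, w) \<in> {(a, x)} \<and> f \<in> Hom A c d \<and> v = amap P d c f w"
    using u by (auto simp: universal_element_def bij_betw_def)
qed (use u in \<open>auto simp: universal_element_def\<close>)

text \<open>Two elements over \<open>b\<close> are restrictions of the universal element along
  unique arrows \<open>f\<close> and \<open>g\<close> from \<open>b\<close> to \<open>a\<close>.
  They are equalized by the arrows \<open>h\<close> with equal composites, i.e. by the solutions of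
  a system with one unknown and one equation.\<close>

lemma representable_lucid:
  assumes pre: precomplete and u: "universal_element P a x"
  shows "elementwise_lucid P"
  unfolding elementwise_lucid_def
proof (intro conjI ballI universal_element_generated[OF u])
  show P: "P \<in> Obj PS" using u by (simp add: universal_element_def)
  have a: "a \<in> ob" and x: "x \<in> omap P a"
    and bij: "\<And>c. c \<in> ob \<Longrightarrow> bij_betw (\<lambda>h. amap P a c h x) (Hom A c a) (omap P c)"
    using u by (auto simp: universal_element_def)
  fix b y z assume b: "b \<in> ob" and "y \<in> omap P b" "z \<in> omap P b"
  with bij[OF b] obtain f g where f: "f \<in> Hom A b a" "y = amap P a b f x"
    and g: "g \<in> Hom A b a" "z = amap P a b g x" unfolding bij_betw_def by blast
  have "system {()} {()} (\<lambda>_. b) (\<lambda>_. a) (\<lambda>_. ()) (\<lambda>_. ()) (\<lambda>_. f) (\<lambda>_. g)"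
    using a b f g by (auto simp: system_def usmall_finite)
  from solutions_generated[OF pre this]
  show "gsieve b (\<lambda>c h. amap P b c h y = amap P b c h z)"
    unfolding gsieve_def
  proof (rule generated_surj[where \<phi> = "\<lambda>c h. h ()"])
    have eq: "amap P b c h y = amap P b c h z \<longleftrightarrow> Comp A c b a f h = Comp A c b a g h"
      if "c \<in> ob" "h \<in> Hom A c b" for c h
    proof -
      have "amap P b c h y = amap P b c h z \<longleftrightarrow>
          amap P a c (Comp A c b a f h) x = amap P a c (Comp A c b a g h) x"
        using that f g P a b x by simp
      also have "\<dots> \<longleftrightarrow> Comp A c b a f h = Comp A c b a g h"
        using bij[OF that(1)] that a b f g by (intro inj_on_eq_iff[where A = "Hom A c a"]) (auto simp: bij_betw_def)
      finally show ?thesis .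
    qed
    fix c
    assume c: "c \<in> ob"
    show "h () \<in> {h \<in> Hom A c b. amap P b c h y = amap P b c h z}"
      if "h \<in> solutions {()} {()} (\<lambda>_. b) (\<lambda>_. a) (\<lambda>_. ()) (\<lambda>_. ()) (\<lambda>_. f) (\<lambda>_. g) c" for h
    proof -
      have "h () \<in> Hom A c b" "Comp A c b a f (h ()) = Comp A c b a g (h ())"
        using that by (auto simp: solutions_def)
      with eq[OF c] show ?thesis by simp
    qed
    show "\<exists>k. k \<in> solutions {()} {()} (\<lambda>_. b) (\<lambda>_. a) (\<lambda>_. ()) (\<lambda>_. ()) (\<lambda>_. f) (\<lambda>_. g) c \<and> h = k ()"
      if "h \<in> {h \<in> Hom A c b. amap P b c h y = amap P b c h z}" for h
      using that eq[OF c] by (intro exI[of _ "\<lambda>_. h"]) (auto simp: solutions_def)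
  qed (simp add: family_act_def)
qed


subsection \<open>Small presheaves\<close>

lemma PS_Comp_Id:
  assumes "P \<in> Obj PS" "Q \<in> Obj PS" "t \<in> Hom PS P Q"
  shows "Comp PS P P Q t (Id PS P) = t" and "Comp PS P Q Q (Id PS Q) t = t"
proof -
  show "Comp PS P P Q t (Id PS P) = t"
    unfolding PS_Comp_eq_iff[OF assms(1) assms(1) assms(2) PS_Id_in[OF assms(1)] assms(3) assms(3)] by simp
  show "Comp PS P Q Q (Id PS Q) t = t"
    unfolding PS_Comp_eq_iff[OF assms(1) assms(2) assms(2) assms(3) PS_Id_in[OF assms(2)] assms(3)]
    using hom_in[OF assms(3)] by simp
qed

section \<open>From limits of representables to generated systems\<close>

text \<open>A solution at \<open>c\<close> is a cone with vertex the representable at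
  \<open>c\<close>, which lies in the subcategory. The limit \<open>L\<close> therefore maps onto
  the presheaf of solutions, and since \<open>L\<close> belongs to \<open>S\<close> it is generated.
  This serves petty, lucid and small presheaves alike.\<close>

lemma limits_imp_precomplete:
  assumes S: "S \<subseteq> Obj PS" and homs: "\<And>a. a \<in> ob \<Longrightarrow> hom_presheaf A a \<in> S"
    and gen: "\<And>P. P \<in> S \<Longrightarrow> generated (omap P) (amap P)"
    and lim: "has_limits_of TYPE('u) (full_subcategory PS S) (representables A)"
  shows precomplete
  unfolding precomplete_def
proof (intro allI impI, elim conjE)
  fix I K :: "'u set" and a b s t f g
  assume dis: "I \<inter> K = {}" and sys: "system I K a b s t f g"
  have sI: "usmall TYPE('u) I" and sK: "usmall TYPE('u) K" and a: "\<And>i. i \<in> I \<Longrightarrow> a i \<in> ob"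
    and k: "\<And>k. k \<in> K \<Longrightarrow> s k \<in> I" "\<And>k. k \<in> K \<Longrightarrow> t k \<in> I" "\<And>k. k \<in> K \<Longrightarrow> b k \<in> ob"
      "\<And>k. k \<in> K \<Longrightarrow> f k \<in> Hom A (a (s k)) (b k)" "\<And>k. k \<in> K \<Longrightarrow> g k \<in> Hom A (a (t k)) (b k)"
    using sys by (auto simp: system_def)
  \<comment> \<open>Three names of arrows: \<open>e0\<close> for identities, \<open>e1\<close> for
    the arrows \<open>f k\<close> and \<open>e2\<close> for the arrows \<open>g k\<close>. The last
    two must differ because \<open>s k\<close> and \<open>t k\<close> may coincide.\<close>
  obtain n :: "nat \<Rightarrow> 'u" where n: "inj n"
    using universe_infinite infinite_countable_subset by blast
  define e0 e1 e2 where "e0 = n 0" and "e1 = n 1" and "e2 = n 2"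
  have e012 [simp]: "e1 \<noteq> e0" "e2 \<noteq> e0" "e1 \<noteq> e2" "e0 \<noteq> e1" "e0 \<noteq> e2" "e2 \<noteq> e1"
    using n by (auto simp: inj_eq e0_def e1_def e2_def)
  \<comment> \<open>All arrows other than identities lead from \<open>I\<close> to \<open>K\<close>,
    and these are disjoint. Of two composable arrows one is thus \<open>e0\<close>, and the
    composite is the other one.\<close>
  define J :: "('u, 'u) cat" where "J = \<lparr>Obj = I \<union> K,
    Hom = \<lambda>x y. {u. u = e0 \<and> x = y \<or> u = e1 \<and> x \<in> I \<and> y \<in> K \<and> x = s y \<or>
      u = e2 \<and> x \<in> I \<and> y \<in> K \<and> x = t y},
    Comp = \<lambda>x y z v u. if u = e0 then v else u, Id = \<lambda>_. e0\<rparr>"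
  have J: "small_category J"
    unfolding small_category_def locally_small_def small_iff_usmall
  proof (intro conjI ballI)
    show "category J"
      unfolding category_def J_def using dis by auto
    show "usmall TYPE('u) (Obj J)" by (simp add: J_def usmall_Un sI sK)
    show "usmall TYPE('u) (Hom J x y)" for x y
      by (rule usmall_subset[OF usmall_finite, of "{e0, e1, e2}"]) (auto simp: J_def)
  qed
  have HJ: "u \<in> Hom J x y \<longleftrightarrow> u = e0 \<and> x = y \<or> u = e1 \<and> x \<in> I \<and> y \<in> K \<and> x = s y \<or>
      u = e2 \<and> x \<in> I \<and> y \<in> K \<and> x = t y" for u x y by (simp add: J_def)
  define o' where "o' x = (if x \<in> I then a x else b x)" for x
  have o': "o' x \<in> ob" if "x \<in> I \<union> K" for x using that a k(3) by (auto simp: o'_def)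
  have o'I: "o' i = a i" if "i \<in> I" for i using that by (simp add: o'_def)
  have o'K: "o' j = b j" if "j \<in> K" for j using that dis by (auto simp: o'_def)
  define D where "D = \<lparr>omap = \<lambda>x. hom_presheaf A (o' x),
    amap = \<lambda>x y u. if u = e0 then Id PS (hom_presheaf A (o' x))
      else if u = e1 then yon (hom_presheaf A (o' y)) (o' x) (f y)
      else yon (hom_presheaf A (o' y)) (o' x) (g y)\<rparr>"
  have oD [simp]: "omap D x = hom_presheaf A (o' x)" for x by (simp add: D_def)
  have D_in: "amap D x y u \<in> Hom PS (hom_presheaf A (o' x)) (hom_presheaf A (o' y))"
    if "x \<in> I \<union> K" "y \<in> I \<union> K" "u \<in> Hom J x y" for x y u
  proof -
    note u = that(3)
    consider "u = e0" "x = y" | "u = e1" "x \<in> I" "y \<in> K" "x = s y" | "u = e2" "x \<in> I" "y \<in> K" "x = t y"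
      using u unfolding HJ by blast
    then show ?thesis
    proof cases
      case 1
      then show ?thesis using o'[OF that(1)] by (auto simp: D_def intro!: PS_Id_in)
    next
      case 2
      then show ?thesis using k(3,4)[of y] a[of x] by (auto simp: D_def o'I o'K intro!: yon_in)
    next
      case 3
      then show ?thesis using k(3,5)[of y] a[of x] by (auto simp: D_def o'I o'K intro!: yon_in)
    qed
  qed
  have D0: "amap D x x e0 = Id PS (hom_presheaf A (o' x))" for x by (simp add: D_def)
  have DPS: "is_functor J PS D"
    unfolding is_functor_def
  proof (intro conjI ballI)
    show "omap D x \<in> Obj PS" if "x \<in> Obj J" for x using that o' by (simp add: J_def)
    show "amap D x y u \<in> Hom PS (omap D x) (omap D y)"
      if "x \<in> Obj J" "y \<in> Obj J" "u \<in> Hom J x y" for x y u using D_in that by (simp add: J_def)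
    show "amap D x x (Id J x) = Id PS (omap D x)" for x using D0 by (simp add: J_def)
    fix x y z u v assume *: "x \<in> Obj J" "y \<in> Obj J" "z \<in> Obj J" "u \<in> Hom J x y" "v \<in> Hom J y z"
    then have x: "x \<in> I \<union> K" and y: "y \<in> I \<union> K" and z: "z \<in> I \<union> K" by (auto simp: J_def)
    note hx = hom_presheaf_psh[OF o'[OF x]] and hy = hom_presheaf_psh[OF o'[OF y]]
      and hz = hom_presheaf_psh[OF o'[OF z]]
    show "amap D x z (Comp J x y z v u) =
        Comp PS (omap D x) (omap D y) (omap D z) (amap D y z v) (amap D x y u)"
    proof (cases "u = e0")
      case True
      with * have "x = y" by (auto simp: J_def)
      with True show ?thesis using PS_Comp_Id(1)[OF hy hz D_in[OF y z *(5)]] D0 by (simp add: J_def)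
    next
      case False
      with *(4,5) dis have v: "v = e0" "y = z" by (auto simp: J_def)
      with False show ?thesis using PS_Comp_Id(2)[OF hx hy D_in[OF x y *(4)]] D0 by (simp add: J_def)
    qed
  qed
  then have "is_functor J (full_subcategory PS S) D"
    by (rule is_functor_full_subcategoryI) (simp add: homs o' J_def)
  moreover have "omap D j \<in> representables A" if "j \<in> Obj J" for j
    using that o' hom_presheaf_representable by (simp add: J_def)
  ultimately obtain L p where L: "is_limit J (full_subcategory PS S) D L p"
    using lim[unfolded has_limits_of_def, rule_format, of J D] J by blast
  then have LS: "L \<in> S" and p: "\<And>i. i \<in> I \<union> K \<Longrightarrow> p i \<in> Hom PS L (hom_presheaf A (o' i))"
    and pc: "\<And>i j u. \<lbrakk>i \<in> I \<union> K; j \<in> I \<union> K; u \<in> Hom J i j\<rbrakk> \<Longrightarrow>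
      Comp PS L (hom_presheaf A (o' i)) (hom_presheaf A (o' j)) (amap D i j u) (p i) = p j"
    by (auto simp: is_limit_def is_cone_def full_subcategory_def J_def)
  have LP: "L \<in> Obj PS" using LS S by blast
  have p_in: "p i c x \<in> Hom A c (o' i)" if "i \<in> I \<union> K" "c \<in> ob" "x \<in> omap L c" for i c x
    using hom_in[OF p[OF that(1)] that(2,3)] by simp
  have e1J: "e1 \<in> Hom J (s j) j" and e2J: "e2 \<in> Hom J (t j) j" if "j \<in> K" for j
    using that k by (auto simp: J_def)
  show "generated (solutions I K a b s t f g) (family_act I a)"
  proof (rule generated_surj[OF gen[OF LS], where \<phi> = "\<lambda>c x. \<lambda>i\<in>I. p i c x"])
    fix c x assume c: "c \<in> ob" "x \<in> omap L c"
    show "(\<lambda>i\<in>I. p i c x) \<in> solutions I K a b s t f g c"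
      unfolding solutions_def
    proof (intro CollectI conjI ballI)
      show "(\<lambda>i\<in>I. p i c x) \<in> (\<Pi>\<^sub>E i\<in>I. Hom A c (a i))" using p_in[OF _ c] o'I by force
      fix j assume j: "j \<in> K"
      have 1: "Comp A c (a (s j)) (b j) (f j) (p (s j) c x) = p j c x"
        using fun_cong[OF fun_cong[OF pc[OF _ _ e1J[OF j]]], of c x] p_in[OF _ c, of "s j"] c j k(1,4)[OF j]
        by (simp add: D_def o'I o'K)
      have 2: "Comp A c (a (t j)) (b j) (g j) (p (t j) c x) = p j c x"
        using fun_cong[OF fun_cong[OF pc[OF _ _ e2J[OF j]]], of c x] p_in[OF _ c, of "t j"] c j k(2,5)[OF j]
        by (simp add: D_def o'I o'K)
      show "Comp A c (a (s j)) (b j) (f j) ((\<lambda>i\<in>I. p i c x) (s j)) =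
          Comp A c (a (t j)) (b j) (g j) ((\<lambda>i\<in>I. p i c x) (t j))"
        using 1 2 k(1,2)[OF j] by simp
    qed
  next
    fix c d u x assume c: "c \<in> ob" "d \<in> ob" "u \<in> Hom A c d" "x \<in> omap L d"
    show "(\<lambda>i\<in>I. p i c (amap L d c u x)) = family_act I a d c u (\<lambda>i\<in>I. p i d x)"
      unfolding family_act_def
    proof (rule restrict_ext)
      fix i assume i: "i \<in> I"
      have "p i c (amap L d c u x) = amap (hom_presheaf A (o' i)) d c u (p i d x)"
        using i o' by (intro hom_natural[OF LP _ p c]) auto
      then show "p i c (amap L d c u x) = Comp A c d (a i) ((\<lambda>i\<in>I. p i d x) i) u"
        using p_in[of i, OF _ c(2,4)] i by (simp add: o'I)
    qed
  next
    fix c h assume c: "c \<in> ob" and h: "h \<in> solutions I K a b s t f g c"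
    have hi: "h i \<in> Hom A c (a i)" if "i \<in> I" for i using h that by (auto simp: solutions_def)
    have hk: "Comp A c (a (s j)) (b j) (f j) (h (s j)) = Comp A c (a (t j)) (b j) (g j) (h (t j))"
      if "j \<in> K" for j using h that by (simp add: solutions_def)
    \<comment> \<open>The coordinates at \<open>K\<close> are filled in along \<open>f\<close>; the
      equations \<open>hk\<close> make them correct along \<open>g\<close> too.\<close>
    define r where "r i = (if i \<in> I then h i else Comp A c (a (s i)) (b i) (f i) (h (s i)))" for i
    have r: "r i \<in> Hom A c (o' i)" if "i \<in> I \<union> K" for i
      using that hi k a c by (auto simp: r_def o'_def)
    define q where "q i = yon (hom_presheaf A (o' i)) c (r i)" for i
    let ?C = "hom_presheaf A c"
    have q: "q i \<in> Hom PS ?C (hom_presheaf A (o' i))" if "i \<in> I \<union> K" for i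
      unfolding q_def using that o' r c by (intro yon_in) auto
    have "is_cone J (full_subcategory PS S) D ?C q"
      unfolding is_cone_def
    proof (intro conjI ballI)
      show "?C \<in> Obj (full_subcategory PS S)" using homs c by (simp add: full_subcategory_def)
      show "q i \<in> Hom (full_subcategory PS S) ?C (omap D i)" if "i \<in> Obj J" for i
        using that q by (simp add: full_subcategory_def J_def)
      fix i j u assume ij: "i \<in> Obj J" "j \<in> Obj J" and u: "u \<in> Hom J i j"
      then have ij': "i \<in> I \<union> K" "j \<in> I \<union> K" by (auto simp: J_def)
      note hI = hom_presheaf_psh[OF o'[OF ij'(1)]] and hJ = hom_presheaf_psh[OF o'[OF ij'(2)]]
      have "Comp PS ?C (hom_presheaf A (o' i)) (hom_presheaf A (o' j)) (amap D i j u) (q i) = q j"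
        unfolding PS_Comp_eq_iff[OF hom_presheaf_psh[OF c] hI hJ q[OF ij'(1)] D_in[OF ij' u] q[OF ij'(2)]]
      proof (intro ballI)
        fix d w assume d: "d \<in> ob" "w \<in> omap ?C d"
        then have w: "w \<in> Hom A d c" by simp
        have qi: "q i d w = Comp A d c (o' i) (r i) w" if "i \<in> I \<union> K" for i
          using that w d r by (simp add: q_def)
        have in_i: "Comp A d c (o' i) (r i) w \<in> Hom A d (o' i)"
          using w d r c o' ij' by blast
        consider "u = e0" "i = j" | "u = e1" "i \<in> I" "j \<in> K" "i = s j" | "u = e2" "i \<in> I" "j \<in> K" "i = t j"
          using u unfolding HJ by blast
        then show "amap D i j u d (q i d w) = q j d w"
        proof cases
          case 1
          then show ?thesis using D0 qi[OF ij'(2)] in_i d by simp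
        next
          case 2
          then have rj: "r j = Comp A c (a i) (b j) (f j) (r i)" using dis by (auto simp: r_def)
          show ?thesis unfolding rj qi[OF ij'(1)] qi[OF ij'(2)]
            using 2 in_i d w c k(3,4)[of j] a r[OF ij'(1)] by (simp add: D_def o'I o'K Comp_assoc)
        next
          case 3
          then have rj: "r j = Comp A c (a i) (b j) (g j) (r i)" using dis hk by (auto simp: r_def)
          show ?thesis unfolding rj qi[OF ij'(1)] qi[OF ij'(2)]
            using 3 in_i d w c k(3,5)[of j] a r[OF ij'(1)] by (simp add: D_def o'I o'K Comp_assoc)
        qed
      qed
      then show "Comp (full_subcategory PS S) ?C (omap D i) (omap D j) (amap D i j u) (q i) = q j"
        by (simp add: full_subcategory_def)
    qed
    from limit_ex[OF L this] obtain m where m: "m \<in> Hom PS ?C L"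
      "\<And>i. i \<in> I \<union> K \<Longrightarrow> Comp PS ?C L (hom_presheaf A (o' i)) (p i) m = q i"
      unfolding full_subcategory_def J_def by auto
    \<comment> \<open>Yoneda converts the mediating arrow into an element of \<open>L\<close>, whose
      coordinates are those of the given solution.\<close>
    define x where "x = m c (Id A c)"
    have "x \<in> omap L c" unfolding x_def using hom_in[OF m(1) c] c by simp
    moreover have "h = (\<lambda>i\<in>I. p i c x)"
    proof -
      have "(\<lambda>i\<in>I. p i c x) = (\<lambda>i\<in>I. h i)"
      proof (rule restrict_ext)
        fix i assume i: "i \<in> I"
        then show "p i c x = h i"
          using fun_cong[OF fun_cong[OF m(2)], of i c "Id A c"] c hi[OF i] a
          by (simp add: x_def q_def r_def o'I)
      qed
      also have "\<dots> = h" using h by (simp add: solutions_def PiE_iff extensional_restrict)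
      finally show ?thesis by simp
    qed
    ultimately show "\<exists>x. x \<in> omap L c \<and> h = (\<lambda>i\<in>I. p i c x)" by blast
  qed
qed

section \<open>Colimits of representables from generators and relations\<close>

text \<open>\<open>P\<close> is presented by the generators \<open>G0\<close>, with every
  coincidence of two restrictions of generators traced back to an element of \<open>G\<close> that
  is a common restriction of both. An arrow out of \<open>P\<close> can then be defined on
  restrictions of generators, and the presentation is exactly what makes it well defined.\<close>

lemma small_presheafI:
  assumes P: "P \<in> Obj PS" and sG: "usmall TYPE('u) G"
    and G: "\<And>a x. (a, x) \<in> G \<Longrightarrow> a \<in> ob \<and> x \<in> omap P a" and G0: "G0 \<subseteq> G"
    and gen: "\<And>c z. \<lbrakk>c \<in> ob; z \<in> omap P c\<rbrakk> \<Longrightarrow>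
      \<exists>a x f. (a, x) \<in> G0 \<and> f \<in> Hom A c a \<and> z = amap P a c f x"
    and rel: "\<And>a x b y c f g. \<lbrakk>(a, x) \<in> G0; (b, y) \<in> G0; c \<in> ob; f \<in> Hom A c a; g \<in> Hom A c b;
      amap P a c f x = amap P b c g y\<rbrakk> \<Longrightarrow>
      \<exists>d z u v w. (d, z) \<in> G \<and> u \<in> Hom A d a \<and> v \<in> Hom A d b \<and> w \<in> Hom A c d \<and>
        amap P a d u x = z \<and> amap P b d v y = z \<and> f = Comp A c d a u w \<and> g = Comp A c d b v w"
  shows "small_presheaf A P"
proof -
  obtain e :: "'o \<times> 'u \<Rightarrow> 'u" where e: "inj_on e G" "usmall TYPE('u) (e ` G)"
    using usmall_encode[OF sG] by blast
  define a where "a j = fst (inv_into G e j)" for j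
  define x where "x j = snd (inv_into G e j)" for j
  have ax: "(a j, x j) \<in> G" if "j \<in> e ` G" for j using inv_into_into[OF that] by (simp add: a_def x_def)
  have a: "a j \<in> ob" and x: "x j \<in> omap P (a j)" if "j \<in> e ` G" for j using G ax[OF that] by auto
  have ae: "a (e (d, y)) = d" "x (e (d, y)) = y" "e (d, y) \<in> e ` G" if "(d, y) \<in> G" for d y
    using that e by (auto simp: a_def x_def)
  \<comment> \<open>The full subcategory of the category of elements of \<open>P\<close> on the
    pairs in \<open>G\<close>, its objects coded in \<open>'u\<close>.\<close>
  define J :: "('u, 'u) cat" where "J = \<lparr>Obj = e ` G,
    Hom = \<lambda>i j. {h \<in> Hom A (a i) (a j). amap P (a j) (a i) h (x j) = x i},
    Comp = \<lambda>i j k. Comp A (a i) (a j) (a k), Id = \<lambda>i. Id A (a i)\<rparr>"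
  have oJ: "Obj J = e ` G" by (simp add: J_def)
  have J: "small_category J"
    unfolding small_category_def locally_small_def small_iff_usmall
  proof (intro conjI ballI)
    show "category J"
      unfolding category_def using a x P by (auto simp: J_def Comp_assoc)
    show "usmall TYPE('u) (Obj J)" by (simp add: J_def e)
    show "usmall TYPE('u) (Hom J i j)" if "i \<in> Obj J" "j \<in> Obj J" for i j
      by (rule usmall_subset[OF usmall_Hom[of "a i" "a j"]]) (use that a in \<open>auto simp: J_def\<close>)
  qed
  define D where "D = \<lparr>omap = \<lambda>j. hom_presheaf A (a j),
    amap = \<lambda>i j h. yon (hom_presheaf A (a j)) (a i) h\<rparr>"
  have oD [simp]: "omap D j = hom_presheaf A (a j)" for j by (simp add: D_def)
  have H: "hom_presheaf A (a j) \<in> Obj PS" if "j \<in> e ` G" for j using a[OF that] by simp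
  have D_in: "amap D i j h \<in> Hom PS (hom_presheaf A (a i)) (hom_presheaf A (a j))"
    if "i \<in> e ` G" "j \<in> e ` G" "h \<in> Hom A (a i) (a j)" for i j h
    unfolding D_def using that a by (auto intro!: yon_in)
  have DPS: "is_functor J PS D"
    unfolding is_functor_def oJ
  proof (intro conjI ballI)
    show "omap D j \<in> Obj PS" if "j \<in> e ` G" for j using H that by simp
    show "amap D i j h \<in> Hom PS (omap D i) (omap D j)"
      if "i \<in> e ` G" "j \<in> e ` G" "h \<in> Hom J i j" for i j h using D_in that by (simp add: J_def)
    show "amap D j j (Id J j) = Id PS (omap D j)" if j: "j \<in> e ` G" for j
      by (rule hom_eqI[where P = "hom_presheaf A (a j)" and Q = "hom_presheaf A (a j)"])
        (use D_in[OF j j] PS_Id_in[OF H[OF j]] a[OF j] in \<open>auto simp: J_def D_def\<close>)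
    fix i j k h l assume *: "i \<in> e ` G" "j \<in> e ` G" "k \<in> e ` G" "h \<in> Hom J i j" "l \<in> Hom J j k"
    then have hl: "h \<in> Hom A (a i) (a j)" "l \<in> Hom A (a j) (a k)" by (auto simp: J_def)
    have hl': "Comp A (a i) (a j) (a k) l h \<in> Hom A (a i) (a k)" using hl a * by blast
    have "Comp PS (hom_presheaf A (a i)) (hom_presheaf A (a j)) (hom_presheaf A (a k)) (amap D j k l) (amap D i j h) =
        amap D i k (Comp A (a i) (a j) (a k) l h)"
      unfolding PS_Comp_eq_iff[OF H[OF *(1)] H[OF *(2)] H[OF *(3)] D_in[OF *(1,2) hl(1)]
          D_in[OF *(2,3) hl(2)] D_in[OF *(1,3) hl']]
      using hl hl' a * by (simp add: D_def Comp_assoc[symmetric])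
    then show "amap D i k (Comp J i j k l h) = Comp PS (omap D i) (omap D j) (omap D k) (amap D j k l) (amap D i j h)"
      by (simp add: J_def)
  qed
  define q where "q j = yon P (a j) (x j)" for j
  have q: "q j \<in> Hom PS (hom_presheaf A (a j)) P" if "j \<in> e ` G" for j
    unfolding q_def using P a[OF that] x[OF that] by (rule yon_in)
  have cocone: "is_cocone J PS D P q"
    unfolding is_cocone_def oJ
  proof (intro conjI ballI P)
    show "q j \<in> Hom PS (omap D j) P" if "j \<in> e ` G" for j using q that by simp
    fix i j h assume *: "i \<in> e ` G" "j \<in> e ` G" "h \<in> Hom J i j"
    then have h: "h \<in> Hom A (a i) (a j)" "amap P (a j) (a i) h (x j) = x i" by (auto simp: J_def)
    have "Comp PS (hom_presheaf A (a i)) (hom_presheaf A (a j)) P (q j) (amap D i j h) = q i"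
      unfolding PS_Comp_eq_iff[OF H[OF *(1)] H[OF *(2)] P D_in[OF *(1,2) h(1)] q[OF *(2)] q[OF *(1)]]
    proof (intro ballI)
      fix c k assume c: "c \<in> ob" and "k \<in> omap (hom_presheaf A (a i)) c"
      then have k: "k \<in> Hom A c (a i)" by simp
      have "Comp A c (a i) (a j) h k \<in> Hom A c (a j)" using c k h a * by blast
      then show "q j c (amap D i j h c k) = q i c k"
        using c k h a * x P by (simp add: q_def D_def)
    qed
    then show "Comp PS (omap D i) (omap D j) P (q j) (amap D i j h) = q i" by simp
  qed
  have "is_colimit J PS D P q"
    unfolding is_colimit_def
  proof (intro conjI cocone allI impI)
    fix Q r assume "is_cocone J PS D Q r"
    then have Q: "Q \<in> Obj PS" and r: "\<And>j. j \<in> e ` G \<Longrightarrow> r j \<in> Hom PS (hom_presheaf A (a j)) Q"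
      and rc: "\<And>i j h. \<lbrakk>i \<in> e ` G; j \<in> e ` G; h \<in> Hom J i j\<rbrakk> \<Longrightarrow>
        Comp PS (hom_presheaf A (a i)) (hom_presheaf A (a j)) Q (r j) (amap D i j h) = r i"
      by (auto simp: is_cocone_def oJ)
    have rD: "r j c (Comp A c (a i) (a j) h k) = r i c k"
      if "i \<in> e ` G" "j \<in> e ` G" "h \<in> Hom A (a i) (a j)" "amap P (a j) (a i) h (x j) = x i"
        "c \<in> ob" "k \<in> Hom A c (a i)" for i j h c k
      using fun_cong[OF fun_cong[OF rc[OF that(1,2)]], of h c k] that by (simp add: J_def D_def)
    have r_nat: "r j c (Comp A c d (a j) h k) = amap Q d c k (r j d h)"
      if "j \<in> e ` G" "c \<in> ob" "d \<in> ob" "k \<in> Hom A c d" "h \<in> Hom A d (a j)" for j c d h k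
      using hom_natural[OF H[OF that(1)] Q r[OF that(1)] that(2-4), of h] that by simp
    let ?pr = "\<lambda>c z (j, f). j \<in> e ` G0 \<and> f \<in> Hom A c (a j) \<and> z = amap P (a j) c f (x j)"
    \<comment> \<open>A way of writing \<open>z\<close> as a restriction of a generator is picked
      arbitrarily; \<open>wd\<close> shows that the value does not depend on it.\<close>
    define \<tau> where "\<tau> c z = (case SOME jf. ?pr c z jf of (j, f) \<Rightarrow> r j c f)" for c z
    have G0': "j \<in> e ` G" "(a j, x j) \<in> G0" if "j \<in> e ` G0" for j
      using that G0 ae by auto
    have ex: "\<exists>j f. j \<in> e ` G0 \<and> f \<in> Hom A c (a j) \<and> z = amap P (a j) c f (x j)" if "c \<in> ob" "z \<in> omap P c" for c z
    proof -
      from gen[OF that] obtain d y f where "(d, y) \<in> G0" "f \<in> Hom A c d" "z = amap P d c f y" by blast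
      moreover from this G0 have "(d, y) \<in> G" by blast
      ultimately show ?thesis using ae by (intro exI[of _ "e (d, y)"] exI[of _ f]) simp
    qed
    have wd: "r i c f = r j c g"
      if i: "i \<in> e ` G0" and j: "j \<in> e ` G0" and c: "c \<in> ob" and f: "f \<in> Hom A c (a i)" and g: "g \<in> Hom A c (a j)"
        and eq: "amap P (a i) c f (x i) = amap P (a j) c g (x j)" for i j c f g
    proof -
      from rel[OF G0'(2)[OF i] G0'(2)[OF j] c f g eq] obtain d z u v w
        where d: "(d, z) \<in> G" and u: "u \<in> Hom A d (a i)" "amap P (a i) d u (x i) = z"
          and v: "v \<in> Hom A d (a j)" "amap P (a j) d v (x j) = z" and w: "w \<in> Hom A c d"
          and fg: "f = Comp A c d (a i) u w" "g = Comp A c d (a j) v w" by blast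
      have "r i c f = r (e (d, z)) c w"
        using rD[OF ae(3)[OF d] G0'(1)[OF i], of u c w] u w c ae[OF d] fg by simp
      moreover have "r j c g = r (e (d, z)) c w"
        using rD[OF ae(3)[OF d] G0'(1)[OF j], of v c w] v w c ae[OF d] fg by simp
      ultimately show ?thesis by simp
    qed
    have \<tau>: "\<tau> c (amap P (a j) c f (x j)) = r j c f"
      if "j \<in> e ` G0" "c \<in> ob" "f \<in> Hom A c (a j)" for j c f
    proof -
      let ?z = "amap P (a j) c f (x j)"
      have "?pr c ?z (SOME jf. ?pr c ?z jf)" by (rule someI[of _ "(j, f)"]) (use that in simp)
      moreover obtain i g where ig: "(SOME jf. ?pr c ?z jf) = (i, g)" by fastforce
      ultimately have i: "i \<in> e ` G0" "g \<in> Hom A c (a i)" "?z = amap P (a i) c g (x i)" by auto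
      show ?thesis unfolding \<tau>_def ig using wd[OF that(1) i(1) that(2,3) i(2,3)] by simp
    qed
    have h: "transf P \<tau> \<in> Hom PS P Q"
    proof (rule transf_in[OF P Q])
      fix c z assume c: "c \<in> ob" "z \<in> omap P c"
      with ex obtain j f where j: "j \<in> e ` G0" "f \<in> Hom A c (a j)" "z = amap P (a j) c f (x j)" by blast
      then show "\<tau> c z \<in> omap Q c" using \<tau> c hom_in[OF r[OF G0'(1)[OF j(1)]] c(1)] by simp
    next
      fix c d k z assume c: "c \<in> ob" "d \<in> ob" "k \<in> Hom A c d" "z \<in> omap P d"
      with ex obtain j f where j: "j \<in> e ` G0" "f \<in> Hom A d (a j)" "z = amap P (a j) d f (x j)" by blast
      note jG = G0'(1)[OF j(1)]
      have "amap P d c k z = amap P (a j) c (Comp A c d (a j) f k) (x j)"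
        using c j P a[OF jG] x[OF jG] by simp
      then show "\<tau> c (amap P d c k z) = amap Q d c k (\<tau> d z)"
        using \<tau> r_nat[OF jG c(1-3) j(2)] j c a[OF jG] by simp
    qed
    \<comment> \<open>An object \<open>j\<close> outside the image of \<open>G0\<close> is reached
      through a generator \<open>i\<close>: writing \<open>x j\<close> as a restriction of
      \<open>x i\<close> gives an arrow of \<open>J\<close> from \<open>j\<close> to
      \<open>i\<close>, and \<open>rD\<close> carries the value across.\<close>
    have hq: "\<tau> c (amap P (a j) c k (x j)) = r j c k"
      if j: "j \<in> e ` G" and c: "c \<in> ob" and k: "k \<in> Hom A c (a j)" for j c k
    proof -
      from ex[OF a[OF j] x[OF j]] obtain i f
        where i: "i \<in> e ` G0" "f \<in> Hom A (a j) (a i)" "x j = amap P (a i) (a j) f (x i)" by blast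
      note iG = G0'(1)[OF i(1)]
      have fk: "Comp A c (a j) (a i) f k \<in> Hom A c (a i)" using i k c a[OF j] a[OF iG] by blast
      have "amap P (a j) c k (x j) = amap P (a i) c (Comp A c (a j) (a i) f k) (x i)"
        using i k c a[OF j] a[OF iG] P x[OF iG] by simp
      then show ?thesis using \<tau>[OF i(1) c fk] rD[OF j iG i(2) _ c k] i(3) by simp
    qed
    show "\<exists>!h. h \<in> Hom PS P Q \<and> (\<forall>j\<in>Obj J. Comp PS (omap D j) P Q h (q j) = r j)"
    proof (rule ex1I[of _ "transf P \<tau>"])
      show "transf P \<tau> \<in> Hom PS P Q \<and> (\<forall>j\<in>Obj J. Comp PS (omap D j) P Q (transf P \<tau>) (q j) = r j)"
      proof (intro conjI ballI h)
        fix j assume "j \<in> Obj J"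
        then have j: "j \<in> e ` G" by (simp add: oJ)
        have "Comp PS (hom_presheaf A (a j)) P Q (transf P \<tau>) (q j) = r j"
          unfolding PS_Comp_eq_iff[OF H[OF j] P Q q[OF j] h r[OF j]]
          using hq[OF j] P a[OF j] x[OF j] by (simp add: q_def)
        then show "Comp PS (omap D j) P Q (transf P \<tau>) (q j) = r j" by simp
      qed
    next
      fix k assume k: "k \<in> Hom PS P Q \<and> (\<forall>j\<in>Obj J. Comp PS (omap D j) P Q k (q j) = r j)"
      show "k = transf P \<tau>"
      proof (rule hom_eqI[OF _ h])
        fix c z assume c: "c \<in> ob" "z \<in> omap P c"
        with ex obtain j f where j: "j \<in> e ` G0" "f \<in> Hom A c (a j)" "z = amap P (a j) c f (x j)" by blast
        note jG = G0'(1)[OF j(1)]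
        have "Comp PS (hom_presheaf A (a j)) P Q k (q j) = r j" using k jG unfolding oJ oD by blast
        from fun_cong[OF fun_cong[OF this], of c f] have "k c z = r j c f"
          using c j by (simp add: q_def)
        then show "k c z = transf P \<tau> c z" using \<tau>[OF j(1) c(1) j(2)] j(3) c by simp
      qed (use k in auto)
    qed
  qed
  moreover have "\<forall>j\<in>Obj J. omap D j \<in> representables A"
    using a hom_presheaf_representable by (simp add: oJ)
  ultimately show ?thesis unfolding small_presheaf_def using J DPS by blast
qed

text \<open>A universal element is a single generator with no relations: equal restrictions come
  from equal arrows.\<close>

lemma representable_small:
  assumes u: "universal_element P a x" shows "small_presheaf A P"
proof (rule small_presheafI[where G = "{(a, x)}" and G0 = "{(a, x)}"])
  show P: "P \<in> Obj PS" using u by (simp add: universal_element_def)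
  have a: "a \<in> ob" and x: "x \<in> omap P a"
    and bij: "\<And>c. c \<in> ob \<Longrightarrow> bij_betw (\<lambda>h. amap P a c h x) (Hom A c a) (omap P c)"
    using u by (auto simp: universal_element_def)
  show "usmall TYPE('u) {(a, x)}" by (simp add: usmall_finite)
  show "\<exists>a' x' f. (a', x') \<in> {(a, x)} \<and> f \<in> Hom A c a' \<and> z = amap P a' c f x'"
    if "c \<in> ob" "z \<in> omap P c" for c z
    using bij[OF that(1)] that(2) by (auto simp: bij_betw_def)
  fix a' x' b y c f g
  assume *: "(a', x') \<in> {(a, x)}" "(b, y) \<in> {(a, x)}" "c \<in> ob" "f \<in> Hom A c a'" "g \<in> Hom A c b"
    "amap P a' c f x' = amap P b c g y"
  then have "f = g" using inj_onD[OF bij_betw_imp_inj_on[OF bij[OF *(3)]]] by simp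
  with * a x P show "\<exists>d z u v w. (d, z) \<in> {(a, x)} \<and> u \<in> Hom A d a' \<and> v \<in> Hom A d b \<and> w \<in> Hom A c d \<and>
        amap P a' d u x' = z \<and> amap P b d v y = z \<and> f = Comp A c d a' u w \<and> g = Comp A c d b v w"
    by (intro exI[of _ a] exI[of _ x] exI[of _ "Id A a"] exI[of _ f]) simp
qed (use u in \<open>auto simp: universal_element_def\<close>)

text \<open>The pullback of the Yoneda arrows of \<open>x\<close> and \<open>y\<close>. Spans
  generating the product of the two representables are taken first; over each of them, the arrows
  that equalize the two elements restricted to the apex form a sieve that lucidity of
  \<open>L\<close> generates.\<close>

lemma relation_generated:
  assumes pre: precomplete and L: "elementwise_lucid L" and a: "a \<in> ob" "x \<in> omap L a" and b: "b \<in> ob" "y \<in> omap L b"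
  shows "generated (\<lambda>c. {(f, g) \<in> Hom A c a \<times> Hom A c b. amap L a c f x = amap L b c g y})
    (\<lambda>d c u (f, g). (Comp A c d a f u, Comp A c d b g u))"
proof -
  obtain G where G: "usmall TYPE('u) G" "\<And>d w. (d, w) \<in> G \<Longrightarrow> d \<in> ob \<and> w \<in> Hom A d a \<times> Hom A d b"
    "\<And>c v. \<lbrakk>c \<in> ob; v \<in> Hom A c a \<times> Hom A c b\<rbrakk> \<Longrightarrow> \<exists>d w f. (d, w) \<in> G \<and> f \<in> Hom A c d \<and>
       v = (case w of (h, k) \<Rightarrow> (Comp A c d a h f, Comp A c d b k f))"
    by (rule generatedE[OF pairs_generated[OF pre a(1) b(1)]]) blast
  have LP: "L \<in> Obj PS" using L by (simp add: elementwise_lucid_def)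
  show ?thesis
  proof (rule generated_cover[OF G(1), where
        V = "\<lambda>m c. {w \<in> Hom A c (fst m). amap L (fst m) c w (amap L a (fst m) (fst (snd m)) x) =
          amap L (fst m) c w (amap L b (fst m) (snd (snd m)) y)}"
        and actV = "\<lambda>m d c u w. Comp A c d (fst m) w u"
        and \<phi> = "\<lambda>m c w. (Comp A c (fst m) a (fst (snd m)) w, Comp A c (fst m) b (snd (snd m)) w)"])
    fix m assume "m \<in> G"
    then have m: "fst m \<in> ob" "fst (snd m) \<in> Hom A (fst m) a" "snd (snd m) \<in> Hom A (fst m) b"
      using G(2)[of "fst m" "snd m"] by auto
    show "generated (\<lambda>c. {w \<in> Hom A c (fst m). amap L (fst m) c w (amap L a (fst m) (fst (snd m)) x) =
          amap L (fst m) c w (amap L b (fst m) (snd (snd m)) y)}) (\<lambda>d c u w. Comp A c d (fst m) w u)"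
      using L m a b LP unfolding elementwise_lucid_def gsieve_def by simp
    fix c w assume c: "c \<in> ob"
    show "(Comp A c (fst m) a (fst (snd m)) w, Comp A c (fst m) b (snd (snd m)) w) \<in>
        {(f, g) \<in> Hom A c a \<times> Hom A c b. amap L a c f x = amap L b c g y}"
      if "w \<in> {w \<in> Hom A c (fst m). amap L (fst m) c w (amap L a (fst m) (fst (snd m)) x) =
          amap L (fst m) c w (amap L b (fst m) (snd (snd m)) y)}"
      using that c m a b LP by auto
    fix d u assume "d \<in> ob" "u \<in> Hom A c d" "w \<in> {w \<in> Hom A d (fst m). amap L (fst m) d w (amap L a (fst m) (fst (snd m)) x) =
          amap L (fst m) d w (amap L b (fst m) (snd (snd m)) y)}"
    then show "(Comp A c (fst m) a (fst (snd m)) (Comp A c d (fst m) w u),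
          Comp A c (fst m) b (snd (snd m)) (Comp A c d (fst m) w u)) =
        (case (Comp A d (fst m) a (fst (snd m)) w, Comp A d (fst m) b (snd (snd m)) w) of (f, g) \<Rightarrow>
          (Comp A c d a f u, Comp A c d b g u))"
      using c m a b by (simp add: Comp_assoc)
  next
    fix c v assume c: "c \<in> ob" and v: "v \<in> {(f, g) \<in> Hom A c a \<times> Hom A c b. amap L a c f x = amap L b c g y}"
    then obtain d w h where d: "(d, w) \<in> G" "h \<in> Hom A c d"
      "v = (case w of (f, k) \<Rightarrow> (Comp A c d a f h, Comp A c d b k h))" using G(3)[of c v] by blast
    from G(2)[OF d(1)] have dw: "d \<in> ob" "fst w \<in> Hom A d a" "snd w \<in> Hom A d b"
      by (auto simp: mem_Times_iff)
    have "amap L d c h (amap L a d (fst w) x) = amap L d c h (amap L b d (snd w) y)"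
      using v d dw c a b LP by (auto split: prod.splits)
    with d show "\<exists>m w. m \<in> G \<and> w \<in> {w \<in> Hom A c (fst m). amap L (fst m) c w (amap L a (fst m) (fst (snd m)) x) =
          amap L (fst m) c w (amap L b (fst m) (snd (snd m)) y)} \<and>
        v = (Comp A c (fst m) a (fst (snd m)) w, Comp A c (fst m) b (snd (snd m)) w)"
      by (intro exI[of _ "(d, w)"] exI[of _ h]) (auto split: prod.splits)
  qed
qed

text \<open>Generators of \<open>L\<close> come from pettiness. For every pair of them the relations
  are generated by \<open>relation_generated\<close>, and regularity collects all these into one
  small set.\<close>

lemma lucid_imp_small:
  assumes pre: precomplete and L: "elementwise_lucid L"
  shows "small_presheaf A L"
proof -
  have LP: "L \<in> Obj PS" and gen: "generated (omap L) (amap L)" using L by (auto simp: elementwise_lucid_def)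
  obtain G where G: "usmall TYPE('u) G" "\<And>d w. (d, w) \<in> G \<Longrightarrow> d \<in> ob \<and> w \<in> omap L d"
    "\<And>c v. \<lbrakk>c \<in> ob; v \<in> omap L c\<rbrakk> \<Longrightarrow> \<exists>d w f. (d, w) \<in> G \<and> f \<in> Hom A c d \<and> v = amap L d c f w"
    by (rule generatedE[OF gen]) blast
  let ?R = "\<lambda>m H. usmall TYPE('u) H \<and>
      (\<forall>d u v. (d, u, v) \<in> H \<longrightarrow> d \<in> ob \<and> u \<in> Hom A d (fst (fst m)) \<and> v \<in> Hom A d (fst (snd m)) \<and>
        amap L (fst (fst m)) d u (snd (fst m)) = amap L (fst (snd m)) d v (snd (snd m))) \<and>
      (\<forall>c f g. c \<in> ob \<and> f \<in> Hom A c (fst (fst m)) \<and> g \<in> Hom A c (fst (snd m)) \<and>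
        amap L (fst (fst m)) c f (snd (fst m)) = amap L (fst (snd m)) c g (snd (snd m)) \<longrightarrow>
        (\<exists>d u v w. (d, u, v) \<in> H \<and> w \<in> Hom A c d \<and> f = Comp A c d (fst (fst m)) u w \<and>
          g = Comp A c d (fst (snd m)) v w))"
  have "\<forall>m\<in>G \<times> G. \<exists>H. ?R m H"
  proof
    fix m assume "m \<in> G \<times> G"
    then obtain a x b y where m: "m = ((a, x), (b, y))" and ax: "(a, x) \<in> G" "(b, y) \<in> G" by force
    have "generated (\<lambda>c. {(f, g) \<in> Hom A c a \<times> Hom A c b. amap L a c f x = amap L b c g y})
        (\<lambda>d c u (f, g). (Comp A c d a f u, Comp A c d b g u))"
      using G(2) ax by (intro relation_generated[OF pre L]) auto
    then obtain H where H: "usmall TYPE('u) H"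
      "\<And>d w. (d, w) \<in> H \<Longrightarrow> d \<in> ob \<and> w \<in> {(f, g) \<in> Hom A d a \<times> Hom A d b. amap L a d f x = amap L b d g y}"
      "\<And>c v. \<lbrakk>c \<in> ob; v \<in> {(f, g) \<in> Hom A c a \<times> Hom A c b. amap L a c f x = amap L b c g y}\<rbrakk> \<Longrightarrow>
        \<exists>d w u. (d, w) \<in> H \<and> u \<in> Hom A c d \<and> v = (case w of (f, g) \<Rightarrow> (Comp A c d a f u, Comp A c d b g u))"
      by (rule generatedE) blast
    show "\<exists>H. ?R m H"
    proof (intro exI[of _ H] conjI allI impI H(1))
      fix c f g
      assume "c \<in> ob \<and> f \<in> Hom A c (fst (fst m)) \<and> g \<in> Hom A c (fst (snd m)) \<and>
        amap L (fst (fst m)) c f (snd (fst m)) = amap L (fst (snd m)) c g (snd (snd m))"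
      with H(3)[of c "(f, g)"] obtain d w u where "(d, w) \<in> H" "u \<in> Hom A c d"
        "(f, g) = (case w of (f, g) \<Rightarrow> (Comp A c d a f u, Comp A c d b g u))" by (auto simp: m)
      then show "\<exists>d u v w. (d, u, v) \<in> H \<and> w \<in> Hom A c d \<and> f = Comp A c d (fst (fst m)) u w \<and>
          g = Comp A c d (fst (snd m)) v w"
        by (intro exI[of _ d] exI[of _ "fst w"] exI[of _ "snd w"] exI[of _ u]) (auto simp: m split: prod.splits)
    qed (use H(2) in \<open>auto simp: m\<close>)
  qed
  from bchoice[OF this] obtain H where HH: "\<forall>m\<in>G \<times> G. ?R m (H m)" by blast
  have H: "\<And>m. m \<in> G \<times> G \<Longrightarrow> usmall TYPE('u) (H m)"
    "\<And>m d u v. \<lbrakk>m \<in> G \<times> G; (d, u, v) \<in> H m\<rbrakk> \<Longrightarrow> d \<in> ob \<and> u \<in> Hom A d (fst (fst m)) \<and> v \<in> Hom A d (fst (snd m)) \<and>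
        amap L (fst (fst m)) d u (snd (fst m)) = amap L (fst (snd m)) d v (snd (snd m))"
    "\<And>m c f g. \<lbrakk>m \<in> G \<times> G; c \<in> ob; f \<in> Hom A c (fst (fst m)); g \<in> Hom A c (fst (snd m));
        amap L (fst (fst m)) c f (snd (fst m)) = amap L (fst (snd m)) c g (snd (snd m))\<rbrakk> \<Longrightarrow>
        \<exists>d u v w. (d, u, v) \<in> H m \<and> w \<in> Hom A c d \<and> f = Comp A c d (fst (fst m)) u w \<and>
          g = Comp A c d (fst (snd m)) v w"
    subgoal by (drule bspec[OF HH]) simp
    subgoal by (drule bspec[OF HH]) simp
    subgoal by (drule bspec[OF HH]) simp
    done
  \<comment> \<open>A generating relation \<open>(d, u, v)\<close> contributes the element over
    \<open>d\<close> to which both generators restrict; \<open>u\<close> and \<open>v\<close> become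
    its arrows to the two generators in the diagram.\<close>
  define G' where "G' = G \<union> (\<Union>m\<in>G \<times> G. 
    (\<lambda>w. (fst w, amap L (fst (fst m)) (fst w) (fst (snd w)) (snd (fst m)))) ` H m)"
  show ?thesis
  proof (rule small_presheafI[OF LP, where G = G' and G0 = G])
    show "usmall TYPE('u) G'"
      unfolding G'_def by (intro usmall_Un usmall_UN usmall_Sigma usmall_image G(1) H(1))
  next
    fix a x assume "(a, x) \<in> G'"
    then show "a \<in> ob \<and> x \<in> omap L a"
    proof (cases "(a, x) \<in> G")
      case False
      with \<open>(a, x) \<in> G'\<close> obtain m w where m: "m \<in> G \<times> G" "w \<in> H m"
        and ax: "a = fst w" "x = amap L (fst (fst m)) (fst w) (fst (snd w)) (snd (fst m))"
        unfolding G'_def by blast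
      have "(fst w, fst (snd w), snd (snd w)) \<in> H m" using m by simp
      from H(2)[OF m(1) this] G(2)[of "fst (fst m)" "snd (fst m)"] m(1)
      show ?thesis unfolding ax by (intro conjI psh_act[OF LP]) (auto simp: mem_Times_iff)
    qed (use G(2) in auto)
  next
    fix a x b y c f g
    assume *: "(a, x) \<in> G" "(b, y) \<in> G" "c \<in> ob" "f \<in> Hom A c a" "g \<in> Hom A c b"
      "amap L a c f x = amap L b c g y"
    then have m: "((a, x), (b, y)) \<in> G \<times> G" by simp
    from H(3)[OF m *(3), of f g] * obtain d u v w where d: "(d, u, v) \<in> H ((a, x), (b, y))" and w: "w \<in> Hom A c d"
      "f = Comp A c d a u w" "g = Comp A c d b v w"
      unfolding fst_conv snd_conv by blast
    from H(2)[OF m d] have uv: "u \<in> Hom A d a" "v \<in> Hom A d b" "amap L a d u x = amap L b d v y" by auto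
    have "(d, amap L a d u x) \<in> G'"
      unfolding G'_def using m d by force
    with uv w show "\<exists>d z u v w. (d, z) \<in> G' \<and> u \<in> Hom A d a \<and> v \<in> Hom A d b \<and> w \<in> Hom A c d \<and>
        amap L a d u x = z \<and> amap L b d v y = z \<and> f = Comp A c d a u w \<and> g = Comp A c d b v w" by metis
  qed (use G(3) in \<open>auto simp: G'_def\<close>)
qed


subsection \<open>Small colimits of lucid presheaves\<close>

text \<open>Arrows out of a colimit are determined by their composites with the coprojections, so
  the images of the coprojections form a subpresheaf to which \<open>jointly_epi_covers\<close>
  applies.\<close>

lemma colimit_covers:
  assumes D: "is_functor J PS D" and col: "is_colimit J PS D P q"
    and c: "c \<in> ob" and x: "x \<in> omap P c"
  shows "\<exists>j \<in> Obj J. \<exists>y \<in> omap (omap D j) c. x = q j c y"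
proof -
  note Dj = functor_PS(1)[OF D] and Du = functor_PS(2)[OF D]
  have P: "P \<in> Obj PS" and q: "\<And>j. j \<in> Obj J \<Longrightarrow> q j \<in> Hom PS (omap D j) P"
    and qc: "\<And>i j u. \<lbrakk>i \<in> Obj J; j \<in> Obj J; u \<in> Hom J i j\<rbrakk> \<Longrightarrow>
      Comp PS (omap D i) (omap D j) P (q j) (amap D i j u) = q i"
    using col by (auto simp: is_colimit_def is_cocone_def)
  define Q where "Q c = {q j c y | j y. j \<in> Obj J \<and> y \<in> omap (omap D j) c}" for c
  have "x \<in> Q c"
  proof (rule jointly_epi_covers[OF P _ _ _ c x])
    show "Q c \<subseteq> omap P c" if "c \<in> ob" for c using that hom_in[OF q] by (auto simp: Q_def)
  next
    fix c d f x assume cd: "c \<in> ob" "d \<in> ob" "f \<in> Hom A c d" and "x \<in> Q d"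
    then obtain j y where j: "j \<in> Obj J" "y \<in> omap (omap D j) d" "x = q j d y" by (auto simp: Q_def)
    have "amap P d c f x = q j c (amap (omap D j) d c f y)"
      unfolding j(3) using hom_natural[OF Dj[OF j(1)] P q[OF j(1)] cd j(2)] by simp
    moreover have "amap (omap D j) d c f y \<in> omap (omap D j) c" using Dj[OF j(1)] cd j(2) by blast
    ultimately show "amap P d c f x \<in> Q c" using j(1) unfolding Q_def by blast
  next
    fix Z f g assume Z: "Z \<in> Obj PS" and f: "f \<in> Hom PS P Z" and g: "g \<in> Hom PS P Z"
      and eq: "\<And>c x. \<lbrakk>c \<in> ob; x \<in> Q c\<rbrakk> \<Longrightarrow> f c x = g c x"
    have in_Q: "q j c y \<in> Q c" if "j \<in> Obj J" "y \<in> omap (omap D j) c" for j c y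
      using that by (auto simp: Q_def)
    have fq: "Comp PS (omap D j) P Z f (q j) \<in> Hom PS (omap D j) Z"
      and gq: "Comp PS (omap D j) P Z g (q j) \<in> Hom PS (omap D j) Z" if "j \<in> Obj J" for j
      by (rule PS_Comp_in[OF Dj[OF that] P Z q[OF that]], rule f)
        (rule PS_Comp_in[OF Dj[OF that] P Z q[OF that]], rule g)
    show "f = g"
    proof (rule colimit_eqI[OF col f g])
      show "is_cocone J PS D Z (\<lambda>i. Comp PS (omap D i) P Z f (q i))"
        unfolding is_cocone_def
      proof (intro conjI ballI Z fq)
        fix i j u assume *: "i \<in> Obj J" "j \<in> Obj J" "u \<in> Hom J i j"
        show "Comp PS (omap D i) (omap D j) Z (Comp PS (omap D j) P Z f (q j)) (amap D i j u) =
            Comp PS (omap D i) P Z f (q i)"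
          unfolding PS_Comp_eq_iff[OF Dj[OF *(1)] Dj[OF *(2)] Z Du[OF *] fq[OF *(2)] fq[OF *(1)]]
        proof (intro ballI)
          fix c y assume c: "c \<in> ob" "y \<in> omap (omap D i) c"
          have "q j c (amap D i j u c y) = q i c y"
            using fun_cong[OF fun_cong[OF qc[OF *]], of c y] c by simp
          then show "Comp PS (omap D j) P Z f (q j) c (amap D i j u c y) = Comp PS (omap D i) P Z f (q i) c y"
            using c hom_in[OF Du[OF *] c] by simp
        qed
      qed
      show "Comp PS (omap D i) P Z g (q i) = Comp PS (omap D i) P Z f (q i)" if i: "i \<in> Obj J" for i
        by (rule hom_eqI[OF gq[OF i] fq[OF i]]) (simp add: eq in_Q i)
    qed
  qed
  then show ?thesis by (auto simp: Q_def)
qed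

section \<open>Equality in a colimit by zigzags\<close>

text \<open>The disjoint union at \<open>c\<close> of the presheaves in the diagram, of which the
  colimit is a quotient.\<close>

definition elements :: "('j, 'k) cat \<Rightarrow> ('j, 'k, ('o, 'u) presheaf, 'o \<Rightarrow> 'u \<Rightarrow> 'u) fun_data \<Rightarrow>
    'o \<Rightarrow> ('j \<times> 'u) set" where
  "elements J D c = Sigma (Obj J) (\<lambda>j. omap (omap D j) c)"

definition elements_act :: "('j, 'k, ('o, 'u) presheaf, 'o \<Rightarrow> 'u \<Rightarrow> 'u) fun_data \<Rightarrow>
    'o \<Rightarrow> 'o \<Rightarrow> 'u \<Rightarrow> 'j \<times> 'u \<Rightarrow> 'j \<times> 'u" where
  "elements_act D d c f = (\<lambda>(j, y). (j, amap (omap D j) d c f y))"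

text \<open>The single steps of the zigzags that describe equality in a colimit.\<close>

definition link :: "('j, 'k) cat \<Rightarrow> ('j, 'k, ('o, 'u) presheaf, 'o \<Rightarrow> 'u \<Rightarrow> 'u) fun_data \<Rightarrow>
    'o \<Rightarrow> ('j \<times> 'u) rel" where
  "link J D c = {((i, y), (j, z)). i \<in> Obj J \<and> j \<in> Obj J \<and>
     y \<in> omap (omap D i) c \<and> z \<in> omap (omap D j) c \<and>
     ((\<exists>u \<in> Hom J i j. z = amap D i j u c y) \<or> (\<exists>u \<in> Hom J j i. y = amap D j i u c z))}"

lemma sym_link: "sym (link J D c)"
  unfolding sym_def link_def by blast

lemma link_elements: "(e, e') \<in> link J D c \<Longrightarrow> e \<in> elements J D c \<and> e' \<in> elements J D c"
  by (auto simp: link_def elements_def)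

lemma elements_action:
  assumes D: "is_functor J PS D" shows "action (elements J D) (elements_act D)"
  using functor_PS(1)[OF D] by (auto simp: action_def elements_def elements_act_def)

lemma elements_act_in:
  assumes D: "is_functor J PS D" and "c \<in> ob" "d \<in> ob" "f \<in> Hom A c d" "e \<in> elements J D d"
  shows "elements_act D d c f e \<in> elements J D c"
  using elements_action[OF D] assms(2-) unfolding action_def by blast

lemma elements_act_Comp:
  assumes D: "is_functor J PS D" and "b \<in> ob" "c \<in> ob" "d \<in> ob" "f \<in> Hom A b c" "g \<in> Hom A c d"
    "e \<in> elements J D d"
  shows "elements_act D d b (Comp A b c d g f) e = elements_act D c b f (elements_act D d c g e)"
  using elements_action[OF D] assms(2-) unfolding action_def by blast

lemma link_act:
  assumes D: "is_functor J PS D" and c: "c \<in> ob" "d \<in> ob" "f \<in> Hom A c d" and l: "(e, e') \<in> link J D d"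
  shows "(elements_act D d c f e, elements_act D d c f e') \<in> link J D c"
proof -
  note Dj = functor_PS(1)[OF D] and Du = functor_PS(2)[OF D]
  have nat: "amap (omap D j) d c f (amap D i j u d y) = amap D i j u c (amap (omap D i) d c f y)"
    if "i \<in> Obj J" "j \<in> Obj J" "u \<in> Hom J i j" "y \<in> omap (omap D i) d" for i j u y
    using hom_natural[OF Dj[OF that(1)] Dj[OF that(2)] Du[OF that(1-3)] c that(4)] by simp
  obtain i y j z where e: "e = (i, y)" "e' = (j, z)" by fastforce
  with l have ij: "i \<in> Obj J" "j \<in> Obj J" "y \<in> omap (omap D i) d" "z \<in> omap (omap D j) d"
    and "(\<exists>u \<in> Hom J i j. z = amap D i j u d y) \<or> (\<exists>u \<in> Hom J j i. y = amap D j i u d z)"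
    by (auto simp: link_def)
  then have "(\<exists>u \<in> Hom J i j. amap (omap D j) d c f z = amap D i j u c (amap (omap D i) d c f y)) \<or>
      (\<exists>u \<in> Hom J j i. amap (omap D i) d c f y = amap D j i u c (amap (omap D j) d c f z))"
    using nat by blast
  moreover have "amap (omap D i) d c f y \<in> omap (omap D i) c" "amap (omap D j) d c f z \<in> omap (omap D j) c"
    using Dj ij c by blast+
  ultimately show ?thesis using ij by (simp add: e link_def elements_act_def)
qed

lemma relpow_link_act:
  assumes D: "is_functor J PS D" and c: "c \<in> ob" "d \<in> ob" "f \<in> Hom A c d"
  shows "(e, e') \<in> link J D d ^^ n \<Longrightarrow> (elements_act D d c f e, elements_act D d c f e') \<in> link J D c ^^ n"
proof (induction n arbitrary: e')
  case (Suc n)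
  from \<open>(e, e') \<in> link J D d ^^ Suc n\<close> obtain e''
    where a: "(e, e'') \<in> link J D d ^^ n" and b: "(e'', e') \<in> link J D d" by (rule relpow_Suc_E)
  show ?case by (rule relpow_Suc_I[OF Suc.IH[OF a] link_act[OF D c b]])
qed simp

text \<open>The classes of elements under zigzags carry an action and receive a cocone. The
  mediating arrow from \<open>P\<close> to this quotient separates elements that no zigzag
  joins.\<close>

lemma colimit_identifies:
  assumes J: "usmall TYPE('u) (Obj J)" and D: "is_functor J PS D" and col: "is_colimit J PS D P q"
    and c: "c \<in> ob" and e: "(i, y) \<in> elements J D c" "(j, z) \<in> elements J D c"
    and eq: "q i c y = q j c z"
  shows "((i, y), (j, z)) \<in> (link J D c)\<^sup>*"
proof -
  note Dj = functor_PS(1)[OF D] and Du = functor_PS(2)[OF D]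
  let ?cls = "\<lambda>c e. (link J D c)\<^sup>* `` {e}"
  define V where "V c = ?cls c ` elements J D c" for c
  \<comment> \<open>Restriction sends a class into a class, but in general not onto it; closing
    under zigzags turns the image into a class again.\<close>
  define act where "act d c f X = (link J D c)\<^sup>* `` (elements_act D d c f ` X)" for d c f X
  have cls_eq: "?cls c e = ?cls c e'" if "(e, e') \<in> (link J D c)\<^sup>*" for c e e'
  proof -
    have "(e', e) \<in> (link J D c)\<^sup>*" using that sym_rtrancl[OF sym_link] by (meson symD)
    with that show ?thesis by (auto intro: rtrancl_trans)
  qed
  have rt_act: "(elements_act D d c f e, elements_act D d c f e') \<in> (link J D c)\<^sup>*"
    if "c \<in> ob" "d \<in> ob" "f \<in> Hom A c d" "(e, e') \<in> (link J D d)\<^sup>*" for c d f e e'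
    using that(4) by (induction rule: rtrancl_induct) (auto intro: rtrancl_into_rtrancl link_act[OF D that(1-3)])
  have act_cls: "act d c f (?cls d e) = ?cls c (elements_act D d c f e)"
    if "c \<in> ob" "d \<in> ob" "f \<in> Hom A c d" for c d f e
  proof
    show "act d c f (?cls d e) \<subseteq> ?cls c (elements_act D d c f e)"
    proof
      fix x assume "x \<in> act d c f (?cls d e)"
      then obtain y where y: "(e, y) \<in> (link J D d)\<^sup>*" "(elements_act D d c f y, x) \<in> (link J D c)\<^sup>*"
        unfolding act_def by blast
      show "x \<in> ?cls c (elements_act D d c f e)"
        using rtrancl_trans[OF rt_act[OF that y(1)] y(2)] by blast
    qed
    show "?cls c (elements_act D d c f e) \<subseteq> act d c f (?cls d e)"
      unfolding act_def by blast
  qed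
  have aV: "action V act"
    unfolding action_def
  proof (intro conjI ballI)
    fix c d f X assume *: "c \<in> ob" "d \<in> ob" "f \<in> Hom A c d" and "X \<in> V d"
    then obtain e where e: "e \<in> elements J D d" "X = ?cls d e" unfolding V_def by blast
    show "act d c f X \<in> V c"
      unfolding e(2) act_cls[OF *] V_def by (rule imageI[OF elements_act_in[OF D * e(1)]])
  next
    fix c X assume c: "c \<in> ob" and "X \<in> V c"
    then obtain e where e: "e \<in> elements J D c" "X = ?cls c e" unfolding V_def by blast
    have "elements_act D c c (Id A c) e = e"
      using elements_action[OF D] c e(1) unfolding action_def by blast
    then show "act c c (Id A c) X = X" unfolding e(2) act_cls[OF c c Id_in[OF c]] by simp
  next
    fix b c d f g X assume *: "b \<in> ob" "c \<in> ob" "d \<in> ob" "f \<in> Hom A b c" "g \<in> Hom A c d" and "X \<in> V d"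
    then obtain e where e: "e \<in> elements J D d" "X = ?cls d e" unfolding V_def by blast
    show "act d b (Comp A b c d g f) X = act c b f (act d c g X)"
      unfolding e(2) act_cls[OF *(2,3,5)] act_cls[OF *(1,2,4)] act_cls[OF *(1,3) Comp_in[OF *]]
        elements_act_Comp[OF D * e(1)] ..
  qed
  have sV: "usmall TYPE('u) (V c)" if "c \<in> ob" for c
    unfolding V_def elements_def by (intro usmall_image usmall_Sigma J psh_usmall Dj that)
  obtain Q \<theta> where Q: "Q \<in> Obj PS" and bij: "\<And>c. c \<in> ob \<Longrightarrow> bij_betw (\<theta> c) (V c) (omap Q c)"
    and nat: "\<And>c d f v. \<lbrakk>c \<in> ob; d \<in> ob; f \<in> Hom A c d; v \<in> V d\<rbrakk> \<Longrightarrow>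
       amap Q d c f (\<theta> d v) = \<theta> c (act d c f v)"
    by (rule ex_transport[OF aV sV]) (assumption, rule that)
  have cls_in: "?cls c (j, y) \<in> V c" if "j \<in> Obj J" "y \<in> omap (omap D j) c" for j c y
    using that unfolding V_def elements_def by blast
  define r where "r j = transf (omap D j) (\<lambda>c y. \<theta> c (?cls c (j, y)))" for j
  have r: "r j \<in> Hom PS (omap D j) Q" if j: "j \<in> Obj J" for j
    unfolding r_def
  proof (rule transf_in[OF Dj[OF j] Q])
    show "\<theta> c (?cls c (j, y)) \<in> omap Q c" if "c \<in> ob" "y \<in> omap (omap D j) c" for c y
      using bij_betwE[OF bij[OF that(1)]] cls_in[OF j that(2)] by blast
    show "\<theta> c (?cls c (j, amap (omap D j) d c f y)) = amap Q d c f (\<theta> d (?cls d (j, y)))"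
      if "c \<in> ob" "d \<in> ob" "f \<in> Hom A c d" "y \<in> omap (omap D j) d" for c d f y
      using nat[OF that(1-3) cls_in[OF j that(4)]] act_cls[OF that(1-3)] by (simp add: elements_act_def)
  qed
  have "is_cocone J PS D Q r"
    unfolding is_cocone_def
  proof (intro conjI ballI Q r)
    fix i j u assume *: "i \<in> Obj J" "j \<in> Obj J" "u \<in> Hom J i j"
    show "Comp PS (omap D i) (omap D j) Q (r j) (amap D i j u) = r i"
      unfolding PS_Comp_eq_iff[OF Dj[OF *(1)] Dj[OF *(2)] Q Du[OF *] r[OF *(2)] r[OF *(1)]]
    proof (intro ballI)
      fix c y assume c: "c \<in> ob" "y \<in> omap (omap D i) c"
      have uy: "amap D i j u c y \<in> omap (omap D j) c" by (rule hom_in[OF Du[OF *] c])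
      then have "((i, y), (j, amap D i j u c y)) \<in> link J D c" using * c by (auto simp: link_def)
      then have "?cls c (i, y) = ?cls c (j, amap D i j u c y)" by (intro cls_eq r_into_rtrancl)
      then show "r j c (amap D i j u c y) = r i c y" using c uy by (simp add: r_def)
    qed
  qed
  with col obtain m where m: "\<And>j. j \<in> Obj J \<Longrightarrow> Comp PS (omap D j) P Q m (q j) = r j"
    by (rule colimit_ex) blast
  have ij: "i \<in> Obj J" "j \<in> Obj J" "y \<in> omap (omap D i) c" "z \<in> omap (omap D j) c"
    using e by (auto simp: elements_def)
  have "m c (q i c y) = \<theta> c (?cls c (i, y))"
    using fun_cong[OF fun_cong[OF m[OF ij(1)]], of c y] c ij by (simp add: r_def)
  moreover have "m c (q j c z) = \<theta> c (?cls c (j, z))"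
    using fun_cong[OF fun_cong[OF m[OF ij(2)]], of c z] c ij by (simp add: r_def)
  ultimately have "\<theta> c (?cls c (i, y)) = \<theta> c (?cls c (j, z))" using eq by simp
  then have "?cls c (i, y) = ?cls c (j, z)"
    using inj_onD[OF bij_betw_imp_inj_on[OF bij[OF c]] _ cls_in[OF ij(1,3)] cls_in[OF ij(2,4)]] by blast
  then show ?thesis by blast
qed

lemma colimit_rtrancl_link:
  assumes D: "is_functor J PS D" and col: "is_colimit J PS D P q" and c: "c \<in> ob"
    and "(e, e') \<in> (link J D c)\<^sup>*"
  shows "q (fst e) c (snd e) = q (fst e') c (snd e')"
  using assms(4)
proof (induction rule: rtrancl_induct)
  case (step e' e'')
  have qc: "q j c (amap D i j u c y) = q i c y"
    if "i \<in> Obj J" "j \<in> Obj J" "u \<in> Hom J i j" "y \<in> omap (omap D i) c" for i j u y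
  proof -
    have "Comp PS (omap D i) (omap D j) P (q j) (amap D i j u) = q i"
      using col that by (simp add: is_colimit_def is_cocone_def)
    from fun_cong[OF fun_cong[OF this], of c y] show ?thesis using c that by simp
  qed
  have "q (fst e') c (snd e') = q (fst e'') c (snd e'')"
    using step.hyps(2) by (auto simp: link_def qc)
  with step.IH show ?case by simp
qed simp

lemma gsieve_UN:
  assumes K: "usmall TYPE('u) K" and T: "\<And>k. k \<in> K \<Longrightarrow> gsieve b (T k)"
  shows "gsieve b (\<lambda>c h. \<exists>k \<in> K. T k c h)"
  unfolding gsieve_def
  by (rule generated_cover[OF K T[unfolded gsieve_def], where \<phi> = "\<lambda>k c h. h"]) auto

lemma gsieve_empty: "gsieve b (\<lambda>c h. False)"
  using gsieve_UN[of "{} :: nat set" b "\<lambda>_ _ _. True"] usmall_finite[where X = "{} :: nat set" and ?'u = 'u] by simp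

lemma gsieve_disj: "gsieve b S \<Longrightarrow> gsieve b T \<Longrightarrow> gsieve b (\<lambda>c h. S c h \<or> T c h)"
  using gsieve_UN[of "UNIV :: bool set" b "\<lambda>k. if k then S else T"] usmall_finite[where X = "UNIV :: bool set" and ?'u = 'u]
  by (simp add: ex_bool_eq)

lemma gsieve_conj:
  assumes precomplete "b \<in> ob" "gsieve b S" "gsieve b T"
    and "\<And>c d f h. \<lbrakk>c \<in> ob; d \<in> ob; f \<in> Hom A c d; h \<in> Hom A d b; S d h\<rbrakk> \<Longrightarrow> S c (Comp A c d b h f)"
    and "\<And>c d f h. \<lbrakk>c \<in> ob; d \<in> ob; f \<in> Hom A c d; h \<in> Hom A d b; T d h\<rbrakk> \<Longrightarrow> T c (Comp A c d b h f)"
  shows "gsieve b (\<lambda>c h. S c h \<and> T c h)"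
proof -
  have "gsieve b (\<lambda>c h. \<forall>k \<in> UNIV. (if k then S else T) c h)"
    by (rule gsieve_INT) (use assms in \<open>auto intro: usmall_finite\<close>)
  then show ?thesis by (rule gsieve_cong[rotated]) (auto split: if_splits)
qed

text \<open>Two restricted elements are linked when an arrow of \<open>J\<close> takes one to the
  other. By naturality each arrow contributes an equalizing sieve, and the hom-sets of
  \<open>J\<close> are small.\<close>

lemma gsieve_link:
  assumes J: "small_category (J :: ('u, 'u) cat)" and D: "is_functor J PS D"
    and luc: "\<And>j. j \<in> Obj J \<Longrightarrow> elementwise_lucid (omap D j)"
    and b: "b \<in> ob" and e: "e \<in> elements J D b" "e' \<in> elements J D b"
  shows "gsieve b (\<lambda>c h. (elements_act D b c h e, elements_act D b c h e') \<in> link J D c)"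
proof -
  note Dj = functor_PS(1)[OF D] and Du = functor_PS(2)[OF D]
  obtain i y j z where eq: "e = (i, y)" "e' = (j, z)" by fastforce
  have ij: "i \<in> Obj J" "j \<in> Obj J" "y \<in> omap (omap D i) b" "z \<in> omap (omap D j) b"
    using e by (auto simp: eq elements_def)
  have sJ: "usmall TYPE('u) (Hom J i j)" if "i \<in> Obj J" "j \<in> Obj J" for i j
    using J that by (simp add: small_category_def locally_small_def small_iff_usmall)
  have sieve: "gsieve b (\<lambda>c h. amap (omap D j) b c h x = amap (omap D j) b c h x')"
    if "j \<in> Obj J" "x \<in> omap (omap D j) b" "x' \<in> omap (omap D j) b" for j x x'
    using luc[OF that(1)] that b by (simp add: elementwise_lucid_def)
  have "gsieve b (\<lambda>c h. (\<exists>u \<in> Hom J i j. amap (omap D j) b c h z = amap (omap D j) b c h (amap D i j u b y)) \<or>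
      (\<exists>u \<in> Hom J j i. amap (omap D i) b c h y = amap (omap D i) b c h (amap D j i u b z)))"
    using ij by (intro gsieve_disj gsieve_UN sieve sJ hom_in[OF Du b]) auto
  then show ?thesis
  proof (rule gsieve_cong[rotated])
    fix c h assume c: "c \<in> ob" "h \<in> Hom A c b"
    have "amap (omap D j) b c h (amap D i j u b y) = amap D i j u c (amap (omap D i) b c h y)"
      if "i \<in> Obj J" "j \<in> Obj J" "u \<in> Hom J i j" "y \<in> omap (omap D i) b" for i j u y
      using hom_natural[OF Dj[OF that(1)] Dj[OF that(2)] Du[OF that(1-3)] c(1) b c(2) that(4)] by simp
    moreover have "amap (omap D i) b c h y \<in> omap (omap D i) c" "amap (omap D j) b c h z \<in> omap (omap D j) c"
      using Dj ij c b by blast+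
    ultimately show "(\<exists>u \<in> Hom J i j. amap (omap D j) b c h z = amap (omap D j) b c h (amap D i j u b y)) \<or>
        (\<exists>u \<in> Hom J j i. amap (omap D i) b c h y = amap (omap D i) b c h (amap D j i u b z)) \<longleftrightarrow>
        (elements_act D b c h e, elements_act D b c h e') \<in> link J D c"
      using ij by (simp add: eq link_def elements_act_def)
  qed
qed

text \<open>The last intermediate element of a zigzag varies with \<open>h\<close>, but it is a
  restriction of some generator \<open>(a, x)\<close> of the elements along an arrow
  \<open>w\<close>. For a fixed generator the pairs \<open>(h, w)\<close> factor through generating
  spans, and over such a span the conditions become an intersection of two sieves, one from the
  induction hypothesis and one from \<open>gsieve_link\<close>. Projecting to \<open>h\<close>
  covers the sieve in question.\<close>

lemma gsieve_relpow_link: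
  assumes pre: precomplete and J: "small_category (J :: ('u, 'u) cat)" and D: "is_functor J PS D"
    and luc: "\<And>j. j \<in> Obj J \<Longrightarrow> elementwise_lucid (omap D j)"
    and b: "b \<in> ob" and e: "e \<in> elements J D b" and e': "e' \<in> elements J D b"
  shows "gsieve b (\<lambda>c h. (elements_act D b c h e, elements_act D b c h e') \<in> link J D c ^^ n)"
  using b e e'
\<comment> \<open>The object and the elements have to vary, since the hypothesis is applied at the
  apex of a span over \<open>b\<close>.\<close>
proof (induction n arbitrary: b e e')
  case 0
  obtain i y j z where eq: "e = (i, y)" "e' = (j, z)" by fastforce
  have ij: "i \<in> Obj J" "j \<in> Obj J" "y \<in> omap (omap D i) b" "z \<in> omap (omap D j) b"
    using 0 by (auto simp: eq elements_def)
  show ?case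
  \<comment> \<open>A zigzag of length 0 is equality in the disjoint union: an equalizing sieve over
    one object of \<open>J\<close>, the empty sieve otherwise.\<close>
  proof (cases "i = j")
    case True
    then show ?thesis using luc[OF ij(1)] ij 0(1) by (simp add: eq elements_act_def elementwise_lucid_def)
  next
    case False
    then show ?thesis using gsieve_empty by (simp add: eq elements_act_def)
  qed
next
  case (Suc n)
  note Dj = functor_PS(1)[OF D]
  note b = \<open>b \<in> ob\<close> and e = \<open>e \<in> elements J D b\<close> and e' = \<open>e' \<in> elements J D b\<close>
  have "\<exists>G. usmall TYPE('u) G \<and> (\<forall>d x. (d, x) \<in> G \<longrightarrow> d \<in> ob \<and> x \<in> elements J D d) \<and>
      (\<forall>c x. c \<in> ob \<and> x \<in> elements J D c \<longrightarrow>
        (\<exists>d w f. (d, w) \<in> G \<and> f \<in> Hom A c d \<and> x = elements_act D d c f w))"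
  proof -
    have "generated (elements J D) (elements_act D)"
    proof (rule generated_cover[where M = "Obj J" and V = "\<lambda>j. omap (omap D j)" and
          actV = "\<lambda>j. amap (omap D j)" and \<phi> = "\<lambda>j c x. (j, x)"])
      show "usmall TYPE('u) (Obj J)" using J by (simp add: small_category_def small_iff_usmall)
      show "generated (omap (omap D j)) (amap (omap D j))" if "j \<in> Obj J" for j
        using luc[OF that] by (simp add: elementwise_lucid_def)
    qed (auto simp: elements_def elements_act_def)
    then show ?thesis by (rule generatedE) blast
  qed
  then obtain G where G: "usmall TYPE('u) G" "\<And>d x. (d, x) \<in> G \<Longrightarrow> d \<in> ob \<and> x \<in> elements J D d"
    "\<And>c x. \<lbrakk>c \<in> ob; x \<in> elements J D c\<rbrakk> \<Longrightarrow>
      \<exists>d w f. (d, w) \<in> G \<and> f \<in> Hom A c d \<and> x = elements_act D d c f w"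
    by blast
  have "\<forall>m\<in>G. generated (\<lambda>c. {(h, w) \<in> Hom A c b \<times> Hom A c (fst m).
        (elements_act D b c h e, elements_act D (fst m) c w (snd m)) \<in> link J D c ^^ n \<and>
        (elements_act D (fst m) c w (snd m), elements_act D b c h e') \<in> link J D c})
      (\<lambda>d c u (h, w). (Comp A c d b h u, Comp A c d (fst m) w u))"
  proof
    fix m assume "m \<in> G"
    then obtain a x where m: "m = (a, x)" "a \<in> ob" "x \<in> elements J D a" using G(2) by (cases m) auto
    obtain H where H: "usmall TYPE('u) H" "\<And>d w. (d, w) \<in> H \<Longrightarrow> d \<in> ob \<and> w \<in> Hom A d b \<times> Hom A d a"
      "\<And>c v. \<lbrakk>c \<in> ob; v \<in> Hom A c b \<times> Hom A c a\<rbrakk> \<Longrightarrow> \<exists>d w f. (d, w) \<in> H \<and> f \<in> Hom A c d \<and>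
         v = (case w of (h, k) \<Rightarrow> (Comp A c d b h f, Comp A c d a k f))"
      by (rule generatedE[OF pairs_generated[OF pre b m(2)]]) blast
    \<comment> \<open>A triple \<open>l\<close> is a span with apex \<open>fst l\<close> and legs
      into \<open>b\<close> and \<open>a\<close>; the two ends of the zigzag and the generator
      \<open>x\<close> are restricted to the apex.\<close>
    let ?e = "\<lambda>l. elements_act D b (fst l) (fst (snd l)) e"
    let ?e' = "\<lambda>l. elements_act D b (fst l) (fst (snd l)) e'"
    let ?x = "\<lambda>l. elements_act D a (fst l) (snd (snd l)) x"
    let ?S = "\<lambda>l c v. (elements_act D (fst l) c v (?e l), elements_act D (fst l) c v (?x l)) \<in> link J D c ^^ n \<and>
      (elements_act D (fst l) c v (?x l), elements_act D (fst l) c v (?e' l)) \<in> link J D c"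
    have "generated (\<lambda>c. {(h, w) \<in> Hom A c b \<times> Hom A c a.
        (elements_act D b c h e, elements_act D a c w x) \<in> link J D c ^^ n \<and>
        (elements_act D a c w x, elements_act D b c h e') \<in> link J D c})
      (\<lambda>d c u (h, w). (Comp A c d b h u, Comp A c d a w u))"
    proof (rule generated_cover[OF H(1), where V = "\<lambda>l c. {v \<in> Hom A c (fst l). ?S l c v}"
          and actV = "\<lambda>l d c u v. Comp A c d (fst l) v u"
          and \<phi> = "\<lambda>l c v. (Comp A c (fst l) b (fst (snd l)) v, Comp A c (fst l) a (snd (snd l)) v)"])
      fix l assume "l \<in> H"
      then have l: "fst l \<in> ob" "fst (snd l) \<in> Hom A (fst l) b" "snd (snd l) \<in> Hom A (fst l) a"
        using H(2)[of "fst l" "snd l"] by auto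
      have in_el: "?e l \<in> elements J D (fst l)" "?e' l \<in> elements J D (fst l)" "?x l \<in> elements J D (fst l)"
        by (intro elements_act_in[OF D] l b m e e')+
      have comp: "elements_act D b c (Comp A c (fst l) b (fst (snd l)) v) e = elements_act D (fst l) c v (?e l)"
        "elements_act D b c (Comp A c (fst l) b (fst (snd l)) v) e' = elements_act D (fst l) c v (?e' l)"
        "elements_act D a c (Comp A c (fst l) a (snd (snd l)) v) x = elements_act D (fst l) c v (?x l)"
        if "c \<in> ob" "v \<in> Hom A c (fst l)" for c v
        by (intro elements_act_Comp[OF D] that l b m e e')+
      have "gsieve (fst l) (?S l)"
      proof (rule gsieve_conj[OF pre l(1)])
        show "gsieve (fst l) (\<lambda>c v. (elements_act D (fst l) c v (?e l), elements_act D (fst l) c v (?x l)) \<in> link J D c ^^ n)"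
          by (rule Suc.IH[OF l(1) in_el(1,3)])
        show "gsieve (fst l) (\<lambda>c v. (elements_act D (fst l) c v (?x l), elements_act D (fst l) c v (?e' l)) \<in> link J D c)"
          by (rule gsieve_link[OF J D luc l(1) in_el(3,2)])
      next
        fix c d f h assume *: "c \<in> ob" "d \<in> ob" "f \<in> Hom A c d" "h \<in> Hom A d (fst l)"
        show "(elements_act D (fst l) c (Comp A c d (fst l) h f) (?e l),
            elements_act D (fst l) c (Comp A c d (fst l) h f) (?x l)) \<in> link J D c ^^ n"
          if "(elements_act D (fst l) d h (?e l), elements_act D (fst l) d h (?x l)) \<in> link J D d ^^ n"
          using relpow_link_act[OF D *(1-3) that] elements_act_Comp[OF D *(1,2) l(1) *(3,4)] in_el by simp
        show "(elements_act D (fst l) c (Comp A c d (fst l) h f) (?x l),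
            elements_act D (fst l) c (Comp A c d (fst l) h f) (?e' l)) \<in> link J D c"
          if "(elements_act D (fst l) d h (?x l), elements_act D (fst l) d h (?e' l)) \<in> link J D d"
          using link_act[OF D *(1-3) that] elements_act_Comp[OF D *(1,2) l(1) *(3,4)] in_el by simp
      qed
      then show "generated (\<lambda>c. {v \<in> Hom A c (fst l). ?S l c v}) (\<lambda>d c u v. Comp A c d (fst l) v u)"
        unfolding gsieve_def .
      fix c v assume c: "c \<in> ob"
      show "(Comp A c (fst l) b (fst (snd l)) v, Comp A c (fst l) a (snd (snd l)) v) \<in>
          {(h, w) \<in> Hom A c b \<times> Hom A c a.
          (elements_act D b c h e, elements_act D a c w x) \<in> link J D c ^^ n \<and>
          (elements_act D a c w x, elements_act D b c h e') \<in> link J D c}"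
        if "v \<in> {v \<in> Hom A c (fst l). ?S l c v}"
        using that c l b m(2) by (simp add: comp)
      fix d u assume "d \<in> ob" "u \<in> Hom A c d" "v \<in> {v \<in> Hom A d (fst l). ?S l d v}"
      then show "(Comp A c (fst l) b (fst (snd l)) (Comp A c d (fst l) v u),
            Comp A c (fst l) a (snd (snd l)) (Comp A c d (fst l) v u)) =
          (case (Comp A d (fst l) b (fst (snd l)) v, Comp A d (fst l) a (snd (snd l)) v) of (h, w) \<Rightarrow>
            (Comp A c d b h u, Comp A c d a w u))"
        using c l b m(2) by (simp add: Comp_assoc)
    next
      fix c p assume c: "c \<in> ob" and p: "p \<in> {(h, w) \<in> Hom A c b \<times> Hom A c a.
          (elements_act D b c h e, elements_act D a c w x) \<in> link J D c ^^ n \<and>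
          (elements_act D a c w x, elements_act D b c h e') \<in> link J D c}"
      obtain h w where hw: "p = (h, w)" by fastforce
      with p have hw': "h \<in> Hom A c b" "w \<in> Hom A c a"
        "(elements_act D b c h e, elements_act D a c w x) \<in> link J D c ^^ n"
        "(elements_act D a c w x, elements_act D b c h e') \<in> link J D c" by auto
      with H(3)[OF c, of p] hw obtain d k f where d: "(d, k) \<in> H" "f \<in> Hom A c d"
        "h = Comp A c d b (fst k) f" "w = Comp A c d a (snd k) f" by (auto split: prod.splits)
      from H(2)[OF d(1)] have k: "d \<in> ob" "fst k \<in> Hom A d b" "snd k \<in> Hom A d a" by (auto simp: mem_Times_iff)
      have comp: "elements_act D b c h e = elements_act D d c f (elements_act D b d (fst k) e)"
        "elements_act D b c h e' = elements_act D d c f (elements_act D b d (fst k) e')"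
        "elements_act D a c w x = elements_act D d c f (elements_act D a d (snd k) x)"
        unfolding d(3,4) by (intro elements_act_Comp[OF D] c k b m e e' d)+
      show "\<exists>l v. l \<in> H \<and> v \<in> {v \<in> Hom A c (fst l). ?S l c v} \<and>
          p = (Comp A c (fst l) b (fst (snd l)) v, Comp A c (fst l) a (snd (snd l)) v)"
        using d hw' hw unfolding comp by (intro exI[of _ "(d, k)"] exI[of _ f]) simp
    qed
    then show "generated (\<lambda>c. {(h, w) \<in> Hom A c b \<times> Hom A c (fst m).
        (elements_act D b c h e, elements_act D (fst m) c w (snd m)) \<in> link J D c ^^ n \<and>
        (elements_act D (fst m) c w (snd m), elements_act D b c h e') \<in> link J D c})
      (\<lambda>d c u (h, w). (Comp A c d b h u, Comp A c d (fst m) w u))"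
      by (simp add: m(1))
  qed
  then show ?case
    unfolding gsieve_def
  proof (intro generated_cover[OF G(1), where \<phi> = "\<lambda>m c. fst" and
      V = "\<lambda>m c. {(h, w) \<in> Hom A c b \<times> Hom A c (fst m).
        (elements_act D b c h e, elements_act D (fst m) c w (snd m)) \<in> link J D c ^^ n \<and>
        (elements_act D (fst m) c w (snd m), elements_act D b c h e') \<in> link J D c}" and
      actV = "\<lambda>m d c u (h, w). (Comp A c d b h u, Comp A c d (fst m) w u)"])
    fix c h
    assume c: "c \<in> ob" and "h \<in> {h \<in> Hom A c b. (elements_act D b c h e, elements_act D b c h e') \<in> link J D c ^^ Suc n}"
    then obtain e'' where h: "h \<in> Hom A c b" "(elements_act D b c h e, e'') \<in> link J D c ^^ n"
      "(e'', elements_act D b c h e') \<in> link J D c" by auto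
    then have "e'' \<in> elements J D c" using link_elements by blast
    with G(3)[OF c] obtain d x w where "(d, x) \<in> G" "w \<in> Hom A c d" "e'' = elements_act D d c w x" by blast
    with h show "\<exists>m v. m \<in> G \<and> v \<in> {(h, w) \<in> Hom A c b \<times> Hom A c (fst m).
        (elements_act D b c h e, elements_act D (fst m) c w (snd m)) \<in> link J D c ^^ n \<and>
        (elements_act D (fst m) c w (snd m), elements_act D b c h e') \<in> link J D c} \<and> h = fst v"
      by (intro exI[of _ "(d, x)"] exI[of _ "(h, w)"]) simp
  qed auto
qed

lemma small_presheaf_diagram:
  assumes "small_presheaf A P"
  obtains J :: "('u, 'u) cat" and D q where "small_category J" "is_functor J PS D"
    "\<And>j. j \<in> Obj J \<Longrightarrow> omap D j \<in> representables A" "is_colimit J PS D P q" "P \<in> Obj PS"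
proof -
  from assms obtain J :: "('u, 'u) cat" and D q where *: "small_category J" "is_functor J PS D"
    "\<forall>j \<in> Obj J. omap D j \<in> representables A" "is_colimit J PS D P q"
    unfolding small_presheaf_def by blast
  from *(4) have "P \<in> Obj PS" by (simp add: is_colimit_def is_cocone_def)
  with * show thesis by (intro that[of J D q]) auto
qed

text \<open>The universal elements of the representables in the diagram generate, because the
  coprojections cover the colimit. The argument is valid before precompleteness is known, so it can
  be used to derive precompleteness from limits in \<open>PA A\<close>.\<close>

lemma small_generated:
  assumes "small_presheaf A P" shows "P \<in> Obj PS" and "generated (omap P) (amap P)"
proof -
  obtain J :: "('u, 'u) cat" and D q where J: "small_category J" and D: "is_functor J PS D"
    and rep: "\<And>j. j \<in> Obj J \<Longrightarrow> omap D j \<in> representables A" and col: "is_colimit J PS D P q"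
    and P: "P \<in> Obj PS"
    using small_presheaf_diagram[OF assms] by blast
  show "P \<in> Obj PS" by (rule P)
  have q: "\<And>j. j \<in> Obj J \<Longrightarrow> q j \<in> Hom PS (omap D j) P"
    using col by (simp add: is_colimit_def is_cocone_def)
  note Dj = functor_PS(1)[OF D]
  show "generated (omap P) (amap P)"
  proof (rule generated_cover[where M = "Obj J" and V = "\<lambda>j. omap (omap D j)" and
        actV = "\<lambda>j. amap (omap D j)" and \<phi> = q])
    show "usmall TYPE('u) (Obj J)" using J by (simp add: small_category_def small_iff_usmall)
    show "generated (omap (omap D j)) (amap (omap D j))" if "j \<in> Obj J" for j
      by (rule representables_universal_element[OF rep[OF that]]) (rule universal_element_generated)
    show "q j c x \<in> omap P c" if "j \<in> Obj J" "c \<in> ob" "x \<in> omap (omap D j) c" for j c x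
      by (rule hom_in[OF q[OF that(1)] that(2,3)])
    show "q j c (amap (omap D j) d c f x) = amap P d c f (q j d x)"
      if "j \<in> Obj J" "c \<in> ob" "d \<in> ob" "f \<in> Hom A c d" "x \<in> omap (omap D j) d" for j c d f x
      by (rule hom_natural[OF Dj[OF that(1)] P q[OF that(1)] that(2-5)])
    show "\<exists>j y. j \<in> Obj J \<and> y \<in> omap (omap D j) c \<and> x = q j c y" if "c \<in> ob" "x \<in> omap P c" for c x
      using colimit_covers[OF D col that] by blast
  qed
qed

text \<open>Elements of the colimit are equalized by \<open>h\<close> when lifts of them are joined
  by a zigzag after restriction along \<open>h\<close>. The sieves for the single lengths are
  generated, and their union over all lengths stays so because the universe is uncountable.\<close>

lemma small_imp_lucid:
  assumes pre: precomplete and small: "small_presheaf A P" shows "elementwise_lucid P"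
  unfolding elementwise_lucid_def
proof (intro conjI ballI small_generated[OF small])
  obtain J :: "('u, 'u) cat" and D q where J: "small_category J" and D: "is_functor J PS D"
    and rep: "\<And>j. j \<in> Obj J \<Longrightarrow> omap D j \<in> representables A" and col: "is_colimit J PS D P q"
    and P: "P \<in> Obj PS"
    using small_presheaf_diagram[OF small] by blast
  have sJ: "usmall TYPE('u) (Obj J)" using J by (simp add: small_category_def small_iff_usmall)
  have luc: "elementwise_lucid (omap D j)" if "j \<in> Obj J" for j
    by (rule representables_universal_element[OF rep[OF that]]) (rule representable_lucid[OF pre])
  have q: "\<And>j. j \<in> Obj J \<Longrightarrow> q j \<in> Hom PS (omap D j) P"
    using col by (simp add: is_colimit_def is_cocone_def)
  note Dj = functor_PS(1)[OF D]
  fix b x y assume b: "b \<in> ob" and x: "x \<in> omap P b" and y: "y \<in> omap P b"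
  from colimit_covers[OF D col b x] obtain i z where i: "i \<in> Obj J" "z \<in> omap (omap D i) b" "x = q i b z" by blast
  from colimit_covers[OF D col b y] obtain j w where j: "j \<in> Obj J" "w \<in> omap (omap D j) b" "y = q j b w" by blast
  have e: "(i, z) \<in> elements J D b" "(j, w) \<in> elements J D b" using i j by (auto simp: elements_def)
  have "gsieve b (\<lambda>c h. \<exists>n \<in> UNIV. (elements_act D b c h (i, z), elements_act D b c h (j, w)) \<in> link J D c ^^ n)"
    by (rule gsieve_UN[OF usmall_nat gsieve_relpow_link[OF pre J D luc b e]])
  then show "gsieve b (\<lambda>c h. amap P b c h x = amap P b c h y)"
  proof (rule gsieve_cong[rotated])
    fix c h assume c: "c \<in> ob" "h \<in> Hom A c b"
    have e': "elements_act D b c h (i, z) \<in> elements J D c" "elements_act D b c h (j, w) \<in> elements J D c"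
      by (intro elements_act_in[OF D] c b e)+
    have "amap P b c h x = q i c (amap (omap D i) b c h z)" "amap P b c h y = q j c (amap (omap D j) b c h w)"
      using hom_natural[OF Dj[OF i(1)] P q[OF i(1)] c(1) b c(2) i(2)]
        hom_natural[OF Dj[OF j(1)] P q[OF j(1)] c(1) b c(2) j(2)] i j by auto
    then have "amap P b c h x = amap P b c h y \<longleftrightarrow>
        (elements_act D b c h (i, z), elements_act D b c h (j, w)) \<in> (link J D c)\<^sup>*"
      using colimit_identifies[OF sJ D col c(1) e'[unfolded elements_act_def prod.case]]
        colimit_rtrancl_link[OF D col c(1), of "elements_act D b c h (i, z)" "elements_act D b c h (j, w)"]
      unfolding elements_act_def prod.case fst_conv snd_conv by argo
    then show "(\<exists>n \<in> UNIV. (elements_act D b c h (i, z), elements_act D b c h (j, w)) \<in> link J D c ^^ n) \<longleftrightarrow>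
        amap P b c h x = amap P b c h y"
      by (simp add: rtrancl_power)
  qed
qed

section \<open>The four conditions compared with precompleteness\<close>

lemma representables_lucid: "precomplete \<Longrightarrow> P \<in> representables A \<Longrightarrow> lucid A P"
  unfolding lucid_iff by (erule representables_universal_element) (rule representable_lucid)

text \<open>A limit in all presheaves remains one in any full subcategory that contains its vertex,
  and here the vertex is lucid. Suitable \<open>S\<close> and \<open>T\<close> give the limits in
  \<open>Pt A\<close>, \<open>Lcd A\<close> and \<open>PA A\<close> at once.\<close>

lemma lucid_limit:
  assumes pre: precomplete and S: "{P. lucid A P} \<subseteq> S" "S \<subseteq> Obj PS" and T: "T \<subseteq> {P. lucid A P}"
  shows "has_limits_of TYPE('u) (full_subcategory PS S) T"
  unfolding has_limits_of_def
proof (intro allI impI, elim conjE)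
  fix J :: "('u, 'u) cat" and D
  assume J: "small_category J" and D: "is_functor J (full_subcategory PS S) D"
    and "\<forall>j \<in> Obj J. omap D j \<in> T"
  then have luc: "\<And>j. j \<in> Obj J \<Longrightarrow> elementwise_lucid (omap D j)" using T lucid_iff by blast
  obtain L p where L: "is_limit J PS D L p" and "elementwise_lucid L"
    by (rule limit_of_lucid[OF pre J is_functor_full_subcategory(1)[OF D S(2)] luc])
  then have "L \<in> S" using S(1) lucid_iff by blast
  from is_limit_full_subcategory[OF L this S(2)]
  show "\<exists>L p. is_limit J (full_subcategory PS S) D L p" by blast
qed

lemma representables_small: "P \<in> representables A \<Longrightarrow> small_presheaf A P"
  by (erule representables_universal_element) (rule representable_small)

lemma small_eq_lucid: "precomplete \<Longrightarrow> {P. small_presheaf A P} = {P. lucid A P}"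
  using small_imp_lucid lucid_imp_small lucid_iff by blast

lemma lucid_subset_petty: "{P. lucid A P} \<subseteq> {P. petty A P}"
  by (auto simp: lucid_def)

lemma petty_subset: "{P. petty A P} \<subseteq> Obj PS"
  by (auto simp: petty_def)

lemma precomplete_iff_Pt: "has_limits_of TYPE('u) (Pt A) (representables A) \<longleftrightarrow> precomplete"
proof
  assume "has_limits_of TYPE('u) (Pt A) (representables A)"
  then show precomplete
    by (intro limits_imp_precomplete[of "{P. petty A P}"])
       (auto simp: Pt_def petty_iff petty_hom[unfolded petty_iff])
next
  assume precomplete
  then show "has_limits_of TYPE('u) (Pt A) (representables A)"
    unfolding Pt_def using lucid_subset_petty petty_subset representables_lucid
    by (intro lucid_limit) auto
qed

lemma precomplete_iff_Lcd:
  "complete TYPE('u) (Lcd A) \<and> representables A \<subseteq> Obj (Lcd A) \<longleftrightarrow> precomplete"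
proof
  assume *: "complete TYPE('u) (Lcd A) \<and> representables A \<subseteq> Obj (Lcd A)"
  then have "has_limits_of TYPE('u) (full_subcategory PS {P. lucid A P}) (representables A)"
    using complete_imp_limits unfolding Lcd_def by blast
  moreover have "hom_presheaf A a \<in> {P. lucid A P}" if "a \<in> ob" for a
    using * hom_presheaf_representable[OF that] by (auto simp: Lcd_def full_subcategory_def)
  ultimately show precomplete
    by (intro limits_imp_precomplete[of "{P. lucid A P}"]) (auto simp: lucid_def petty_iff)
next
  assume pre: precomplete
  then show "complete TYPE('u) (Lcd A) \<and> representables A \<subseteq> Obj (Lcd A)"
    using lucid_limit[OF pre, of "{P. lucid A P}" "{P. lucid A P}"] representables_lucid
      lucid_subset_petty petty_subset
    by (auto simp: complete_def Lcd_def full_subcategory_def)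
qed

lemma precomplete_iff_PA: "has_limits_of TYPE('u) (PA A) (representables A) \<longleftrightarrow> precomplete"
proof
  assume "has_limits_of TYPE('u) (PA A) (representables A)"
  then show precomplete
    using representables_small[OF hom_presheaf_representable] small_generated
    by (intro limits_imp_precomplete[of "{P. small_presheaf A P}"]) (auto simp: PA_def)
next
  assume pre: precomplete
  then show "has_limits_of TYPE('u) (PA A) (representables A)"
    unfolding PA_def small_eq_lucid[OF pre] using lucid_subset_petty petty_subset representables_lucid
    by (intro lucid_limit) auto
qed

lemma PA_eq_Lcd: "precomplete \<Longrightarrow> PA A = Lcd A"
  by (simp add: PA_def Lcd_def small_eq_lucid)

lemma precomplete_iff_complete_PA: "complete TYPE('u) (PA A) \<longleftrightarrow> precomplete"
proof
  assume "complete TYPE('u) (PA A)"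
  then have "has_limits_of TYPE('u) (PA A) (representables A)"
    by (rule complete_imp_limits) (auto simp: PA_def full_subcategory_def representables_small)
  then show precomplete by (simp add: precomplete_iff_PA)
next
  assume precomplete
  then show "complete TYPE('u) (PA A)" using PA_eq_Lcd precomplete_iff_Lcd by simp
qed

end

theorem proposition4p42:
  fixes A :: "('o, 'u::universe) cat"
  assumes "category A" and "locally_small A"
  shows "(has_limits_of TYPE('u) (Pt A) (representables A) \<longleftrightarrow>
            complete TYPE('u) (Lcd A) \<and> representables A \<subseteq> Obj (Lcd A)) \<and>
         (complete TYPE('u) (Lcd A) \<and> representables A \<subseteq> Obj (Lcd A) \<longleftrightarrow>
            has_limits_of TYPE('u) (PA A) (representables A)) \<and>
         (has_limits_of TYPE('u) (PA A) (representables A) \<longleftrightarrow>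
            complete TYPE('u) (PA A)) \<and>
         (complete TYPE('u) (PA A) \<longrightarrow> PA A = Lcd A)"
proof -
  interpret presheaves A using assms by unfold_locales
  show ?thesis
    using precomplete_iff_Pt precomplete_iff_Lcd precomplete_iff_PA precomplete_iff_complete_PA PA_eq_Lcd
    by blast
qed

end
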